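(* Let - (MUC): $(\exists \Omega^{3})(\forall \varphi^{2})(\forall f^{1},g^{1}\leq_1 1)[\overline f\,\Omega(\varphi)=\overline g\,\Omega(\varphi)\to \varphi(f)=\varphi(g)]$; - (SUP): $(\exists G^3)(\forall\varphi^2)[(\forall f^1\le_11)(\varphi(f)\le G(\varphi))\wedge(\exists g^1\le_11)(G(\varphi)=\varphi(g))]$; - ($\mathfrak N$): $(\forall^{\mathrm{st}}\varphi^2)(\exists^{\mathrm{st}}k_0^0)[(\forall f^1\le_11)(\varphi(f)\le k_0)\wedge(\exists^{\mathrm{st}}g^1\le_11)(k_0=\varphi(g))]$; - (SUP)$^\dagger$ and ($\mathfrak N$)$^\dagger$: the principles (SUP) and ($\mathfrak N$) in which the second conjunct is required to be witnessed by (the zero-extension of) a finite binary sequence $\sigma^0$, i.e. the second conjunct becomes $(\exists\sigma^0)(\sigma \text{ finite binary}\wedge G(\varphi)=\varphi(\sigma*00\dots))$, respectively $(\exists^{\mathrm{st}}\sigma^0)(\sigma\text{ finite binary}\wedge k_0=\varphi(\sigma*00\dots))$. Then $\mathrm{RCA}_0^\Omega$ proves $(\mathrm{SUP}^\dagger)^{\mathrm{st}}\leftrightarrow\mathfrak N^\dagger$, and $\mathrm{RCA}_0^\Omega+\mathrm{QF\text{-}AC}^{2,0}$ proves \[ \mathrm{MUC}\leftrightarrow\mathrm{SUP}\leftrightarrow\mathrm{SUP}^{\mathrm{st}}\leftrightarrow\mathfrak N\leftrightarrow\mathrm{SUP}^\dagger\leftrightarrow\mathfrak N^\dagger . \]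
   Context: Types: $0$ is the type of natural numbers, $\sigma\to\tau$ that of functionals from type $\sigma$ to type $\tau$; $1:=0\to0$, $2:=1\to0$, $3:=2\to0$. Superscripts indicate types; finitely many arguments or values are combined by standard currying/coding (so a functional taking arguments of type $2$ and $1$ to type $0$ is also given type $3$). For $f,g$ of type $1$, $f\le_1g$ means $(\forall n^0)(f(n)\le g(n))$; `$f\le_11$' says that $f$ is a $0/1$-sequence (an element of Cantor space); $\overline fn$ is (the code of) $\langle f(0),\dots,f(n-1)\rangle$; $\sigma*00\dots$ extends the finite sequence $\sigma$ by zeros. $\mathrm{RCA}_0^\omega$ (Kohlenbach) is $\mathrm{E\text{-}PRA}^\omega+\mathrm{QF\text{-}AC}^{1,0}$. Here $\mathrm{E\text{-}PRA}^\omega$ is classical arithmetic in all finite types with primitive equality $=_0$ only at type $0$ (at higher type, $x=_\tau y$ is defined as $xz_1\dots z_k=_0yz_1\dots z_k$ for all $z_i$), constants for zero, successor, the combinators and primitive recursion with values of type $0$, quantifier-free induction, and the extensionality axiom $x=_\rho y\to\varphi(x)=_\tau\varphi(y)$ for all $\varphi^{\rho\to\tau}$. $\mathrm{QF\text{-}AC}^{\sigma,0}$ is the schema $(\forall x^\sigma)(\exists n^0)A_0(x,n)\to(\exists F^{\sigma\to0})(\forall x^\sigma)A_0(x,F(x))$ for quantifier-free $A_0$. $\mathrm{RCA}_0^\Omega$ is $\mathrm{E\text{-}PRA}^{\omega*}_{\mathrm{st}}+\mathrm{QF\text{-}AC}^{1,0}+\mathrm I+\mathrm{HAC}_{\mathrm{int}}+\mathrm{PF\text{-}TP}_\forall$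 plus the constant axioms below. The language adds a type $\sigma^*$ of finite sequences of objects of type $\sigma$ and, for each type, a predicate $\mathrm{st}(x)$ (`$x$ is standard'). $(\forall^{\mathrm{st}}x)\Phi$ is $(\forall x)(\mathrm{st}(x)\to\Phi)$ and $(\exists^{\mathrm{st}}x)\Phi$ is $(\exists x)(\mathrm{st}(x)\wedge\Phi)$. A formula is internal if `st' does not occur in it; $A^{\mathrm{st}}$ is obtained from $A$ by appending `st' to all quantifiers except bounded number quantifiers. Basic axioms of $\mathrm{E\text{-}PRA}^{\omega*}_{\mathrm{st}}$: $\mathrm{st}(x)\wedge x=y\to\mathrm{st}(y)$; $\mathrm{st}(t)$ for closed terms $t$; $\mathrm{st}(f)\wedge\mathrm{st}(x)\to\mathrm{st}(f(x))$; numbers below a standard number are standard. I (for internal $\varphi$): $(\forall^{\mathrm{st}}x^{\sigma^*})(\exists y^\tau)(\forall z^\sigma\in x)\varphi(z,y)\to(\exists y^\tau)(\forall^{\mathrm{st}}x^\sigma)\varphi(x,y)$. $\mathrm{HAC}_{\mathrm{int}}$ (for internal $\varphi$): $(\forall^{\mathrm{st}}x^\rho)(\exists^{\mathrm{st}}y^\tau)\varphi(x,y)\to(\exists^{\mathrm{st}}F^{\rho\to\tau^*})(\forall^{\mathrm{st}}x^\rho)(\exists y^\tau\in F(x))\varphi(x,y)$. $\mathrm{PF\text{-}TP}_\forall$: $(\forall^{\mathrm{st}}x^\tau)\varphi(x)\to(\forall x^\tau)\varphi(x)$ for internal $\varphi(x)$ with no parameters other than $x$. Constant axioms: (i) there is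 a constant $\Omega_0$ with $\mathrm{st}(\Omega_0)\wedge(\forall^{\mathrm{st}}\Xi^3)[M^{\mathrm{st}}(\Xi)\to(\forall^{\mathrm{st}}\varphi^2)(\Omega_0(\varphi)=\Xi(\varphi))]$, where $M(\Xi)$ says that for all $\varphi^2$, $\Xi(\varphi)$ is the least $n$ with $(\forall f,g\le_11)(\overline fn=\overline gn\to\varphi(f)=\varphi(g))$; and analogous constants and axioms for other functionals uniquely defined by a parameter-free internal formula; (ii) there is a constant $\Lambda_0^3$ with $\mathrm{st}(\Lambda_0)$ and $(\forall^{\mathrm{st}}\Upsilon^3)[K^{\mathrm{st}}(\Upsilon)\to(\forall^{\mathrm{st}}\varphi^2,f^1\le_11)(\Xi(\varphi,\Upsilon(\varphi,\cdot))(\overline f\Lambda_0(\varphi,f))=\varphi(f)+1)]$, where $K(\Upsilon)$ is $(\forall\varphi^2,f^1,g^1\le_11)(\overline f\Upsilon(\varphi,f)=\overline g\Upsilon(\varphi,f)\to\varphi(f)=\varphi(g))$ and $\Xi(\varphi,\omega)$ is the associate of $\varphi$ computed from a modulus $\omega$: $\Xi(\varphi,\omega)(\sigma)=\varphi(\sigma*00\dots)+1$ if $\omega(\sigma*00\dots)\le|\sigma|$, and $0$ otherwise. *)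

theory Defs
  imports Main
begin

section \<open>Syntax\<close>

text \<open>
  Finite types over the numbers \<open>N\<close>, with \<open>Sq \<sigma>\<close> for the type \<open>\<sigma>\<^sup>*\<close> of finite sequences.
  A variable is a pair of an index and its type, so variables of different types are distinct.
\<close>

datatype ty = N | Fn ty ty  (infixr \<open>\<rightarrow>\<close> 80) | Sq ty

type_synonym var = "nat \<times> ty"

abbreviation "ty1 \<equiv> N \<rightarrow> N"
abbreviation "ty2 \<equiv> ty1 \<rightarrow> N"
abbreviation "ty3 \<equiv> ty2 \<rightarrow> N"

text \<open>
  The only primitive equality is at type \<open>N\<close>. \<open>St t\<close> says that \<open>t\<close> is standard, at the type of \<open>t\<close>.
  \<open>BAll i t A\<close> is the bounded number quantifier ``for all \<open>n < t\<close>'', binding the variable \<open>(i, N)\<close>;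
  it is a separate constructor because relativisation to \<open>St\<close> leaves it untouched.

  A type \<open>Sq \<sigma>\<close> consists of pairs of a length and an enumeration: \<open>Mk \<sigma> f n\<close> is the sequence
  \<open>f 0, ..., f (n - 1)\<close>, and \<open>Len\<close>, \<open>At\<close> recover length and entries; empty sequence, prefixing,
  concatenation etc. are explicitly definable from these.

  \<open>Def x A\<close> is a constant of the type of \<open>x\<close> for the functional defined by the formula \<open>A\<close> in the
  variable \<open>x\<close>. The formula inside it is part of the name: its variables are never free in a term.
\<close>

datatype trm = Var var | Cn cnst | App trm trm  (infixl \<open>\<cdot>\<close> 100)
  and cnst = Zero | Succ | CombK ty ty | CombS ty ty ty | Rec
    | Len ty | At ty | Mk ty | Lambda0 | Def var fm
  and fm = Eq trm trm | St trm | Fls | Imp fm fm  (infixr \<open>\<^bold>\<longrightarrow>\<close> 25)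
    | Forall var fm | BAll nat trm fm

abbreviation Neg :: "fm \<Rightarrow> fm"  (\<open>\<^bold>\<not> _\<close> [40] 40) where "\<^bold>\<not> A \<equiv> A \<^bold>\<longrightarrow> Fls"
abbreviation And :: "fm \<Rightarrow> fm \<Rightarrow> fm"  (infixr \<open>\<^bold>\<and>\<close> 35) where "A \<^bold>\<and> B \<equiv> \<^bold>\<not> (A \<^bold>\<longrightarrow> \<^bold>\<not> B)"
abbreviation Iff :: "fm \<Rightarrow> fm \<Rightarrow> fm"  (infix \<open>\<^bold>\<longleftrightarrow>\<close> 25)
  where "A \<^bold>\<longleftrightarrow> B \<equiv> (A \<^bold>\<longrightarrow> B) \<^bold>\<and> (B \<^bold>\<longrightarrow> A)"
abbreviation Exists :: "var \<Rightarrow> fm \<Rightarrow> fm" where "Exists x A \<equiv> \<^bold>\<not> Forall x (\<^bold>\<not> A)"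
abbreviation BEx :: "nat \<Rightarrow> trm \<Rightarrow> fm \<Rightarrow> fm" where "BEx i t A \<equiv> \<^bold>\<not> BAll i t (\<^bold>\<not> A)"
abbreviation AllSt :: "var \<Rightarrow> fm \<Rightarrow> fm" where "AllSt x A \<equiv> Forall x (St (Var x) \<^bold>\<longrightarrow> A)"
abbreviation ExSt :: "var \<Rightarrow> fm \<Rightarrow> fm" where "ExSt x A \<equiv> Exists x (St (Var x) \<^bold>\<and> A)"

primrec ctyp :: "cnst \<Rightarrow> ty" where
  "ctyp Zero = N"
| "ctyp Succ = N \<rightarrow> N"
| "ctyp (CombK \<sigma> \<tau>) = \<sigma> \<rightarrow> \<tau> \<rightarrow> \<sigma>"
| "ctyp (CombS \<rho> \<sigma> \<tau>) = (\<rho> \<rightarrow> \<sigma> \<rightarrow> \<tau>) \<rightarrow> (\<rho> \<rightarrow> \<sigma>) \<rightarrow> \<rho> \<rightarrow> \<tau>"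
| "ctyp Rec = N \<rightarrow> N \<rightarrow> (N \<rightarrow> N \<rightarrow> N) \<rightarrow> N"
| "ctyp (Len \<sigma>) = Sq \<sigma> \<rightarrow> N"
| "ctyp (At \<sigma>) = Sq \<sigma> \<rightarrow> N \<rightarrow> \<sigma>"
| "ctyp (Mk \<sigma>) = (N \<rightarrow> \<sigma>) \<rightarrow> N \<rightarrow> Sq \<sigma>"
| "ctyp Lambda0 = ty2 \<rightarrow> ty1 \<rightarrow> N"
| "ctyp (Def x A) = snd x"

text \<open>\<open>tyof\<close> is only meaningful on terms satisfying \<open>wft\<close>.\<close>

fun tyof :: "trm \<Rightarrow> ty" where
  "tyof (Var x) = snd x"
| "tyof (Cn c) = ctyp c"
| "tyof (s \<cdot> t) = (case tyof s of \<sigma> \<rightarrow> \<tau> \<Rightarrow> \<tau> | _ \<Rightarrow> N)"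

fun fvt :: "trm \<Rightarrow> var set" where
  "fvt (Var x) = {x}"
| "fvt (Cn c) = {}"
| "fvt (s \<cdot> t) = fvt s \<union> fvt t"

fun fv :: "fm \<Rightarrow> var set" where
  "fv (Eq s t) = fvt s \<union> fvt t"
| "fv (St t) = fvt t"
| "fv Fls = {}"
| "fv (A \<^bold>\<longrightarrow> B) = fv A \<union> fv B"
| "fv (Forall x A) = fv A - {x}"
| "fv (BAll i t A) = fvt t \<union> (fv A - {(i, N)})"

fun internal :: "fm \<Rightarrow> bool" where
  "internal (Eq s t) = True"
| "internal (St t) = False"
| "internal Fls = True"
| "internal (A \<^bold>\<longrightarrow> B) = (internal A \<and> internal B)"
| "internal (Forall x A) = internal A"
| "internal (BAll i t A) = internal A"

fun qf :: "fm \<Rightarrow> bool" where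
  "qf (Eq s t) = True"
| "qf (St t) = False"
| "qf Fls = True"
| "qf (A \<^bold>\<longrightarrow> B) = (qf A \<and> qf B)"
| "qf (Forall x A) = False"
| "qf (BAll i t A) = False"

text \<open>
  Well-formedness. The constant \<open>Def x A\<close> exists for every parameter-free internal \<open>A\<close>; it is an
  uninterpreted symbol unless \<open>A\<close> is one of the formulas covered by \<open>DefAx\<close> below.
\<close>

fun wft :: "trm \<Rightarrow> bool" and wfc :: "cnst \<Rightarrow> bool" and wff :: "fm \<Rightarrow> bool" where
  "wft (Var x) = True"
| "wft (Cn c) = wfc c"
| "wft (s \<cdot> t) = (wft s \<and> wft t \<and> tyof s = tyof t \<rightarrow> tyof (s \<cdot> t))"
| "wfc (Def x A) = (wff A \<and> internal A \<and> fv A \<subseteq> {x})"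
| "wfc c = True"
| "wff (Eq s t) = (wft s \<and> wft t \<and> tyof s = N \<and> tyof t = N)"
| "wff (St t) = wft t"
| "wff Fls = True"
| "wff (A \<^bold>\<longrightarrow> B) = (wff A \<and> wff B)"
| "wff (Forall x A) = wff A"
| "wff (BAll i t A) = (wft t \<and> tyof t = N \<and> (i, N) \<notin> fvt t \<and> wff A)"

fun sbt :: "var \<Rightarrow> trm \<Rightarrow> trm \<Rightarrow> trm" where
  "sbt x s (Var y) = (if y = x then s else Var y)"
| "sbt x s (Cn c) = Cn c"
| "sbt x s (t \<cdot> u) = sbt x s t \<cdot> sbt x s u"

fun sbf :: "var \<Rightarrow> trm \<Rightarrow> fm \<Rightarrow> fm" where
  "sbf x s (Eq t u) = Eq (sbt x s t) (sbt x s u)"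
| "sbf x s (St t) = St (sbt x s t)"
| "sbf x s Fls = Fls"
| "sbf x s (A \<^bold>\<longrightarrow> B) = (sbf x s A \<^bold>\<longrightarrow> sbf x s B)"
| "sbf x s (Forall y A) = Forall y (if y = x then A else sbf x s A)"
| "sbf x s (BAll i t A) = BAll i (sbt x s t) (if (i, N) = x then A else sbf x s A)"

fun free_for :: "trm \<Rightarrow> var \<Rightarrow> fm \<Rightarrow> bool" where
  "free_for s x (A \<^bold>\<longrightarrow> B) = (free_for s x A \<and> free_for s x B)"
| "free_for s x (Forall y A) = (x \<notin> fv (Forall y A) \<or> y \<notin> fvt s \<and> free_for s x A)"
| "free_for s x (BAll i t A) = (x \<notin> fv (BAll i t A) \<or> (i, N) \<notin> fvt s \<and> free_for s x A)"
| "free_for s x A = True"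

text \<open>
  The formula \<open>A\<^sup>s\<^sup>t\<close>. Since \<open>Exists\<close> is \<open>\<not>\<forall>\<not>\<close>, existential quantifiers are relativised as well.
\<close>

fun rel_st :: "fm \<Rightarrow> fm" where
  "rel_st (A \<^bold>\<longrightarrow> B) = (rel_st A \<^bold>\<longrightarrow> rel_st B)"
| "rel_st (Forall x A) = AllSt x (rel_st A)"
| "rel_st (BAll i t A) = BAll i t (rel_st A)"
| "rel_st A = A"


section \<open>Closed terms for primitive recursive functions and sequence codes\<close>

text \<open>Lambda abstraction, by the usual translation into combinators.\<close>

fun lam :: "var \<Rightarrow> trm \<Rightarrow> trm" where
  "lam x (Var y) =
    (if y = x
     then Cn (CombS (snd x) (snd x \<rightarrow> snd x) (snd x)) \<cdot> Cn (CombK (snd x) (snd x \<rightarrow> snd x))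
            \<cdot> Cn (CombK (snd x) (snd x))
     else Cn (CombK (snd y) (snd x)) \<cdot> Var y)"
| "lam x (Cn c) = Cn (CombK (ctyp c) (snd x)) \<cdot> Cn c"
| "lam x (s \<cdot> t) =
    (if x \<in> fvt (s \<cdot> t)
     then Cn (CombS (snd x) (tyof t) (tyof (s \<cdot> t))) \<cdot> lam x s \<cdot> lam x t
     else Cn (CombK (tyof (s \<cdot> t)) (snd x)) \<cdot> (s \<cdot> t))"

abbreviation "v i \<equiv> Var (i, N)"
abbreviation "lamN i t \<equiv> lam (i, N) t"

abbreviation "zero \<equiv> Cn Zero"
abbreviation "suc t \<equiv> Cn Succ \<cdot> t"

text \<open>
  In the definitions of this section \<open>recN t b a i e\<close> is the value at \<open>t\<close> of the function given by
  primitive recursion from the start value \<open>b\<close> with step \<open>e\<close>, where in \<open>e\<close> the variable \<open>v a\<close> stands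
  for the previous value and \<open>v i\<close> for the previous argument.
\<close>

abbreviation "recN t b a i e \<equiv> Cn Rec \<cdot> t \<cdot> b \<cdot> lamN a (lamN i e)"

definition addT :: trm where "addT = lamN 0 (lamN 1 (recN (v 1) (v 0) 2 3 (suc (v 2))))"
definition predT :: trm where "predT = lamN 0 (recN (v 0) zero 1 2 (v 2))"
definition subT :: trm where "subT = lamN 0 (lamN 1 (recN (v 1) (v 0) 2 3 (predT \<cdot> v 2)))"

abbreviation "le s t \<equiv> Eq (subT \<cdot> s \<cdot> t) zero"
abbreviation "lt s t \<equiv> le (suc s) t"

text \<open>\<open>condT c a b\<close> is \<open>a\<close> if \<open>c = 0\<close>, and \<open>b\<close> otherwise.\<close>

definition condT :: trm where
  "condT = lamN 0 (lamN 1 (lamN 2 (recN (v 0) (v 1) 3 4 (v 2))))"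

text \<open>
  Cantor pairing \<open>pair a b = (a + b) (a + b + 1) / 2 + b\<close> with its projections; \<open>rootT p\<close> is the
  largest \<open>w\<close> whose triangular number is at most \<open>p\<close>.
\<close>

definition triT :: trm where "triT = lamN 0 (recN (v 0) zero 1 2 (addT \<cdot> v 1 \<cdot> suc (v 2)))"
definition pairT :: trm where
  "pairT = lamN 0 (lamN 1 (addT \<cdot> (triT \<cdot> (addT \<cdot> v 0 \<cdot> v 1)) \<cdot> v 1))"
definition rootT :: trm where
  "rootT = lamN 0 (recN (v 0) zero 1 2
     (condT \<cdot> (subT \<cdot> (triT \<cdot> suc (v 1)) \<cdot> suc (v 2)) \<cdot> suc (v 1) \<cdot> v 1))"
definition sndT :: trm where "sndT = lamN 0 (subT \<cdot> v 0 \<cdot> (triT \<cdot> (rootT \<cdot> v 0)))"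
definition fstT :: trm where "fstT = lamN 0 (subT \<cdot> (rootT \<cdot> v 0) \<cdot> (sndT \<cdot> v 0))"

text \<open>
  Every number codes a finite sequence of numbers: \<open>0\<close> codes the empty one, and \<open>pair s a + 1\<close>
  codes the sequence coded by \<open>s\<close> followed by the entry \<open>a\<close>. \<open>codeT f n\<close> is the code of
  \<open>f 0, ..., f (n - 1)\<close>; \<open>cutT s k\<close> removes the last \<open>k\<close> entries; \<open>lhT\<close> is the length, computed as
  the number of \<open>k < s\<close> with \<open>cutT s k \<noteq> 0\<close>; \<open>extT s\<close> is the extension of the sequence by zeros,
  as a function of type \<open>1\<close>.
\<close>

definition codeT :: trm where
  "codeT = lam (0, ty1) (lamN 1 (recN (v 1) zero 2 3
     (suc (pairT \<cdot> v 2 \<cdot> (Var (0, ty1) \<cdot> v 3)))))"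
definition cutT :: trm where
  "cutT = lamN 0 (lamN 1 (recN (v 1) (v 0) 2 3 (fstT \<cdot> (predT \<cdot> v 2))))"
definition lhT :: trm where
  "lhT = lamN 0 (recN (v 0) zero 1 2
     (condT \<cdot> (cutT \<cdot> v 0 \<cdot> v 2) \<cdot> v 1 \<cdot> suc (v 1)))"
definition extT :: trm where
  "extT = lamN 0 (lamN 1
     (condT \<cdot> (subT \<cdot> suc (v 1) \<cdot> (lhT \<cdot> v 0))
        \<cdot> (sndT \<cdot> (predT \<cdot> (cutT \<cdot> v 0 \<cdot> (subT \<cdot> (lhT \<cdot> v 0) \<cdot> suc (v 1)))))
        \<cdot> zero))"

text \<open>
  The associate \<open>\<Xi>(\<phi>, \<omega>)\<close> of \<open>\<phi>\<close> obtained from a modulus \<open>\<omega>\<close>, of type \<open>2 \<rightarrow> 2 \<rightarrow> 0 \<rightarrow> 0\<close>.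
\<close>

definition assocT :: trm where
  "assocT = lam (0, ty2) (lam (1, ty2) (lamN 2
     (condT \<cdot> (subT \<cdot> (Var (1, ty2) \<cdot> (extT \<cdot> v 2)) \<cdot> (lhT \<cdot> v 2))
        \<cdot> suc (Var (0, ty2) \<cdot> (extT \<cdot> v 2))
        \<cdot> zero)))"


section \<open>Defined formulas\<close>

text \<open>\<open>(fresh t, \<sigma>)\<close> does not occur in \<open>t\<close>.\<close>

fun fresh :: "trm \<Rightarrow> nat" where
  "fresh (Var x) = Suc (fst x)"
| "fresh (Cn c) = 0"
| "fresh (s \<cdot> t) = max (fresh s) (fresh t)"

primrec eq :: "ty \<Rightarrow> trm \<Rightarrow> trm \<Rightarrow> fm" where
  "eq N s t = Eq s t"
| "eq (\<sigma> \<rightarrow> \<tau>) s t =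
    (let z = (fresh (s \<cdot> t), \<sigma>) in Forall z (eq \<tau> (s \<cdot> Var z) (t \<cdot> Var z)))"
| "eq (Sq \<sigma>) s t =
    (let i = fresh (s \<cdot> t) in
      Eq (Cn (Len \<sigma>) \<cdot> s) (Cn (Len \<sigma>) \<cdot> t)
      \<^bold>\<and> BAll i (Cn (Len \<sigma>) \<cdot> s) (eq \<sigma> (Cn (At \<sigma>) \<cdot> s \<cdot> v i) (Cn (At \<sigma>) \<cdot> t \<cdot> v i)))"

definition mem :: "ty \<Rightarrow> trm \<Rightarrow> trm \<Rightarrow> fm" where
  "mem \<sigma> z s =
    (let i = fresh (z \<cdot> s) in BEx i (Cn (Len \<sigma>) \<cdot> s) (eq \<sigma> z (Cn (At \<sigma>) \<cdot> s \<cdot> v i)))"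

text \<open>\<open>f \<le>\<^sub>1 1\<close>\<close>

definition cantor :: "trm \<Rightarrow> fm" where
  "cantor f = (let i = fresh f in Forall (i, N) (le (f \<cdot> v i) (suc zero)))"

abbreviation "AllC f A \<equiv> Forall f (cantor (Var f) \<^bold>\<longrightarrow> A)"
abbreviation "ExC f A \<equiv> Exists f (cantor (Var f) \<^bold>\<and> A)"

text \<open>The number \<open>s\<close> codes a finite binary sequence.\<close>

definition binary :: "trm \<Rightarrow> fm" where
  "binary s = (let i = fresh s in BAll i (lhT \<cdot> s) (le (extT \<cdot> s \<cdot> v i) (suc zero)))"


section \<open>Derivability\<close>

text \<open>
  Classical many-sorted predicate logic with equality at type \<open>N\<close>. The side condition in \<open>ax\<close>
  discards ill-typed instances of the axiom schemata in \<open>T\<close>. Free variables of axioms are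
  understood universally.
\<close>

inductive prv :: "fm set \<Rightarrow> fm \<Rightarrow> bool"  (infix \<open>\<turnstile>\<close> 20) for T :: "fm set" where
  ax: "A \<in> T \<Longrightarrow> wff A \<Longrightarrow> T \<turnstile> A"
| imp_k: "wff A \<Longrightarrow> wff B \<Longrightarrow> T \<turnstile> A \<^bold>\<longrightarrow> B \<^bold>\<longrightarrow> A"
| imp_s: "wff A \<Longrightarrow> wff B \<Longrightarrow> wff C \<Longrightarrow>
    T \<turnstile> (A \<^bold>\<longrightarrow> B \<^bold>\<longrightarrow> C) \<^bold>\<longrightarrow> (A \<^bold>\<longrightarrow> B) \<^bold>\<longrightarrow> A \<^bold>\<longrightarrow> C"
| dne: "wff A \<Longrightarrow> T \<turnstile> \<^bold>\<not> \<^bold>\<not> A \<^bold>\<longrightarrow> A"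
| mp: "T \<turnstile> A \<^bold>\<longrightarrow> B \<Longrightarrow> T \<turnstile> A \<Longrightarrow> T \<turnstile> B"
| all_inst: "wff A \<Longrightarrow> wft t \<Longrightarrow> tyof t = snd x \<Longrightarrow> free_for t x A \<Longrightarrow> T \<turnstile> Forall x A \<^bold>\<longrightarrow> sbf x t A"
| all_imp: "wff A \<Longrightarrow> wff B \<Longrightarrow> x \<notin> fv A \<Longrightarrow> T \<turnstile> Forall x (A \<^bold>\<longrightarrow> B) \<^bold>\<longrightarrow> A \<^bold>\<longrightarrow> Forall x B"
| gen: "T \<turnstile> A \<Longrightarrow> T \<turnstile> Forall x A"
| ball: "wff (BAll i t A) \<Longrightarrow> T \<turnstile> BAll i t A \<^bold>\<longleftrightarrow> Forall (i, N) (lt (v i) t \<^bold>\<longrightarrow> A)"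
| eq_refl: "wff (Eq t t) \<Longrightarrow> T \<turnstile> Eq t t"
| eq_subst: "wff (Eq s t) \<Longrightarrow> wff A \<Longrightarrow> free_for s (i, N) A \<Longrightarrow> free_for t (i, N) A \<Longrightarrow>
    T \<turnstile> Eq s t \<^bold>\<longrightarrow> sbf (i, N) s A \<^bold>\<longrightarrow> sbf (i, N) t A"


section \<open>The systems\<close>

inductive_set EPRA :: "fm set" where
  suc_nonzero: "(\<^bold>\<not> Eq (suc t) zero) \<in> EPRA"
| suc_inj: "(Eq (suc s) (suc t) \<^bold>\<longrightarrow> Eq s t) \<in> EPRA"
| combK: "eq \<sigma> (Cn (CombK \<sigma> \<tau>) \<cdot> s \<cdot> t) s \<in> EPRA"
| combS: "eq \<tau> (Cn (CombS \<rho> \<sigma> \<tau>) \<cdot> r \<cdot> s \<cdot> t) (r \<cdot> t \<cdot> (s \<cdot> t)) \<in> EPRA"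
| rec_zero: "Eq (Cn Rec \<cdot> zero \<cdot> s \<cdot> t) s \<in> EPRA"
| rec_suc: "Eq (Cn Rec \<cdot> suc r \<cdot> s \<cdot> t) (t \<cdot> (Cn Rec \<cdot> r \<cdot> s \<cdot> t) \<cdot> r) \<in> EPRA"
| len_mk: "Eq (Cn (Len \<sigma>) \<cdot> (Cn (Mk \<sigma>) \<cdot> s \<cdot> t)) t \<in> EPRA"
| at_mk: "(lt r t \<^bold>\<longrightarrow> eq \<sigma> (Cn (At \<sigma>) \<cdot> (Cn (Mk \<sigma>) \<cdot> s \<cdot> t) \<cdot> r) (s \<cdot> r)) \<in> EPRA"
| ext: "(eq \<rho> s t \<^bold>\<longrightarrow> eq \<tau> (r \<cdot> s) (r \<cdot> t)) \<in> EPRA"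
| qf_ind: "qf A \<Longrightarrow>
    (sbf (i, N) zero A \<^bold>\<longrightarrow> Forall (i, N) (A \<^bold>\<longrightarrow> sbf (i, N) (suc (v i)) A) \<^bold>\<longrightarrow> Forall (i, N) A) \<in> EPRA"

text \<open>\<open>QFAC \<sigma>\<close> is the schema \<open>QF-AC\<^bsup>\<sigma>,0\<^esup>\<close>.\<close>

inductive_set QFAC :: "ty \<Rightarrow> fm set" for \<sigma> :: ty where
  "qf A \<Longrightarrow> snd x = \<sigma> \<Longrightarrow> x \<noteq> (n, N) \<Longrightarrow> F \<notin> fv A \<Longrightarrow> snd F = \<sigma> \<rightarrow> N \<Longrightarrow>
    (Forall x (Exists (n, N) A) \<^bold>\<longrightarrow> Exists F (Forall x (sbf (n, N) (Var F \<cdot> Var x) A))) \<in> QFAC \<sigma>"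

definition RCA0\<omega> :: "fm set" where "RCA0\<omega> = EPRA \<union> QFAC ty1"

inductive_set StAx :: "fm set" where
  st_eq: "(St s \<^bold>\<and> eq \<sigma> s t \<^bold>\<longrightarrow> St t) \<in> StAx"
| st_closed: "fvt t = {} \<Longrightarrow> St t \<in> StAx"
| st_app: "(St s \<^bold>\<and> St t \<^bold>\<longrightarrow> St (s \<cdot> t)) \<in> StAx"
| st_le: "(St t \<^bold>\<and> le s t \<^bold>\<longrightarrow> St s) \<in> StAx"

inductive_set Idealisation :: "fm set" where
  "internal A \<Longrightarrow> snd x = Sq (snd z) \<Longrightarrow> x \<notin> fv A \<Longrightarrow> y \<noteq> z \<Longrightarrow> y \<noteq> x \<Longrightarrow>
    (AllSt x (Exists y (Forall z (mem (snd z) (Var z) (Var x) \<^bold>\<longrightarrow> A))) \<^bold>\<longrightarrow> Exists y (AllSt z A))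
      \<in> Idealisation"

inductive_set HACint :: "fm set" where
  "internal A \<Longrightarrow> x \<noteq> y \<Longrightarrow> snd F = snd x \<rightarrow> Sq (snd y) \<Longrightarrow> F \<notin> fv A \<Longrightarrow>
    (AllSt x (ExSt y A) \<^bold>\<longrightarrow> ExSt F (AllSt x (Exists y (mem (snd y) (Var y) (Var F \<cdot> Var x) \<^bold>\<and> A))))
      \<in> HACint"

inductive_set PFTP :: "fm set" where
  "internal A \<Longrightarrow> fv A \<subseteq> {x} \<Longrightarrow> (AllSt x A \<^bold>\<longrightarrow> Forall x A) \<in> PFTP"

text \<open>
  \<open>const_ax x M\<close> says that the constant of \<open>M\<close> is standard and agrees, on standard arguments, with
  every standard \<open>x\<close> satisfying \<open>M\<^sup>s\<^sup>t\<close>.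
\<close>

definition const_ax :: "var \<Rightarrow> fm \<Rightarrow> fm" where
  "const_ax x M = (St (Cn (Def x M))
     \<^bold>\<and> AllSt x (rel_st M \<^bold>\<longrightarrow> rel_st (eq (snd x) (Cn (Def x M)) (Var x))))"

abbreviation vphi :: var where "vphi \<equiv> (0, ty2)"
abbreviation vf :: var where "vf \<equiv> (0, ty1)"
abbreviation vg :: var where "vg \<equiv> (1, ty1)"

text \<open>
  \<open>t\<close> is a modulus of uniform continuity on Cantor space of the functional \<open>vphi\<close>, which is free in
  the formula; \<open>t\<close> must not contain \<open>vf\<close> or \<open>vg\<close>.
\<close>

definition cont_mod :: "trm \<Rightarrow> fm" where
  "cont_mod t = AllC vf (AllC vg
     (Eq (codeT \<cdot> Var vf \<cdot> t) (codeT \<cdot> Var vg \<cdot> t) \<^bold>\<longrightarrow> Eq (Var vphi \<cdot> Var vf) (Var vphi \<cdot> Var vg)))"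

text \<open>\<open>M_fm\<close> is \<open>M(\<Xi>)\<close>, with \<open>\<Xi>\<close> the variable \<open>(0, ty3)\<close>, and \<open>\<Omega>\<^sub>0\<close> is its constant.\<close>

definition M_fm :: fm where
  "M_fm = Forall vphi
     (cont_mod (Var (0, ty3) \<cdot> Var vphi)
      \<^bold>\<and> BAll 0 (Var (0, ty3) \<cdot> Var vphi) (\<^bold>\<not> cont_mod (v 0)))"

text \<open>
  ``Uniquely defined'' is read as: uniqueness of the functional satisfying the formula is provable
  in \<open>RCA0\<omega>\<close>. Existence is not required, since the axiom only concerns those \<open>x\<close> that satisfy
  the relativised formula.
\<close>

inductive_set DefAx :: "fm set" where
  Omega0: "const_ax (0, ty3) M_fm \<in> DefAx"
| other: "wff M \<Longrightarrow> internal M \<Longrightarrow> fv M \<subseteq> {x} \<Longrightarrow> snd y = snd x \<Longrightarrow> y \<noteq> x \<Longrightarrow> free_for (Var y) x M \<Longrightarrow>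
    RCA0\<omega> \<turnstile> Forall x (Forall y (M \<^bold>\<and> sbf x (Var y) M \<^bold>\<longrightarrow> eq (snd x) (Var x) (Var y))) \<Longrightarrow>
    const_ax x M \<in> DefAx"

abbreviation vUps :: var where "vUps \<equiv> (0, ty2 \<rightarrow> ty1 \<rightarrow> N)"

definition K_fm :: fm where
  "K_fm = (let n = Var vUps \<cdot> Var vphi \<cdot> Var vf in Forall vphi (AllC vf (AllC vg
     (Eq (codeT \<cdot> Var vf \<cdot> n) (codeT \<cdot> Var vg \<cdot> n)
      \<^bold>\<longrightarrow> Eq (Var vphi \<cdot> Var vf) (Var vphi \<cdot> Var vg)))))"

definition Lambda0_ax :: fm where
  "Lambda0_ax = (St (Cn Lambda0)
     \<^bold>\<and> AllSt vUps (rel_st K_fm \<^bold>\<longrightarrow>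
         AllSt vphi (AllSt vf (cantor (Var vf) \<^bold>\<longrightarrow>
           Eq (assocT \<cdot> Var vphi \<cdot> (Var vUps \<cdot> Var vphi)
                 \<cdot> (codeT \<cdot> Var vf \<cdot> (Cn Lambda0 \<cdot> Var vphi \<cdot> Var vf)))
              (suc (Var vphi \<cdot> Var vf))))))"

definition RCA0\<Omega> :: "fm set" where
  "RCA0\<Omega> = RCA0\<omega> \<union> StAx \<union> Idealisation \<union> HACint \<union> PFTP \<union> DefAx \<union> {Lambda0_ax}"


section \<open>The principles\<close>

abbreviation vOmega :: var where "vOmega \<equiv> (0, ty3)"
abbreviation vG :: var where "vG \<equiv> (0, ty3)"
abbreviation vk :: var where "vk \<equiv> (0, N)"
abbreviation vsigma :: var where "vsigma \<equiv> (1, N)"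

definition MUC_fm :: fm where
  "MUC_fm = Exists vOmega (Forall vphi (AllC vf (AllC vg
     (Eq (codeT \<cdot> Var vf \<cdot> (Var vOmega \<cdot> Var vphi)) (codeT \<cdot> Var vg \<cdot> (Var vOmega \<cdot> Var vphi))
      \<^bold>\<longrightarrow> Eq (Var vphi \<cdot> Var vf) (Var vphi \<cdot> Var vg)))))"

definition SUP_fm :: fm where
  "SUP_fm = Exists vG (Forall vphi
     (AllC vf (le (Var vphi \<cdot> Var vf) (Var vG \<cdot> Var vphi))
      \<^bold>\<and> ExC vg (Eq (Var vG \<cdot> Var vphi) (Var vphi \<cdot> Var vg))))"

definition N_fm :: fm where
  "N_fm = AllSt vphi (ExSt vk
     (AllC vf (le (Var vphi \<cdot> Var vf) (Var vk))
      \<^bold>\<and> ExSt vg (cantor (Var vg) \<^bold>\<and> Eq (Var vk) (Var vphi \<cdot> Var vg))))"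

definition SUP_dagger_fm :: fm where
  "SUP_dagger_fm = Exists vG (Forall vphi
     (AllC vf (le (Var vphi \<cdot> Var vf) (Var vG \<cdot> Var vphi))
      \<^bold>\<and> Exists vsigma (binary (Var vsigma)
            \<^bold>\<and> Eq (Var vG \<cdot> Var vphi) (Var vphi \<cdot> (extT \<cdot> Var vsigma)))))"

definition N_dagger_fm :: fm where
  "N_dagger_fm = AllSt vphi (ExSt vk
     (AllC vf (le (Var vphi \<cdot> Var vf) (Var vk))
      \<^bold>\<and> ExSt vsigma (binary (Var vsigma) \<^bold>\<and> Eq (Var vk) (Var vphi \<cdot> (extT \<cdot> Var vsigma)))))"

end

theory Submission
  imports Defs "HOL-Library.Countable"
begin

text \<open>
  Derivability is reduced to truth by a completeness theorem: if \<open>T\<close> extends \<open>EPRA\<close>, a formula holding in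
  all extensional models of \<open>T\<close> is derivable, provided it is internal or \<open>T\<close> contains \<open>StAx\<close>. In a model, all equivalences are proved by ordinary
  mathematics over its (nonstandard) numbers.

  From \<open>SUP\<close> to \<open>MUC\<close>: \<open>QF-AC\<^bsup>2,0\<^esup>\<close> applied to the axiom of extensionality yields
  \<open>\<Psi>\<close> such that \<open>f\<close> and \<open>g\<close> differ at \<open>\<Psi>(\<phi>, f, g)\<close> whenever \<open>\<phi>(f) \<noteq> \<phi>(g)\<close>; the supremum of
  \<open>\<Psi>(\<phi>, \<cdot>, \<cdot>)\<close> over Cantor space, plus one, is a modulus of uniform continuity. Conversely a modulus
  bounds the lengths of the binary sequences at which the maximum is to be sought. A standard \<open>\<Psi>\<close>,
  which exists by transfer, makes standard functionals respect equality on standard arguments; this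
  takes care of sequences that are only seen to be binary at standard places.

  Without \<open>QF-AC\<^bsup>2,0\<^esup>\<close>, this standard extensionality follows from \<open>N_dagger_fm\<close>: let \<open>f\<close> and \<open>g\<close> agree at standard
  places and \<open>\<psi>(h) = 1\<close> if \<open>\<phi>\<close> takes different values on \<open>g\<close> and on the sequence that follows \<open>f\<close> where \<open>h\<close> is
  nonzero and \<open>g\<close> elsewhere, \<open>\<psi>(h) = 0\<close> otherwise. The maximum of \<open>\<psi>\<close> is attained at a standard finite
  sequence, for which the mixed sequence is \<open>g\<close>, so it is \<open>0\<close>, and \<open>\<phi>(f) = \<phi>(g)\<close>.

  Transfer lacks parameters. A supremum functional on the standard objects is turned into a genuine one
  through the closed constant for the functional uniquely defined by the matrix of \<open>SUP\<close>.
\<close>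

text \<open>The Henkin construction below runs through an enumeration of all formulas.\<close>

instance ty :: countable by countable_datatype
instance trm and cnst and fm :: countable by countable_datatype

section \<open>Substitution and derived rules\<close>

text \<open>Since a constant \<open>Def x A\<close> contains a formula, the three datatypes are
  mutually recursive and their generated induction rule is simultaneous. The recursion of
  \<open>fvt\<close> never enters a constant, which gives a simple rule for terms; formulas are
  treated in the same way.\<close>

lemma trm_induct [case_names Var Cn App, induct type: trm]:
  assumes "\<And>x. P (Var x)" "\<And>c. P (Cn c)" "\<And>s t. P s \<Longrightarrow> P t \<Longrightarrow> P (s \<cdot> t)"
  shows "P t"
  using assms by (rule fvt.induct)

lemma fm_induct [case_names Eq St Fls Imp Forall BAll, induct type: fm]:
  assumes "\<And>s t. P (Eq s t)" "\<And>t. P (St t)" "P Fls" "\<And>A B. P A \<Longrightarrow> P B \<Longrightarrow> P (A \<^bold>\<longrightarrow> B)"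
    "\<And>x A. P A \<Longrightarrow> P (Forall x A)" "\<And>i t A. P A \<Longrightarrow> P (BAll i t A)"
  shows "P A"
  using assms by (rule fv.induct)

text \<open>Bound variables are counted as well: a variable of this index is neither free in the
  formula nor captured in it, whatever its type.\<close>

fun fresh_fm :: "fm \<Rightarrow> nat" where
  "fresh_fm (Eq s t) = max (fresh s) (fresh t)"
| "fresh_fm (St t) = fresh t"
| "fresh_fm Fls = 0"
| "fresh_fm (A \<^bold>\<longrightarrow> B) = max (fresh_fm A) (fresh_fm B)"
| "fresh_fm (Forall x A) = max (Suc (fst x)) (fresh_fm A)"
| "fresh_fm (BAll i t A) = max (Suc i) (max (fresh t) (fresh_fm A))"

lemma fvt_fresh: "x \<in> fvt t \<Longrightarrow> fst x < fresh t"
  by (induction t) auto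

lemma fv_fresh_fm: "x \<in> fv A \<Longrightarrow> fst x < fresh_fm A"
  by (induction A) (auto dest: fvt_fresh)

lemma finite_fvt [simp]: "finite (fvt t)"
  by (induction t) auto

lemma sbt_notin [simp]: "x \<notin> fvt t \<Longrightarrow> sbt x s t = t"
  by (induction t) auto

lemma sbf_notin: "x \<notin> fv A \<Longrightarrow> sbf x s A = A"
  by (induction A) auto

lemma sbt_type:
  assumes "wft s" "tyof s = snd x"
  shows "wft t \<Longrightarrow> wft (sbt x s t) \<and> tyof (sbt x s t) = tyof t"
  by (induction t) (use assms in auto)

lemma fvt_sbt: "fvt (sbt x s t) \<subseteq> (fvt t - {x}) \<union> fvt s"
  by (induction t) auto

lemma fv_sbf: "fv (sbf x s A) \<subseteq> (fv A - {x}) \<union> fvt s"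
proof (induction A)
  case (BAll i t A)
  then show ?case using fvt_sbt[of x s t] by auto
qed (use fvt_sbt in \<open>auto split: if_splits\<close>, (use fvt_sbt in fastforce)+)

lemma wff_sbf:
  assumes "wft s" "tyof s = snd x"
  shows "wff A \<Longrightarrow> free_for s x A \<Longrightarrow> wff (sbf x s A)"
proof (induction A)
  case (Forall y A)
  then show ?case by (auto simp: sbf_notin)
next
  case (BAll i t A)
  then show ?case
    using sbt_type[OF assms, of t] fvt_sbt[of x s t]
    by (cases "x \<in> fvt t"; cases "x \<in> fv A") (auto simp: sbf_notin)
qed (use sbt_type[OF assms] in auto)

lemma free_for_fresh: "\<forall>z\<in>fvt s. fresh_fm A \<le> fst z \<Longrightarrow> free_for s x A"
  by (induction A) force+

lemma qf_free_for [simp]: "qf A \<Longrightarrow> free_for s x A"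
  by (induction A) auto

lemma qf_internal: "qf A \<Longrightarrow> internal A"
  by (induction A) auto

lemma sbt_back: "fresh t \<le> fst y \<Longrightarrow> sbt y (Var x) (sbt x (Var y) t) = t"
  by (induction t) auto

text \<open>Renaming to a fresh variable can be undone. Well-formedness matters for
  \<open>BAll\<close>: otherwise \<open>x\<close> could occur in the bound of a quantifier that
  binds \<open>x\<close>, and \<open>Var x\<close> would not be free for \<open>y\<close> after the
  renaming.\<close>

lemma sbf_back:
  "wff A \<Longrightarrow> fresh_fm A \<le> fst y \<Longrightarrow> sbf y (Var x) (sbf x (Var y) A) = A \<and> free_for (Var x) y (sbf x (Var y) A)"
proof (induction A)
  case (Forall z A)
  then have "y \<notin> fv A" using fv_fresh_fm[of y A] by force
  with Forall show ?case by (auto simp: sbf_notin)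
next
  case (BAll i t A)
  then have "y \<notin> fv A" using fv_fresh_fm[of y A] by force
  moreover have "y \<noteq> (i, N)" using BAll.prems by force
  moreover have "y \<notin> fvt t" using BAll.prems fvt_fresh[of y t] by force
  ultimately show ?case using BAll by (auto simp: sbf_notin sbt_back)
qed (auto simp: sbt_back)

lemma closedT_wf [simp]:
  "wft predT" "tyof predT = N \<rightarrow> N" "fvt predT = {}"
  "wft subT" "tyof subT = N \<rightarrow> N \<rightarrow> N" "fvt subT = {}"
  by (simp_all add: predT_def subT_def)

section \<open>Derived rules of the Hilbert calculus\<close>

lemma prv_wff: "T \<turnstile> A \<Longrightarrow> wff A"
  by (induction rule: prv.induct) (auto intro: wff_sbf)

lemma prv_I: "wff A \<Longrightarrow> T \<turnstile> A \<^bold>\<longrightarrow> A"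
  by (rule mp[OF mp[OF imp_s[of A "A \<^bold>\<longrightarrow> A" A]] imp_k]) (auto intro: imp_k)

lemma prv_K: "T \<turnstile> B \<Longrightarrow> wff A \<Longrightarrow> T \<turnstile> A \<^bold>\<longrightarrow> B"
  by (rule mp[OF imp_k]) (auto dest: prv_wff)

lemma prv_S:
  assumes "T \<turnstile> C \<^bold>\<longrightarrow> A \<^bold>\<longrightarrow> B" "T \<turnstile> C \<^bold>\<longrightarrow> A"
  shows "T \<turnstile> C \<^bold>\<longrightarrow> B"
  by (rule mp[OF mp[OF imp_s assms(1)] assms(2)]) (use prv_wff[OF assms(1)] in auto)

lemma prv_trans: "T \<turnstile> A \<^bold>\<longrightarrow> B \<Longrightarrow> T \<turnstile> B \<^bold>\<longrightarrow> C \<Longrightarrow> T \<turnstile> A \<^bold>\<longrightarrow> C"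
  by (rule prv_S[OF prv_K]) (auto dest: prv_wff)

lemma prv_swap: assumes "T \<turnstile> A \<^bold>\<longrightarrow> B \<^bold>\<longrightarrow> C" shows "T \<turnstile> B \<^bold>\<longrightarrow> A \<^bold>\<longrightarrow> C"
proof -
  have w: "wff A" "wff B" "wff C" using prv_wff[OF assms] by auto
  have "T \<turnstile> (A \<^bold>\<longrightarrow> B) \<^bold>\<longrightarrow> A \<^bold>\<longrightarrow> C" by (rule mp[OF imp_s assms]) (use w in auto)
  then show ?thesis by (rule prv_trans[OF imp_k, rotated 2]) (use w in auto)
qed

lemma prv_trans2:
  assumes "T \<turnstile> C \<^bold>\<longrightarrow> A \<^bold>\<longrightarrow> B" "T \<turnstile> B \<^bold>\<longrightarrow> D"
  shows "T \<turnstile> C \<^bold>\<longrightarrow> A \<^bold>\<longrightarrow> D"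
proof -
  have w: "wff A" "wff B" "wff D" using assms prv_wff by force+
  have "T \<turnstile> (A \<^bold>\<longrightarrow> B) \<^bold>\<longrightarrow> A \<^bold>\<longrightarrow> D" by (rule mp[OF imp_s prv_K[OF assms(2)]]) (use w in auto)
  with assms(1) show ?thesis by (rule prv_trans)
qed

lemma prv_contra: assumes "T \<turnstile> A \<^bold>\<longrightarrow> B" shows "T \<turnstile> \<^bold>\<not> B \<^bold>\<longrightarrow> \<^bold>\<not> A"
proof -
  have w: "wff A" "wff B" using prv_wff[OF assms] by auto
  have "T \<turnstile> B \<^bold>\<longrightarrow> \<^bold>\<not> B \<^bold>\<longrightarrow> Fls" by (rule prv_swap[OF prv_I]) (use w in auto)
  then show ?thesis by (rule prv_swap[OF prv_trans[OF assms]])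
qed

lemma prv_exf: "wff A \<Longrightarrow> T \<turnstile> Fls \<^bold>\<longrightarrow> A"
  by (rule prv_trans[OF imp_k dne]) auto

lemma prv_conjD1: assumes "wff A" "wff B" shows "T \<turnstile> (A \<^bold>\<and> B) \<^bold>\<longrightarrow> A"
proof -
  have "T \<turnstile> \<^bold>\<not> A \<^bold>\<longrightarrow> A \<^bold>\<longrightarrow> \<^bold>\<not> B"
    by (rule prv_trans2[OF prv_I prv_exf]) (use assms in auto)
  from prv_trans[OF prv_contra[OF this] dne] show ?thesis using assms by simp
qed

lemma prv_conjD2: assumes "wff A" "wff B" shows "T \<turnstile> (A \<^bold>\<and> B) \<^bold>\<longrightarrow> B"
proof -
  have "T \<turnstile> \<^bold>\<not> B \<^bold>\<longrightarrow> A \<^bold>\<longrightarrow> \<^bold>\<not> B" by (rule imp_k) (use assms in auto)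
  from prv_trans[OF prv_contra[OF this] dne] show ?thesis using assms by simp
qed

lemma prv_iffD: assumes "T \<turnstile> A \<^bold>\<longleftrightarrow> B" shows "T \<turnstile> A \<^bold>\<longrightarrow> B" "T \<turnstile> B \<^bold>\<longrightarrow> A"
  using prv_wff[OF assms] mp[OF prv_conjD1 assms] mp[OF prv_conjD2 assms] by auto

lemma prv_imp_cong: assumes "T \<turnstile> A' \<^bold>\<longrightarrow> A" "T \<turnstile> B \<^bold>\<longrightarrow> B'"
  shows "T \<turnstile> (A \<^bold>\<longrightarrow> B) \<^bold>\<longrightarrow> (A' \<^bold>\<longrightarrow> B')"
proof -
  have w: "wff A" "wff B" "wff A'" using assms prv_wff by force+
  have "T \<turnstile> A \<^bold>\<longrightarrow> (A \<^bold>\<longrightarrow> B) \<^bold>\<longrightarrow> B" by (rule prv_swap[OF prv_I]) (use w in auto)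
  from prv_swap[OF prv_trans[OF assms(1) this]] show ?thesis using assms(2) by (rule prv_trans2)
qed

lemma prv_all: assumes "T \<turnstile> C \<^bold>\<longrightarrow> A" "x \<notin> fv C" shows "T \<turnstile> C \<^bold>\<longrightarrow> Forall x A"
  by (rule mp[OF all_imp gen[OF assms(1)]]) (use assms(2) prv_wff[OF assms(1)] in auto)

lemma prv_inst: "wff A \<Longrightarrow> T \<turnstile> Forall x A \<^bold>\<longrightarrow> A"
proof -
  assume w: "wff A"
  have *: "sbt x (Var x) t = t" for t by (induction t) auto
  have "wff A \<longrightarrow> free_for (Var x) x A" "sbf x (Var x) A = A" by (induction A) (auto simp: *)
  then show ?thesis using all_inst[of A "Var x" x T] w by simp
qed

lemma prv_all_cong: assumes "T \<turnstile> A \<^bold>\<longrightarrow> B" shows "T \<turnstile> Forall x A \<^bold>\<longrightarrow> Forall x B"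
  by (rule prv_all[OF prv_trans[OF prv_inst assms]]) (use prv_wff[OF assms] in auto)

text \<open>Instantiate at \<open>y\<close> and generalise; for the converse,
  \<open>sbf_back\<close> returns to \<open>A\<close> itself.\<close>

lemma prv_rename:
  assumes "wff A" "fresh_fm A \<le> fst y" "snd y = snd x"
  shows "T \<turnstile> Forall x A \<^bold>\<longrightarrow> Forall y (sbf x (Var y) A)"
    and "T \<turnstile> Forall y (sbf x (Var y) A) \<^bold>\<longrightarrow> Forall x A"
proof -
  have ff: "free_for (Var y) x A" by (rule free_for_fresh) (use assms in auto)
  have w: "wff (sbf x (Var y) A)" by (rule wff_sbf) (use assms ff in auto)
  have y: "y \<notin> fv A" using fv_fresh_fm[of y A] assms by force
  have "T \<turnstile> Forall x A \<^bold>\<longrightarrow> sbf x (Var y) A" by (rule all_inst) (use assms ff in auto)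
  then show "T \<turnstile> Forall x A \<^bold>\<longrightarrow> Forall y (sbf x (Var y) A)" by (rule prv_all) (use y in auto)
  have "T \<turnstile> Forall y (sbf x (Var y) A) \<^bold>\<longrightarrow> sbf y (Var x) (sbf x (Var y) A)"
    by (rule all_inst) (use w assms sbf_back[of A y x] in auto)
  then have "T \<turnstile> Forall y (sbf x (Var y) A) \<^bold>\<longrightarrow> A" using sbf_back[OF assms(1,2)] by simp
  then show "T \<turnstile> Forall y (sbf x (Var y) A) \<^bold>\<longrightarrow> Forall x A"
    by (rule prv_all) (use fv_sbf[of x "Var y" A] in auto)
qed

section \<open>Structures\<close>

text \<open>Equality is read as an arbitrary relation \<open>E\<close> without any laws, so that the
  locale covers both a term model, where \<open>E\<close> is membership of the equation in a Henkin
  set, and its quotient, where \<open>E\<close> is identity.\<close>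

locale interp =
  fixes D :: "ty \<Rightarrow> 'u set" and ap :: "'u \<Rightarrow> 'u \<Rightarrow> 'u" and cn :: "cnst \<Rightarrow> 'u"
    and E :: "'u \<Rightarrow> 'u \<Rightarrow> bool" and sd :: "'u \<Rightarrow> bool"
  assumes ap_closed: "f \<in> D (\<sigma> \<rightarrow> \<tau>) \<Longrightarrow> a \<in> D \<sigma> \<Longrightarrow> ap f a \<in> D \<tau>"
    and cn_closed: "wfc c \<Longrightarrow> cn c \<in> D (ctyp c)"
begin

fun val :: "(var \<Rightarrow> 'u) \<Rightarrow> trm \<Rightarrow> 'u" where
  "val \<rho> (Var x) = \<rho> x"
| "val \<rho> (Cn c) = cn c"
| "val \<rho> (s \<cdot> t) = ap (val \<rho> s) (val \<rho> t)"

text \<open>The meaning of \<open>lt\<close>. As \<open>subT\<close> is closed, its value is the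
  same under every valuation; the constant one is merely at hand.\<close>

definition less :: "'u \<Rightarrow> 'u \<Rightarrow> bool" where
  "less a b \<longleftrightarrow> E (ap (ap (val (\<lambda>_. a) subT) (ap (cn Succ) a)) b) (cn Zero)"

fun sat :: "(var \<Rightarrow> 'u) \<Rightarrow> fm \<Rightarrow> bool" where
  "sat \<rho> (Eq s t) = E (val \<rho> s) (val \<rho> t)"
| "sat \<rho> (St t) = sd (val \<rho> t)"
| "sat \<rho> Fls = False"
| "sat \<rho> (A \<^bold>\<longrightarrow> B) = (sat \<rho> A \<longrightarrow> sat \<rho> B)"
| "sat \<rho> (Forall x A) = (\<forall>a\<in>D (snd x). sat (\<rho>(x := a)) A)"
| "sat \<rho> (BAll i t A) = (\<forall>a\<in>D N. less a (val \<rho> t) \<longrightarrow> sat (\<rho>((i, N) := a)) A)"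

definition typed :: "(var \<Rightarrow> 'u) \<Rightarrow> bool" where
  "typed \<rho> \<longleftrightarrow> (\<forall>x. \<rho> x \<in> D (snd x))"

lemma typedD: "typed \<rho> \<Longrightarrow> \<rho> x \<in> D (snd x)"
  by (auto simp only: typed_def)

lemma typed_upd [simp]: "typed \<rho> \<Longrightarrow> a \<in> D (snd x) \<Longrightarrow> typed (\<rho>(x := a))"
  unfolding typed_def fun_upd_apply by metis

lemma val_type: "typed \<rho> \<Longrightarrow> wft t \<Longrightarrow> val \<rho> t \<in> D (tyof t)"
proof (induction t)
  case (App s t)
  then have "tyof s = tyof t \<rightarrow> tyof (s \<cdot> t)" by simp
  with App show ?case by (metis ap_closed val.simps(3) wft.simps(3))
qed (simp_all add: typedD cn_closed)

lemma val_in: "typed \<rho> \<Longrightarrow> wft t \<Longrightarrow> tyof t = \<sigma> \<Longrightarrow> val \<rho> t \<in> D \<sigma>"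
  using val_type by blast

lemma val_cong: "(\<And>x. x \<in> fvt t \<Longrightarrow> \<rho> x = \<rho>' x) \<Longrightarrow> val \<rho> t = val \<rho>' t"
  by (induction t) auto

lemma val_upd [simp]: "x \<notin> fvt t \<Longrightarrow> val (\<rho>(x := a)) t = val \<rho> t"
  by (rule val_cong) auto

lemma sat_cong: "(\<And>x. x \<in> fv A \<Longrightarrow> \<rho> x = \<rho>' x) \<Longrightarrow> sat \<rho> A = sat \<rho>' A"
proof (induction A arbitrary: \<rho> \<rho>')
  case (Eq s t)
  have "val \<rho> s = val \<rho>' s" "val \<rho> t = val \<rho>' t" by (rule val_cong; simp add: Eq)+
  then show ?case by simp
next
  case (St t)
  have "val \<rho> t = val \<rho>' t" by (rule val_cong) (simp add: St)
  then show ?case by simp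
next
  case (Imp A B)
  have "sat \<rho> A = sat \<rho>' A" "sat \<rho> B = sat \<rho>' B"
    by (rule Imp.IH(1), simp add: Imp.prems, rule Imp.IH(2), simp add: Imp.prems)
  then show ?case by simp
next
  case (Forall x A)
  have "sat (\<rho>(x := a)) A = sat (\<rho>'(x := a)) A" for a
    by (rule Forall.IH) (simp add: Forall.prems)
  then show ?case by simp
next
  case (BAll i t A)
  have "sat (\<rho>((i, N) := a)) A = sat (\<rho>'((i, N) := a)) A" for a
    by (rule BAll.IH) (simp add: BAll.prems)
  moreover have "val \<rho> t = val \<rho>' t" by (rule val_cong) (simp add: BAll.prems)
  ultimately show ?case by simp
qed simp

lemma sat_upd: "x \<notin> fv A \<Longrightarrow> sat (\<rho>(x := a)) A = sat \<rho> A"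
  by (rule sat_cong) auto

lemma val_sbt: "val \<rho> (sbt x s t) = val (\<rho>(x := val \<rho> s)) t"
  by (induction t) auto

lemma sat_sbf: "free_for s x A \<Longrightarrow> sat \<rho> (sbf x s A) = sat (\<rho>(x := val \<rho> s)) A"
proof (induction A arbitrary: \<rho>)
  case (Forall y A)
  show ?case
  proof (cases "x \<in> fv (Forall y A)")
    case True
    with Forall have "y \<notin> fvt s" "free_for s x A" "y \<noteq> x" by auto
    then have "sat (\<rho>(y := a)) (sbf x s A) = sat (\<rho>(x := val \<rho> s, y := a)) A" for a
      using Forall.IH[of "\<rho>(y := a)"] fun_upd_twist[of x y \<rho> "val \<rho> s" a]
      by (simp del: fun_upd_apply)
    then show ?thesis using \<open>y \<noteq> x\<close> by (simp del: fun_upd_apply)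
  next
    case False
    then show ?thesis by (metis sbf_notin sat_upd)
  qed
next
  case (BAll i t A)
  show ?case
  proof (cases "x \<in> fv (BAll i t A)")
    case True
    show ?thesis
    proof (cases "(i, N) = x")
      case False
      with BAll True have "(i, N) \<notin> fvt s" "free_for s x A" by auto
      then have "sat (\<rho>((i, N) := a)) (sbf x s A) = sat (\<rho>(x := val \<rho> s, (i, N) := a)) A" for a
        using BAll.IH[of "\<rho>((i, N) := a)"] False
          fun_upd_twist[of x "(i, N)" \<rho> "val \<rho> s" a] by (simp del: fun_upd_apply)
      then show ?thesis using False by (simp add: val_sbt del: fun_upd_apply)
    qed (simp add: val_sbt del: fun_upd_apply)
  next
    case False
    then show ?thesis by (metis sbf_notin sat_upd)
  qed
qed (auto simp: val_sbt)

lemma sat_rename: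
  assumes "fresh_fm A \<le> fst y" "snd y = snd x"
  shows "sat \<rho> (Forall y (sbf x (Var y) A)) = sat \<rho> (Forall x A)"
proof -
  have "free_for (Var y) x A" by (rule free_for_fresh) (use assms in auto)
  moreover have "sat (\<rho>(y := a, x := a)) A = sat (\<rho>(x := a)) A" for a
    by (rule sat_cong) (use fv_fresh_fm[of y A] assms in force)
  ultimately show ?thesis using assms by (simp add: sat_sbf)
qed

lemma less_val: "less a b \<longleftrightarrow> E (ap (ap (val \<rho> subT) (ap (cn Succ) a)) b) (cn Zero)"
proof -
  have "val \<rho> subT = val (\<lambda>_. a) subT" by (rule val_cong) simp
  then show ?thesis by (simp add: less_def)
qed

lemma sat_ball:
  assumes "(i, N) \<notin> fvt t"
  shows "sat \<rho> (BAll i t A) = sat \<rho> (Forall (i, N) (lt (v i) t \<^bold>\<longrightarrow> A))"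
  using assms by (simp add: less_val[of _ _ \<rho>])

text \<open>The semantic counterpart of the defined equality \<open>eq\<close>, built over
  \<open>E\<close>.\<close>

primrec ext_eq :: "ty \<Rightarrow> 'u \<Rightarrow> 'u \<Rightarrow> bool" where
  "ext_eq N a b = E a b"
| "ext_eq (\<sigma> \<rightarrow> \<tau>) a b = (\<forall>c\<in>D \<sigma>. ext_eq \<tau> (ap a c) (ap b c))"
| "ext_eq (Sq \<sigma>) a b = (E (ap (cn (Len \<sigma>)) a) (ap (cn (Len \<sigma>)) b) \<and>
    (\<forall>i\<in>D N. less i (ap (cn (Len \<sigma>)) a) \<longrightarrow>
      ext_eq \<sigma> (ap (ap (cn (At \<sigma>)) a) i) (ap (ap (cn (At \<sigma>)) b) i)))"

lemma sat_eq: "sat \<rho> (eq \<sigma> s t) = ext_eq \<sigma> (val \<rho> s) (val \<rho> t)"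
proof (induction \<sigma> arbitrary: \<rho> s t)
  case (Fn \<sigma> \<tau>)
  have "(fresh (s \<cdot> t), \<sigma>) \<notin> fvt s" "(fresh (s \<cdot> t), \<sigma>) \<notin> fvt t"
    using fvt_fresh[of _ s] fvt_fresh[of _ t] by fastforce+
  then show ?case by (simp add: Let_def Fn.IH fun_upd_same del: fun_upd_apply)
next
  case (Sq \<sigma>)
  have "(fresh (s \<cdot> t), N) \<notin> fvt s" "(fresh (s \<cdot> t), N) \<notin> fvt t"
    using fvt_fresh[of _ s] fvt_fresh[of _ t] by fastforce+
  then show ?case by (simp add: Let_def Sq.IH fun_upd_same del: fun_upd_apply)
qed simp

end

lemma wff_eq: "wft s \<Longrightarrow> wft t \<Longrightarrow> tyof s = \<sigma> \<Longrightarrow> tyof t = \<sigma> \<Longrightarrow> wff (eq \<sigma> s t)"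
proof (induction \<sigma> arbitrary: s t)
  case (Sq \<sigma>)
  have "(fresh (s \<cdot> t), N) \<notin> fvt s"
    using fvt_fresh[of _ s] by fastforce
  then show ?case using Sq by (auto simp: Let_def)
qed (auto simp: Let_def)

lemma internal_eq [simp]: "internal (eq \<sigma> s t)"
  by (induction \<sigma> arbitrary: s t) (auto simp: Let_def)

section \<open>Renaming of bound variables\<close>

text \<open>The measure of the induction in \<open>truth\<close>. Terms have no weight, so
  substitution preserves it; the weight 3 of \<open>BAll\<close> exceeds the weight 2 that its
  unfolding into \<open>Forall\<close> and an implication adds.\<close>

fun fm_size :: "fm \<Rightarrow> nat" where
  "fm_size (A \<^bold>\<longrightarrow> B) = Suc (fm_size A + fm_size B)"
| "fm_size (Forall x A) = Suc (fm_size A)"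
| "fm_size (BAll i t A) = 3 + fm_size A"
| "fm_size A = 0"

lemma fm_size_sbf [simp]: "fm_size (sbf x s A) = fm_size A"
  by (induction A) auto

fun bv :: "fm \<Rightarrow> var set" where
  "bv (A \<^bold>\<longrightarrow> B) = bv A \<union> bv B"
| "bv (Forall x A) = insert x (bv A)"
| "bv (BAll i t A) = insert (i, N) (bv A)"
| "bv A = {}"

lemma bv_sbf [simp]: "bv (sbf x s A) = bv A"
  by (induction A) auto

lemma free_for_bv: "bv A \<inter> fvt s = {} \<Longrightarrow> free_for s x A"
  by (induction A) auto

text \<open>An equivalent of \<open>A\<close> with all bound variables of index at least \<open>k\<close> and without \<open>BAll\<close>.\<close>

fun rename_bound :: "nat \<Rightarrow> fm \<Rightarrow> fm" where
  "rename_bound k (A \<^bold>\<longrightarrow> B) = (rename_bound k A \<^bold>\<longrightarrow> rename_bound k B)"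
| "rename_bound k (Forall x A) =
    (let y = (max k (fresh_fm (rename_bound k A)), snd x) in Forall y (sbf x (Var y) (rename_bound k A)))"
| "rename_bound k (BAll i t A) =
    (let A' = lt (v i) t \<^bold>\<longrightarrow> rename_bound k A; y = (max k (fresh_fm A'), N) in Forall y (sbf (i, N) (Var y) A'))"
| "rename_bound k A = A"

lemma bv_rename_bound: "bv (rename_bound k A) \<subseteq> {x. k \<le> fst x}"
  by (induction A) (auto simp: Let_def)

lemma fm_size_rename_bound: "fm_size (rename_bound k A) \<le> fm_size A"
  by (induction A) (auto simp: Let_def)

lemma (in interp) sat_rename_bound: "wff A \<Longrightarrow> sat \<rho> (rename_bound k A) = sat \<rho> A"
proof (induction A arbitrary: \<rho>)
  case (Forall x A)
  let ?y = "(max k (fresh_fm (rename_bound k A)), snd x)"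
  have "sat \<rho> (rename_bound k (Forall x A)) = sat \<rho> (Forall x (rename_bound k A))"
    by (simp only: rename_bound.simps Let_def) (rule sat_rename; simp)
  then show ?case using Forall by (simp del: fun_upd_apply rename_bound.simps)
next
  case (BAll i t A)
  let ?A = "lt (v i) t \<^bold>\<longrightarrow> rename_bound k A"
  have "sat \<rho> (rename_bound k (BAll i t A)) = sat \<rho> (Forall (i, N) ?A)"
    by (simp only: rename_bound.simps Let_def) (rule sat_rename; simp)
  moreover have "sat \<rho> (BAll i t A) = sat \<rho> (Forall (i, N) (lt (v i) t \<^bold>\<longrightarrow> A))"
    by (rule sat_ball) (use BAll in simp)
  ultimately show ?case using BAll by (simp del: fun_upd_apply rename_bound.simps)
qed auto

text \<open>The quantifier case of \<open>truth\<close> rests on this: after the renaming, a given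
  term can be substituted without capture.\<close>

lemma prv_rename_bound: "wff A \<Longrightarrow> (T \<turnstile> A \<^bold>\<longrightarrow> rename_bound k A) \<and> (T \<turnstile> rename_bound k A \<^bold>\<longrightarrow> A)"
proof (induction A)
  case (Imp A B)
  then show ?case by (auto intro: prv_imp_cong)
next
  case (Forall x A)
  let ?y = "(max k (fresh_fm (rename_bound k A)), snd x)"
  have IH: "T \<turnstile> A \<^bold>\<longrightarrow> rename_bound k A" "T \<turnstile> rename_bound k A \<^bold>\<longrightarrow> A" using Forall by auto
  have w: "wff (rename_bound k A)" using prv_wff[OF IH(1)] by simp
  have "T \<turnstile> Forall x (rename_bound k A) \<^bold>\<longrightarrow> rename_bound k (Forall x A)" "T \<turnstile> rename_bound k (Forall x A) \<^bold>\<longrightarrow> Forall x (rename_bound k A)"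
    by (simp_all only: rename_bound.simps Let_def) (rule prv_rename; use w in simp)+
  then show ?case using IH by (blast intro: prv_trans prv_all_cong)
next
  case (BAll i t A)
  let ?A = "lt (v i) t \<^bold>\<longrightarrow> A" and ?A' = "lt (v i) t \<^bold>\<longrightarrow> rename_bound k A"
  have IH: "T \<turnstile> A \<^bold>\<longrightarrow> rename_bound k A" "T \<turnstile> rename_bound k A \<^bold>\<longrightarrow> A" using BAll by auto
  have w: "wff (rename_bound k A)" using prv_wff[OF IH(1)] by simp
  have wl: "wff (lt (v i) t)" using BAll.prems by simp
  have 1: "T \<turnstile> ?A \<^bold>\<longrightarrow> ?A'" "T \<turnstile> ?A' \<^bold>\<longrightarrow> ?A"
    using prv_imp_cong[OF prv_I[OF wl]] IH by blast+
  have 2: "T \<turnstile> BAll i t A \<^bold>\<longrightarrow> Forall (i, N) ?A" "T \<turnstile> Forall (i, N) ?A \<^bold>\<longrightarrow> BAll i t A"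
    using prv_iffD[OF ball[OF BAll.prems]] by blast+
  have "T \<turnstile> Forall (i, N) ?A' \<^bold>\<longrightarrow> rename_bound k (BAll i t A)" "T \<turnstile> rename_bound k (BAll i t A) \<^bold>\<longrightarrow> Forall (i, N) ?A'"
    by (simp_all only: rename_bound.simps Let_def) (rule prv_rename; use w wl in simp)+
  with 1 2 show ?case by (blast intro: prv_trans prv_all_cong)
qed (auto intro: prv_I)


section \<open>Henkin sets and completeness\<close>

text \<open>A complete, deductively closed set of formulas with counterexamples. The language is not
  extended by constants: a false universal formula fails at a variable, of which fresh ones are
  always available.\<close>

locale henkin =
  fixes T :: "fm set" and \<Gamma> :: "fm set"
  assumes wff: "B \<in> \<Gamma> \<Longrightarrow> wff B"
    and thms: "T \<turnstile> B \<Longrightarrow> B \<in> \<Gamma>"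
    and mpc: "(A \<^bold>\<longrightarrow> B) \<in> \<Gamma> \<Longrightarrow> A \<in> \<Gamma> \<Longrightarrow> B \<in> \<Gamma>"
    and neg: "wff B \<Longrightarrow> (\<^bold>\<not> B) \<in> \<Gamma> \<longleftrightarrow> B \<notin> \<Gamma>"
    and witness: "wff A \<Longrightarrow> Forall x A \<notin> \<Gamma> \<Longrightarrow>
      \<exists>y. snd y = snd x \<and> free_for (Var y) x A \<and> sbf x (Var y) A \<notin> \<Gamma>"

text \<open>What one stage of the construction has to achieve: the single formula \<open>C\<close>
  collects all assumptions made so far and settles \<open>B\<close>, with a counterexample if it
  affirms a negated universal formula.\<close>

definition decides :: "fm set \<Rightarrow> fm \<Rightarrow> fm \<Rightarrow> bool" where
  "decides T B C \<longleftrightarrow> (wff B \<longrightarrow> (T \<turnstile> C \<^bold>\<longrightarrow> \<^bold>\<not> B) \<or> (T \<turnstile> C \<^bold>\<longrightarrow> B) \<and>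
      (\<forall>x A. B = (\<^bold>\<not> Forall x A) \<longrightarrow>
        (\<exists>y. snd y = snd x \<and> free_for (Var y) x A \<and> (T \<turnstile> C \<^bold>\<longrightarrow> \<^bold>\<not> sbf x (Var y) A))))"

text \<open>If \<open>C\<close> does not refute \<open>B\<close>, then \<open>B\<close> is added as
  a conjunct. For \<open>B\<close> the negation of \<open>Forall x A\<close>, the counterexample is
  named by a variable that occurs in neither \<open>C\<close> nor \<open>A\<close>; were this
  inconsistent, generalising over it would derive \<open>Forall x A\<close> from \<open>C\<close>
  and \<open>B\<close>.\<close>

lemma henkin_step:
  assumes C: "wff C" "\<not> (T \<turnstile> \<^bold>\<not> C)"
  shows "\<exists>C'. (wff C' \<and> \<not> (T \<turnstile> \<^bold>\<not> C')) \<and> (T \<turnstile> C' \<^bold>\<longrightarrow> C) \<and> decides T B C'"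
proof (cases "wff B \<and> \<not> (T \<turnstile> C \<^bold>\<longrightarrow> \<^bold>\<not> B)")
  case False
  then show ?thesis using C prv_I[of C T] by (intro exI[of _ C]) (auto simp: decides_def)
next
  case True
  let ?C = "C \<^bold>\<and> B"
  have w: "wff ?C" using C True by simp
  have con: "\<not> (T \<turnstile> \<^bold>\<not> ?C)"
  proof
    assume "T \<turnstile> \<^bold>\<not> ?C"
    then have "T \<turnstile> C \<^bold>\<longrightarrow> \<^bold>\<not> B" by (rule mp[OF dne, rotated]) (use C True in simp)
    then show False using True by blast
  qed
  have pC: "T \<turnstile> ?C \<^bold>\<longrightarrow> C" and pB: "T \<turnstile> ?C \<^bold>\<longrightarrow> B"
    using C True prv_conjD1 prv_conjD2 by blast+
  show ?thesis
  proof (cases "\<exists>x A. B = (\<^bold>\<not> Forall x A)")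
    case False
    then show ?thesis using w con pC pB unfolding decides_def by blast
  next
    case True
    then obtain x A where B: "B = (\<^bold>\<not> Forall x A)" by blast
    let ?y = "(max (Suc (fst x)) (max (fresh_fm A) (fresh_fm C)), snd x)"
    have wA: "wff A" using w B by simp
    have ff: "free_for (Var ?y) x A" by (rule free_for_fresh) simp
    have wS: "wff (sbf x (Var ?y) A)" by (rule wff_sbf) (use wA ff in auto)
    let ?W = "\<^bold>\<not> sbf x (Var ?y) A"
    have w': "wff (?C \<^bold>\<and> ?W)" using w wS by simp
    have con': "\<not> (T \<turnstile> \<^bold>\<not> (?C \<^bold>\<and> ?W))"
    proof
      assume "T \<turnstile> \<^bold>\<not> (?C \<^bold>\<and> ?W)"
      then have "T \<turnstile> ?C \<^bold>\<longrightarrow> \<^bold>\<not> ?W" by (rule mp[OF dne, rotated]) (use w wS in simp)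
      then have "T \<turnstile> ?C \<^bold>\<longrightarrow> sbf x (Var ?y) A" by (rule prv_trans[OF _ dne]) (use wS in simp)
      then have "T \<turnstile> ?C \<^bold>\<longrightarrow> Forall ?y (sbf x (Var ?y) A)"
        by (rule prv_all) (use fv_fresh_fm[of ?y C] fv_fresh_fm[of ?y A] B in auto)
      then have "T \<turnstile> ?C \<^bold>\<longrightarrow> Forall x A"
        by (rule prv_trans) (rule prv_rename, use wA in auto)
      then have "T \<turnstile> \<^bold>\<not> ?C" using prv_S[of T ?C "Forall x A" Fls] pB B by simp
      with con show False by blast
    qed
    have "T \<turnstile> (?C \<^bold>\<and> ?W) \<^bold>\<longrightarrow> ?C" and pW: "T \<turnstile> (?C \<^bold>\<and> ?W) \<^bold>\<longrightarrow> ?W"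
      using w wS by (auto intro!: prv_conjD1 prv_conjD2)
    then have "T \<turnstile> (?C \<^bold>\<and> ?W) \<^bold>\<longrightarrow> C" "T \<turnstile> (?C \<^bold>\<and> ?W) \<^bold>\<longrightarrow> B"
      using pC pB prv_trans by blast+
    moreover have "snd ?y = snd x" by simp
    ultimately show ?thesis using w' con' pW ff B unfolding decides_def
      by (intro exI[of _ "?C \<^bold>\<and> ?W"]) (metis fm.inject(3,4))
  qed
qed

text \<open>Iterate \<open>henkin_step\<close> along the enumeration of formulas, starting from the
  negation of \<open>A0\<close>, and collect the consequences of all stages. Every stage implies the
  earlier ones, so two consequences always hold at a common stage.\<close>

lemma henkin_exists:
  assumes "wff A0" "\<not> (T \<turnstile> A0)"
  shows "\<exists>\<Gamma>. henkin T \<Gamma> \<and> A0 \<notin> \<Gamma>"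
proof -
  let ?P = "\<lambda>n C. wff C \<and> \<not> (T \<turnstile> \<^bold>\<not> C) \<and> (n = (0::nat) \<longrightarrow> C = (\<^bold>\<not> A0))"
  let ?Q = "\<lambda>n C C'. (T \<turnstile> C' \<^bold>\<longrightarrow> C) \<and> decides T (from_nat n) C'"
  have "\<not> (T \<turnstile> \<^bold>\<not> \<^bold>\<not> A0)" using assms mp[OF dne] by blast
  then have "?P 0 (\<^bold>\<not> A0)" using assms by simp
  then have 0: "\<exists>C. ?P 0 C" by blast
  have 1: "\<exists>C'. ?P (Suc n) C' \<and> ?Q n C C'" if "?P n C" for n C
    using henkin_step[of C T "from_nat n"] that by auto
  obtain C where P: "\<And>n. ?P n (C n)" and Q: "\<And>n. ?Q n (C n) (C (Suc n))"
    using dependent_nat_choice[of ?P ?Q, OF 0 1] by blast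
  have mono: "T \<turnstile> C n \<^bold>\<longrightarrow> C m" if "m \<le> n" for m n
    using that
  proof (induction n rule: dec_induct)
    case base
    then show ?case using P prv_I by blast
  next
    case (step n)
    then show ?case using Q[of n] prv_trans by blast
  qed
  define \<Gamma> where "\<Gamma> = {B. \<exists>n. T \<turnstile> C n \<^bold>\<longrightarrow> B}"
  have mpc: "B \<in> \<Gamma>" if AB: "(A \<^bold>\<longrightarrow> B) \<in> \<Gamma>" "A \<in> \<Gamma>" for A B
  proof -
    obtain m n where "T \<turnstile> C m \<^bold>\<longrightarrow> A \<^bold>\<longrightarrow> B" "T \<turnstile> C n \<^bold>\<longrightarrow> A" using AB by (auto simp: \<Gamma>_def)
    then have "T \<turnstile> C (max m n) \<^bold>\<longrightarrow> A \<^bold>\<longrightarrow> B" "T \<turnstile> C (max m n) \<^bold>\<longrightarrow> A"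
      using mono prv_trans by (metis max.cobounded1 max.cobounded2)+
    then show ?thesis by (auto simp: \<Gamma>_def intro: prv_S)
  qed
  have cons: "Fls \<notin> \<Gamma>" using P by (auto simp: \<Gamma>_def)
  have dec: "(\<^bold>\<not> B) \<in> \<Gamma> \<or> B \<in> \<Gamma>" if "wff B" for B
    using Q[of "to_nat B"] that by (auto simp: \<Gamma>_def decides_def)
  have neg: "(\<^bold>\<not> B) \<in> \<Gamma> \<longleftrightarrow> B \<notin> \<Gamma>" if "wff B" for B
    using dec[OF that] mpc cons by blast
  have "henkin T \<Gamma>"
  proof
    show "wff B" if "B \<in> \<Gamma>" for B using that prv_wff by (force simp: \<Gamma>_def)
    show "B \<in> \<Gamma>" if "T \<turnstile> B" for B using prv_K[OF that] P by (auto simp: \<Gamma>_def)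
    show "\<exists>y. snd y = snd x \<and> free_for (Var y) x A \<and> sbf x (Var y) A \<notin> \<Gamma>"
      if w: "wff A" and nin: "Forall x A \<notin> \<Gamma>" for A x
    proof -
      \<comment> \<open>This formula is settled at the stage following its number. It is not refuted
        there, since its negation is outside \<open>\<Gamma>\<close>, so the stage carries a
        counterexample.\<close>
      let ?B = "\<^bold>\<not> Forall x A"
      have B: "?B \<in> \<Gamma>" using neg w nin by simp
      then have "(\<^bold>\<not> ?B) \<notin> \<Gamma>" using neg[of ?B] w by simp
      then have "\<not> (T \<turnstile> C (Suc (to_nat ?B)) \<^bold>\<longrightarrow> \<^bold>\<not> ?B)" by (auto simp: \<Gamma>_def)
      then obtain y where y: "snd y = snd x" "free_for (Var y) x A"
        "T \<turnstile> C (Suc (to_nat ?B)) \<^bold>\<longrightarrow> \<^bold>\<not> sbf x (Var y) A"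
        using Q[of "to_nat ?B"] w unfolding decides_def by auto
      have "wff (sbf x (Var y) A)" by (rule wff_sbf) (use w y in auto)
      moreover have "(\<^bold>\<not> sbf x (Var y) A) \<in> \<Gamma>" using y by (auto simp: \<Gamma>_def)
      ultimately show ?thesis using y neg by blast
    qed
  qed (use mpc neg in auto)
  moreover have "(\<^bold>\<not> A0) \<in> \<Gamma>" using P[of 0] prv_I[of "\<^bold>\<not> A0" T] by (auto simp: \<Gamma>_def intro!: exI[of _ 0])
  ultimately show ?thesis using neg assms by blast
qed

section \<open>The term model of a Henkin set\<close>

context henkin begin

text \<open>Open terms are elements too, and \<open>Var\<close> is the valuation under which every
  term denotes itself.\<close>

definition "Dt \<sigma> = {t. wft t \<and> tyof t = \<sigma>}"

sublocale tm: interp Dt App Cn "\<lambda>s t. Eq s t \<in> \<Gamma>" "\<lambda>t. St t \<in> \<Gamma>"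
  by unfold_locales (auto simp: Dt_def)

lemma val_Var [simp]: "tm.val Var t = t"
  by (induction t) auto

lemma imp_in: "wff A \<Longrightarrow> wff B \<Longrightarrow> (A \<^bold>\<longrightarrow> B) \<in> \<Gamma> \<longleftrightarrow> (A \<in> \<Gamma> \<longrightarrow> B \<in> \<Gamma>)"
proof (intro iffI)
  assume w: "wff A" "wff B" and i: "A \<in> \<Gamma> \<longrightarrow> B \<in> \<Gamma>"
  show "(A \<^bold>\<longrightarrow> B) \<in> \<Gamma>"
  proof (cases "A \<in> \<Gamma>")
    case True
    then show ?thesis using i w mpc thms[OF imp_k] by blast
  next
    case False
    then have "(\<^bold>\<not> A) \<in> \<Gamma>" using neg w by blast
    moreover have "T \<turnstile> \<^bold>\<not> A \<^bold>\<longrightarrow> A \<^bold>\<longrightarrow> B" by (rule prv_trans2[OF prv_I prv_exf]) (use w in auto)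
    ultimately show ?thesis using mpc thms by blast
  qed
qed (use mpc in blast)

text \<open>Induction on \<open>fm_size\<close> and not on the structure, because the quantifier
  case passes to substitution instances and \<open>BAll\<close> to its unfolding.\<close>

lemma truth: "wff A \<Longrightarrow> tm.sat Var A \<longleftrightarrow> A \<in> \<Gamma>"
proof (induction "fm_size A" arbitrary: A rule: less_induct)
  case less
  show ?case
  proof (cases A)
    case Fls
    have "(\<^bold>\<not> Fls) \<in> \<Gamma>" using thms[OF prv_I[of Fls]] by simp
    then show ?thesis using Fls neg[of Fls] by simp
  next
    case (Imp B C)
    then show ?thesis using less imp_in[of B C] by simp
  next
    case (BAll i t B)
    let ?A = "Forall (i, N) (lt (v i) t \<^bold>\<longrightarrow> B)"
    have "A \<in> \<Gamma> \<longleftrightarrow> ?A \<in> \<Gamma>"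
      using prv_iffD[OF ball] less.prems thms mpc BAll by blast
    moreover have "tm.sat Var ?A \<longleftrightarrow> ?A \<in> \<Gamma>"
      by (rule less.hyps) (use less.prems BAll in auto)
    moreover have "tm.sat Var A = tm.sat Var ?A"
      unfolding BAll by (rule tm.sat_ball) (use less.prems BAll in simp)
    ultimately show ?thesis by blast
  next
    case (Forall x B)
    show ?thesis
    proof
      assume s: "tm.sat Var A"
      show "A \<in> \<Gamma>"
      proof (rule ccontr)
        assume "A \<notin> \<Gamma>"
        then obtain y where y: "snd y = snd x" "free_for (Var y) x B" "sbf x (Var y) B \<notin> \<Gamma>"
          using witness[of B x] less.prems Forall by auto
        have "wff (sbf x (Var y) B)" by (rule wff_sbf) (use less.prems Forall y in auto)
        then have "\<not> tm.sat Var (sbf x (Var y) B)" using less.hyps y Forall by simp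
        then show False using s y Forall by (auto simp: tm.sat_sbf Dt_def)
      qed
    next
      assume A: "A \<in> \<Gamma>"
      have "tm.sat (Var(x := t)) B" if t: "t \<in> Dt (snd x)" for t
      proof -
        \<comment> \<open>The term \<open>t\<close> may fail to be free for \<open>x\<close> in
          \<open>B\<close>; moving all bound variables beyond those of \<open>t\<close> makes the
          instantiation legitimate.\<close>
        let ?B = "rename_bound (fresh t) B"
        have wB: "wff B" using less.prems Forall by simp
        have imp: "T \<turnstile> B \<^bold>\<longrightarrow> ?B" using prv_rename_bound[OF wB] by blast
        then have w: "wff ?B" using prv_wff by force
        have ff: "free_for t x ?B"
          by (rule free_for_bv) (use bv_rename_bound[of "fresh t" B] fvt_fresh[of _ t] in force)
        have "Forall x ?B \<in> \<Gamma>" using prv_all_cong[OF imp] A Forall thms mpc by blast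
        moreover have "(Forall x ?B \<^bold>\<longrightarrow> sbf x t ?B) \<in> \<Gamma>"
          by (rule thms, rule all_inst) (use w ff t in \<open>auto simp: Dt_def\<close>)
        ultimately have "sbf x t ?B \<in> \<Gamma>" using mpc by blast
        moreover have "wff (sbf x t ?B)" by (rule wff_sbf) (use w ff t in \<open>auto simp: Dt_def\<close>)
        moreover have "fm_size (sbf x t ?B) < fm_size A" using fm_size_rename_bound[of "fresh t" B] Forall by simp
        ultimately have "tm.sat Var (sbf x t ?B)" using less.hyps by blast
        then show ?thesis using ff wB by (simp add: tm.sat_sbf tm.sat_rename_bound)
      qed
      then show "tm.sat Var A" using Forall by simp
    qed
  qed (use less.prems in auto)
qed

lemma sat_closure:
  "tm.sat \<sigma> (foldr Forall xs A) \<Longrightarrow> tm.typed \<rho> \<Longrightarrow> tm.sat (\<lambda>x. if x \<in> set xs then \<rho> x else \<sigma> x) A"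
proof (induction xs arbitrary: \<sigma>)
  case (Cons x xs)
  then have "tm.sat (\<sigma>(x := \<rho> x)) (foldr Forall xs A)" by (simp add: tm.typedD)
  then have "tm.sat (\<lambda>y. if y \<in> set xs then \<rho> y else (\<sigma>(x := \<rho> x)) y) A" using Cons by blast
  moreover have "(\<lambda>y. if y \<in> set xs then \<rho> y else (\<sigma>(x := \<rho> x)) y) =
      (\<lambda>y. if y \<in> set (x # xs) then \<rho> y else \<sigma> y)" by auto
  ultimately show ?case by simp
qed auto

text \<open>\<open>truth\<close> speaks of the valuation \<open>Var\<close> only. Any other typed
  valuation is reached through the universal closure of the theorem, by instantiating the
  quantifiers with its values.\<close>

lemma sat_thm:
  assumes "T \<turnstile> A" "tm.typed \<rho>"
  shows "tm.sat \<rho> A"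
proof -
  have "finite (fv A)" by (induction A) auto
  then obtain xs where xs: "set xs = fv A" using finite_list by blast
  have "T \<turnstile> foldr Forall ys A" for ys by (induction ys) (use assms gen in auto)
  then have "tm.sat Var (foldr Forall xs A)" using truth prv_wff thms by blast
  from sat_closure[OF this assms(2)]
  show ?thesis by (rule tm.sat_cong[THEN iffD1, rotated]) (use xs in auto)
qed

end

section \<open>Extensional models\<close>

text \<open>Equality is now identity. Soundness is restricted to internal formulas unless
  \<open>StAx\<close> is available: its axiom \<open>st_eq\<close> is what makes standardness
  compatible with extensional equality, so that it passes to the quotient.\<close>

locale model = interp D ap cn "(=)" sd
  for T :: "fm set" and D :: "ty \<Rightarrow> 'u set" and ap cn sd +
  assumes extensional: "a \<in> D \<sigma> \<Longrightarrow> b \<in> D \<sigma> \<Longrightarrow> ext_eq \<sigma> a b \<Longrightarrow> a = b"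
    and sound: "T \<turnstile> A \<Longrightarrow> internal A \<or> StAx \<subseteq> T \<Longrightarrow> typed \<rho> \<Longrightarrow> sat \<rho> A"

locale epra_henkin = henkin +
  assumes EPRA: "EPRA \<subseteq> T"
begin

lemma axiom: "A \<in> T \<Longrightarrow> wff A \<Longrightarrow> tm.typed \<rho> \<Longrightarrow> tm.sat \<rho> A"
  by (rule sat_thm[OF ax])

abbreviation "E \<equiv> \<lambda>s t. Eq s t \<in> \<Gamma>"
abbreviation "ext_eq \<equiv> tm.ext_eq"

lemma Dt_app: "f \<in> Dt (\<sigma> \<rightarrow> \<tau>) \<Longrightarrow> a \<in> Dt \<sigma> \<Longrightarrow> f \<cdot> a \<in> Dt \<tau>"
  by (simp add: Dt_def)

lemma typed_Var: "tm.typed Var"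
  unfolding tm.typed_def by (simp add: Dt_def)

lemma ext_eq_cong:
  assumes "f \<in> Dt (\<sigma> \<rightarrow> \<tau>)" "a \<in> Dt \<sigma>" "b \<in> Dt \<sigma>" "ext_eq \<sigma> a b"
  shows "ext_eq \<tau> (f \<cdot> a) (f \<cdot> b)"
proof -
  let ?f = "(2, \<sigma> \<rightarrow> \<tau>)" and ?a = "(0, \<sigma>)" and ?b = "(1, \<sigma>)"
  let ?A = "eq \<sigma> (Var ?a) (Var ?b) \<^bold>\<longrightarrow> eq \<tau> (Var ?f \<cdot> Var ?a) (Var ?f \<cdot> Var ?b)"
  have "tm.sat (Var(?f := f, ?a := a, ?b := b)) ?A"
    by (rule axiom) (use assms EPRA EPRA.ext typed_Var in \<open>auto simp: wff_eq simp del: fun_upd_apply\<close>)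
  then show ?thesis using assms(4) by (simp add: tm.sat_eq)
qed

lemma E_refl: "a \<in> Dt N \<Longrightarrow> E a a"
  by (rule thms, rule eq_refl) (simp add: Dt_def)

lemma E_subst:
  assumes "a \<in> Dt N" "b \<in> Dt N" "c \<in> Dt N" "E a b"
  shows "E a c \<longleftrightarrow> E b c" "E b a"
proof -
  \<comment> \<open>Leibniz's law for the equation between a fresh variable and \<open>z\<close>
    shows that equality is Euclidean; with reflexivity this gives symmetry and transitivity.\<close>
  have 1: "E y z" if m: "x \<in> Dt N" "y \<in> Dt N" "z \<in> Dt N" "E x y" "E x z" for x y z
  proof -
    let ?i = "fresh z"
    have i: "(?i, N) \<notin> fvt z" using fvt_fresh[of _ z] by fastforce
    have "T \<turnstile> Eq x y \<^bold>\<longrightarrow> sbf (?i, N) x (Eq (v ?i) z) \<^bold>\<longrightarrow> sbf (?i, N) y (Eq (v ?i) z)"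
      by (rule eq_subst) (use m in \<open>auto simp: Dt_def\<close>)
    then show ?thesis using i m thms mpc by (simp del: sbf.simps add: sbf.simps(1)) blast
  qed
  show "E b a" using 1[of a b a] assms E_refl by blast
  then show "E a c \<longleftrightarrow> E b c" using 1[of a b c] 1[of b a c] assms by blast
qed

lemma Dt_consts:
  "Cn (Len \<sigma>) \<in> Dt (Sq \<sigma> \<rightarrow> N)" "Cn (At \<sigma>) \<in> Dt (Sq \<sigma> \<rightarrow> N \<rightarrow> \<sigma>)" "Cn Succ \<in> Dt (N \<rightarrow> N)" "Cn Zero \<in> Dt N"
  "subT \<in> Dt (N \<rightarrow> N \<rightarrow> N)"
  by (simp_all add: Dt_def)

lemma val_subT: "tm.val \<rho> subT = subT"
proof -
  have "tm.val \<rho> subT = tm.val Var subT" by (rule tm.val_cong) simp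
  then show ?thesis by simp
qed

lemma less_cong: "i \<in> Dt N \<Longrightarrow> a \<in> Dt N \<Longrightarrow> b \<in> Dt N \<Longrightarrow> E a b \<Longrightarrow> tm.less i a \<longleftrightarrow> tm.less i b"
  using ext_eq_cong[of "subT \<cdot> (Cn Succ \<cdot> i)" N N a b]
    E_subst(1)[of "subT \<cdot> (Cn Succ \<cdot> i) \<cdot> a" "subT \<cdot> (Cn Succ \<cdot> i) \<cdot> b" "Cn Zero"]
  by (simp add: tm.less_def val_subT Dt_def)

lemma ext_eq_refl: "a \<in> Dt \<sigma> \<Longrightarrow> ext_eq \<sigma> a a"
proof (induction \<sigma> arbitrary: a)
  case (Sq \<sigma>)
  have "Cn (Len \<sigma>) \<cdot> a \<in> Dt N" "\<And>i. i \<in> Dt N \<Longrightarrow> Cn (At \<sigma>) \<cdot> a \<cdot> i \<in> Dt \<sigma>"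
    using Sq.prems by (auto simp: Dt_def)
  then show ?case using Sq.IH by (simp add: E_refl)
qed (auto simp: E_refl intro: Dt_app)

lemma ext_eq_sym: "a \<in> Dt \<sigma> \<Longrightarrow> b \<in> Dt \<sigma> \<Longrightarrow> ext_eq \<sigma> a b \<Longrightarrow> ext_eq \<sigma> b a"
proof (induction \<sigma> arbitrary: a b)
  case N
  then show ?case using E_subst(2)[of a b] by simp
next
  case (Fn \<sigma> \<tau>)
  have "ext_eq \<tau> (b \<cdot> c) (a \<cdot> c)" if c: "c \<in> Dt \<sigma>" for c
    by (rule Fn.IH(2)[OF Dt_app[OF Fn.prems(1) c] Dt_app[OF Fn.prems(2) c]]) (use Fn.prems(3) c in simp)
  then show ?case by simp
next
  case (Sq \<sigma>)
  have D: "Cn (Len \<sigma>) \<cdot> a \<in> Dt N" "Cn (Len \<sigma>) \<cdot> b \<in> Dt N"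
    "\<And>i. i \<in> Dt N \<Longrightarrow> Cn (At \<sigma>) \<cdot> a \<cdot> i \<in> Dt \<sigma>" "\<And>i. i \<in> Dt N \<Longrightarrow> Cn (At \<sigma>) \<cdot> b \<cdot> i \<in> Dt \<sigma>"
    using Sq.prems by (auto simp: Dt_def)
  have ab: "E (Cn (Len \<sigma>) \<cdot> a) (Cn (Len \<sigma>) \<cdot> b)" using Sq.prems by simp
  have "ext_eq \<sigma> (Cn (At \<sigma>) \<cdot> b \<cdot> i) (Cn (At \<sigma>) \<cdot> a \<cdot> i)"
    if i: "i \<in> Dt N" "tm.less i (Cn (Len \<sigma>) \<cdot> b)" for i
  proof (rule Sq.IH)
    have "tm.less i (Cn (Len \<sigma>) \<cdot> a)" using less_cong[OF i(1) D(1,2) ab] i by blast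
    then show "ext_eq \<sigma> (Cn (At \<sigma>) \<cdot> a \<cdot> i) (Cn (At \<sigma>) \<cdot> b \<cdot> i)" using Sq.prems i by simp
  qed (use D i in auto)
  then show ?case using E_subst(2)[OF D(1,2,1) ab] by simp
qed

lemma ext_eq_trans: "a \<in> Dt \<sigma> \<Longrightarrow> b \<in> Dt \<sigma> \<Longrightarrow> c \<in> Dt \<sigma> \<Longrightarrow> ext_eq \<sigma> a b \<Longrightarrow> ext_eq \<sigma> b c \<Longrightarrow> ext_eq \<sigma> a c"
proof (induction \<sigma> arbitrary: a b c)
  case N
  then show ?case using E_subst(1)[of a b c] by simp
next
  case (Fn \<sigma> \<tau>)
  have "ext_eq \<tau> (a \<cdot> d) (c \<cdot> d)" if d: "d \<in> Dt \<sigma>" for d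
    by (rule Fn.IH(2)[OF Dt_app[OF Fn.prems(1) d] Dt_app[OF Fn.prems(2) d] Dt_app[OF Fn.prems(3) d]])
      (use Fn.prems(4,5) d in simp_all)
  then show ?case by simp
next
  case (Sq \<sigma>)
  have D: "Cn (Len \<sigma>) \<cdot> x \<in> Dt N" "\<And>i. i \<in> Dt N \<Longrightarrow> Cn (At \<sigma>) \<cdot> x \<cdot> i \<in> Dt \<sigma>" if "x \<in> {a, b, c}" for x
    using Sq.prems that by (auto simp: Dt_def)
  have ab: "E (Cn (Len \<sigma>) \<cdot> a) (Cn (Len \<sigma>) \<cdot> b)" using Sq.prems by simp
  have ac: "E (Cn (Len \<sigma>) \<cdot> a) (Cn (Len \<sigma>) \<cdot> c)" using Sq.prems E_subst(1)[OF _ _ _ ab, of "Cn (Len \<sigma>) \<cdot> c"] D by simp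
  have "ext_eq \<sigma> (Cn (At \<sigma>) \<cdot> a \<cdot> i) (Cn (At \<sigma>) \<cdot> c \<cdot> i)"
    if i: "i \<in> Dt N" "tm.less i (Cn (Len \<sigma>) \<cdot> a)" for i
  proof (rule Sq.IH[of _ "Cn (At \<sigma>) \<cdot> b \<cdot> i"])
    have "tm.less i (Cn (Len \<sigma>) \<cdot> b)" using less_cong[OF i(1) _ _ ab] i D by blast
    then show "ext_eq \<sigma> (Cn (At \<sigma>) \<cdot> b \<cdot> i) (Cn (At \<sigma>) \<cdot> c \<cdot> i)" using Sq.prems i by simp
  qed (use i Sq.prems D in auto)
  then show ?case unfolding tm.ext_eq.simps using ac by blast
qed

section \<open>The quotient by extensional equality\<close>

text \<open>A class counts as standard as soon as one of its members is; by
  \<open>st_respects\<close> all of them are then standard if \<open>T\<close> contains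
  \<open>StAx\<close>.\<close>

definition "cls t = {s \<in> Dt (tyof t). ext_eq (tyof t) t s}"
definition "Dq \<sigma> = cls ` Dt \<sigma>"
definition "rep X = (SOME t. t \<in> X)"
definition "apq X Y = cls (rep X \<cdot> rep Y)"
definition "cnq c = cls (Cn c)"
definition "sdq X \<longleftrightarrow> (\<exists>t\<in>X. St t \<in> \<Gamma>)"

lemma cls_eq: assumes "a \<in> Dt \<sigma>" "b \<in> Dt \<sigma>" shows "cls a = cls b \<longleftrightarrow> ext_eq \<sigma> a b"
proof -
  have ty: "tyof a = \<sigma>" "tyof b = \<sigma>" using assms by (auto simp: Dt_def)
  show ?thesis
  proof
    assume "cls a = cls b"
    then have "b \<in> cls a" using assms(2) ext_eq_refl[OF assms(2)] by (simp add: cls_def ty)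
    then show "ext_eq \<sigma> a b" by (simp add: cls_def ty)
  next
    assume "ext_eq \<sigma> a b"
    then have "ext_eq \<sigma> a c \<longleftrightarrow> ext_eq \<sigma> b c" if "c \<in> Dt \<sigma>" for c
      using ext_eq_trans[OF assms that] ext_eq_trans[OF assms(2,1) that] ext_eq_sym[OF assms] by blast
    then show "cls a = cls b" by (auto simp: cls_def ty)
  qed
qed

lemma ball_Dq: "(\<forall>X\<in>Dq \<sigma>. P X) \<longleftrightarrow> (\<forall>a\<in>Dt \<sigma>. P (cls a))"
  by (simp add: Dq_def)

lemma rep_cls: assumes "a \<in> Dt \<sigma>" shows "rep (cls a) \<in> Dt \<sigma>" "ext_eq \<sigma> a (rep (cls a))" "cls (rep (cls a)) = cls a"
proof -
  have ty: "tyof a = \<sigma>" using assms by (auto simp: Dt_def)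
  have "a \<in> cls a" using assms ext_eq_refl by (simp add: cls_def ty)
  then have "rep (cls a) \<in> cls a" unfolding rep_def by (rule someI)
  then show 1: "rep (cls a) \<in> Dt \<sigma>" "ext_eq \<sigma> a (rep (cls a))" by (auto simp: cls_def ty)
  then show "cls (rep (cls a)) = cls a" using cls_eq[OF assms 1(1)] by simp
qed

text \<open>Independence of the chosen representatives: in the argument by the axiom of
  extensionality, in the function by the definition of equality at function types.\<close>

lemma apq_cls:
  assumes "f \<in> Dt (\<sigma> \<rightarrow> \<tau>)" "a \<in> Dt \<sigma>"
  shows "apq (cls f) (cls a) = cls (f \<cdot> a)"
proof -
  note f = rep_cls[OF assms(1)] and a = rep_cls[OF assms(2)]
  have "ext_eq \<tau> (f \<cdot> a) (f \<cdot> rep (cls a))" by (rule ext_eq_cong[OF assms a(1,2)])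
  moreover have "ext_eq \<tau> (f \<cdot> rep (cls a)) (rep (cls f) \<cdot> rep (cls a))" using f a by simp
  ultimately have "ext_eq \<tau> (f \<cdot> a) (rep (cls f) \<cdot> rep (cls a))"
    by (rule ext_eq_trans[OF Dt_app[OF assms] Dt_app[OF assms(1) a(1)] Dt_app[OF f(1) a(1)]])
  then show ?thesis
    unfolding apq_def using cls_eq[OF Dt_app[OF assms] Dt_app[OF f(1) a(1)]] by simp
qed

sublocale q: interp Dq apq cnq "(=)" sdq
proof
  show "apq f a \<in> Dq \<tau>" if fa: "f \<in> Dq (\<sigma> \<rightarrow> \<tau>)" "a \<in> Dq \<sigma>" for f a \<sigma> \<tau>
  proof -
    obtain s t where "s \<in> Dt (\<sigma> \<rightarrow> \<tau>)" "t \<in> Dt \<sigma>" "f = cls s" "a = cls t" using fa unfolding Dq_def by blast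
    then show ?thesis using apq_cls[of s \<sigma> \<tau> t] Dt_app[of s \<sigma> \<tau> t] unfolding Dq_def by simp
  qed
  show "cnq c \<in> Dq (ctyp c)" if "wfc c" for c
    using that by (auto simp: Dq_def cnq_def Dt_def)
qed

lemma val_q: "tm.typed \<rho> \<Longrightarrow> wft t \<Longrightarrow> q.val (\<lambda>x. cls (\<rho> x)) t = cls (tm.val \<rho> t)"
proof (induction t)
  case (App s t)
  have st: "tm.val \<rho> s \<in> Dt (tyof t \<rightarrow> tyof (s \<cdot> t))" "tm.val \<rho> t \<in> Dt (tyof t)"
    by (rule tm.val_in; use App.prems in simp)+
  show ?case using App apq_cls[OF st] by simp
qed (simp_all add: cnq_def)

lemma less_q:
  assumes "a \<in> Dt N" "b \<in> Dt N"
  shows "q.less (cls a) (cls b) \<longleftrightarrow> tm.less a b"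
proof -
  let ?\<rho> = "Var((0, N) := a, (1, N) := b)"
  have t: "tm.typed ?\<rho>" using typed_Var assms by simp
  have "q.less (cls a) (cls b) \<longleftrightarrow> q.sat (\<lambda>x. cls (?\<rho> x)) (lt (v 0) (v 1))"
    by (simp add: q.less_val[of _ _ "\<lambda>x. cls (?\<rho> x)"])
  also have "\<dots> \<longleftrightarrow> tm.sat ?\<rho> (lt (v 0) (v 1))"
    using val_q[OF t, of "subT \<cdot> (suc (v 0)) \<cdot> v 1"] val_q[OF t, of zero] cls_eq[of _ N zero]
      tm.val_in[OF t, of "subT \<cdot> (suc (v 0)) \<cdot> v 1" N] Dt_consts by simp
  also have "\<dots> \<longleftrightarrow> tm.less a b"
    by (simp add: tm.less_val[of _ _ ?\<rho>])
  finally show ?thesis .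
qed

text \<open>\<open>A0\<close> stands for the whole formula and \<open>A\<close> for a part of it:
  the fixed \<open>A0\<close> carries the alternative between internality and compatibility of
  \<open>St\<close> through the induction.\<close>

lemma sat_q:
  assumes st: "internal A0 \<or> (\<forall>\<sigma>. \<forall>a\<in>Dt \<sigma>. \<forall>b\<in>Dt \<sigma>. ext_eq \<sigma> a b \<longrightarrow> St a \<in> \<Gamma> \<longrightarrow> St b \<in> \<Gamma>)"
  shows "internal A0 \<longrightarrow> internal A \<Longrightarrow> tm.typed \<rho> \<Longrightarrow> wff A \<Longrightarrow>
    q.sat (\<lambda>x. cls (\<rho> x)) A = tm.sat \<rho> A"
proof (induction A arbitrary: \<rho>)
  case (Eq s t)
  then have "tm.val \<rho> s \<in> Dt N" "tm.val \<rho> t \<in> Dt N" using tm.val_in by auto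
  then show ?case using Eq.prems by (simp add: val_q cls_eq[of _ N])
next
  case (St t)
  define a where "a = tm.val \<rho> t"
  have a: "a \<in> Dt (tyof t)" unfolding a_def by (rule tm.val_in) (use St.prems in auto)
  have ty: "tyof a = tyof t" using a by (simp add: Dt_def)
  have "St a \<in> \<Gamma>" if "b \<in> Dt (tyof t)" "ext_eq (tyof t) a b" "St b \<in> \<Gamma>" for b
    using St.prems(1) st that a ext_eq_sym[OF a that(1,2)] by auto
  then have "sdq (cls a) \<longleftrightarrow> St a \<in> \<Gamma>"
    using a ext_eq_refl[OF a] unfolding sdq_def cls_def ty by blast
  then show ?case using St.prems by (simp add: val_q a_def)
next
  case (Forall x A)
  have "q.sat ((\<lambda>y. cls (\<rho> y))(x := cls a)) A = tm.sat (\<rho>(x := a)) A" if "a \<in> Dt (snd x)" for a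
  proof -
    have "(\<lambda>y. cls (\<rho> y))(x := cls a) = (\<lambda>y. cls ((\<rho>(x := a)) y))" by (rule HOL.ext) simp
    then show ?thesis
      using Forall.IH[OF _ tm.typed_upd[OF Forall.prems(2) that]] Forall.prems by (simp del: fun_upd_apply)
  qed
  then show ?case by (simp add: ball_Dq del: fun_upd_apply)
next
  case (BAll i t A)
  have "q.sat ((\<lambda>y. cls (\<rho> y))((i, N) := cls a)) A = tm.sat (\<rho>((i, N) := a)) A" if "a \<in> Dt N" for a
  proof -
    have "(\<lambda>y. cls (\<rho> y))((i, N) := cls a) = (\<lambda>y. cls ((\<rho>((i, N) := a)) y))" by (rule HOL.ext) simp
    then show ?thesis
      using BAll.IH[OF _ tm.typed_upd[OF BAll.prems(2), of a "(i, N)"]] BAll.prems that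
      by (simp del: fun_upd_apply)
  qed
  moreover have "tm.val \<rho> t \<in> Dt N" by (rule tm.val_in) (use BAll.prems in auto)
  ultimately show ?case using BAll.prems by (simp add: ball_Dq val_q less_q del: fun_upd_apply)
qed auto

lemma typed_q: assumes "q.typed \<rho>" obtains \<rho>' where "tm.typed \<rho>'" "\<rho> = (\<lambda>x. cls (\<rho>' x))"
proof -
  have "rep (\<rho> x) \<in> Dt (snd x) \<and> cls (rep (\<rho> x)) = \<rho> x" for x
    using q.typedD[OF assms, of x] rep_cls by (auto simp: Dq_def)
  then show ?thesis using that[of "\<lambda>x. rep (\<rho> x)"] unfolding tm.typed_def by auto
qed

text \<open>An instance of \<open>sat_q\<close>, for the internal formula \<open>eq\<close>; it
  makes the quotient extensional.\<close>

lemma ext_eq_q: "a \<in> Dt \<sigma> \<Longrightarrow> b \<in> Dt \<sigma> \<Longrightarrow> q.ext_eq \<sigma> (cls a) (cls b) = ext_eq \<sigma> a b"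
proof -
  assume ab: "a \<in> Dt \<sigma>" "b \<in> Dt \<sigma>"
  let ?\<rho> = "Var((0, \<sigma>) := a, (1, \<sigma>) := b)" and ?A = "eq \<sigma> (Var (0, \<sigma>)) (Var (1, \<sigma>))"
  have "q.sat (\<lambda>x. cls (?\<rho> x)) ?A = tm.sat ?\<rho> ?A"
    by (rule sat_q[of ?A]) (use ab typed_Var in \<open>auto simp: wff_eq simp del: fun_upd_apply\<close>)
  then show ?thesis by (simp add: q.sat_eq tm.sat_eq)
qed

lemma st_respects:
  assumes "internal A \<or> StAx \<subseteq> T"
  shows "internal A \<or> (\<forall>\<sigma>. \<forall>a\<in>Dt \<sigma>. \<forall>b\<in>Dt \<sigma>. ext_eq \<sigma> a b \<longrightarrow> St a \<in> \<Gamma> \<longrightarrow> St b \<in> \<Gamma>)"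
proof (cases "internal A")
  case False
  have "St b \<in> \<Gamma>" if ab: "a \<in> Dt \<sigma>" "b \<in> Dt \<sigma>" "ext_eq \<sigma> a b" "St a \<in> \<Gamma>" for \<sigma> a b
  proof -
    let ?s = "Var (0, \<sigma>)" and ?t = "Var (1, \<sigma>)"
    have "tm.sat (Var((0, \<sigma>) := a, (1, \<sigma>) := b)) (St ?s \<^bold>\<and> eq \<sigma> ?s ?t \<^bold>\<longrightarrow> St ?t)"
      by (rule axiom) (use ab assms False StAx.st_eq typed_Var in \<open>auto simp: wff_eq simp del: fun_upd_apply\<close>)
    then show ?thesis using ab by (simp add: tm.sat_eq)
  qed
  then show ?thesis by blast
qed blast

lemma model_q: "model T Dq apq cnq sdq"
proof
  show "a = b" if ab: "a \<in> Dq \<sigma>" "b \<in> Dq \<sigma>" "q.ext_eq \<sigma> a b" for a b \<sigma>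
  proof -
    obtain s t where "s \<in> Dt \<sigma>" "t \<in> Dt \<sigma>" "a = cls s" "b = cls t" using ab unfolding Dq_def by blast
    then show ?thesis using ab(3) ext_eq_q[of s \<sigma> t] cls_eq[of s \<sigma> t] by simp
  qed
  fix A \<rho> assume A: "T \<turnstile> A" "internal A \<or> StAx \<subseteq> T" and \<rho>: "q.typed \<rho>"
  from sat_q[OF st_respects[OF A(2)], of A] show "q.sat \<rho> A"
    using typed_q[OF \<rho>] sat_thm[OF A(1)] prv_wff[OF A(1)] by metis
qed

end

text \<open>If \<open>A\<close> is not derivable, some Henkin set omits it, and the quotient of its
  term model falsifies \<open>A\<close> when each variable denotes its own class. The elements of
  that model are sets of terms, so models over this one type suffice.\<close>

theorem completeness:
  assumes T: "EPRA \<subseteq> T" and A: "wff A" "internal A \<or> StAx \<subseteq> T"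
    and sat: "\<And>(D :: ty \<Rightarrow> trm set set) ap cn sd \<rho>. model T D ap cn sd \<Longrightarrow> interp.typed D \<rho> \<Longrightarrow>
      interp.sat D ap cn (=) sd \<rho> A"
  shows "T \<turnstile> A"
proof (rule ccontr)
  assume "\<not> (T \<turnstile> A)"
  then obtain \<Gamma> where \<Gamma>: "henkin T \<Gamma>" "A \<notin> \<Gamma>" using henkin_exists A by blast
  then interpret epra_henkin T \<Gamma> using T by (simp add: epra_henkin_def epra_henkin_axioms_def)
  have t: "q.typed (\<lambda>x. cls (Var x))"
    unfolding q.typed_def using typed_Var unfolding tm.typed_def by (auto simp: Dq_def)
  have "tm.sat Var A" using sat[OF model_q t] sat_q[OF st_respects[OF A(2)] _ typed_Var] A by blast
  then show False using truth A \<Gamma> by blast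
qed

section \<open>Combinators and induction in models of \<open>E-PRA\<^sup>\<omega>\<close>\<close>

declare lam.simps [simp del]

lemma lam_type: "wft t \<Longrightarrow> wft (lam x t) \<and> tyof (lam x t) = snd x \<rightarrow> tyof t"
  by (induction t) (auto simp: lam.simps)

lemma wft_lam [simp]: "wft t \<Longrightarrow> wft (lam x t)"
  and tyof_lam [simp]: "wft t \<Longrightarrow> tyof (lam x t) = snd x \<rightarrow> tyof t"
  using lam_type by blast+

lemma fvt_lam [simp]: "fvt (lam x t) = fvt t - {x}"
  by (induction t) (auto simp: lam.simps)

lemma addT_wf [simp]: "wft addT" "tyof addT = N \<rightarrow> N \<rightarrow> N" "fvt addT = {}"
  by (simp_all add: addT_def insert_Diff_if)

lemma condT_wf [simp]: "wft condT" "tyof condT = N \<rightarrow> N \<rightarrow> N \<rightarrow> N" "fvt condT = {}"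
  by (simp_all add: condT_def insert_Diff_if)

lemma triT_wf [simp]: "wft triT" "tyof triT = N \<rightarrow> N" "fvt triT = {}"
  by (simp_all add: triT_def insert_Diff_if)

lemma pairT_wf [simp]: "wft pairT" "tyof pairT = N \<rightarrow> N \<rightarrow> N" "fvt pairT = {}"
  by (simp_all add: pairT_def insert_Diff_if)

lemma rootT_wf [simp]: "wft rootT" "tyof rootT = N \<rightarrow> N" "fvt rootT = {}"
  by (simp_all add: rootT_def insert_Diff_if)

lemma sndT_wf [simp]: "wft sndT" "tyof sndT = N \<rightarrow> N" "fvt sndT = {}"
  by (simp_all add: sndT_def insert_Diff_if)

lemma fstT_wf [simp]: "wft fstT" "tyof fstT = N \<rightarrow> N" "fvt fstT = {}"
  by (simp_all add: fstT_def insert_Diff_if)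

lemma codeT_wf [simp]: "wft codeT" "tyof codeT = ty1 \<rightarrow> N \<rightarrow> N" "fvt codeT = {}"
  by (simp_all add: codeT_def insert_Diff_if)

lemma cutT_wf [simp]: "wft cutT" "tyof cutT = N \<rightarrow> N \<rightarrow> N" "fvt cutT = {}"
  by (simp_all add: cutT_def insert_Diff_if)

lemma lhT_wf [simp]: "wft lhT" "tyof lhT = N \<rightarrow> N" "fvt lhT = {}"
  by (simp_all add: lhT_def insert_Diff_if)

lemma extT_wf [simp]: "wft extT" "tyof extT = N \<rightarrow> N \<rightarrow> N" "fvt extT = {}"
  by (simp_all add: extT_def insert_Diff_if)

locale epra_model = model +
  assumes EPRA: "EPRA \<subseteq> T"
begin

notation ap (infixl \<open>\<bullet>\<close> 100)

abbreviation "Z \<equiv> cn Zero"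
abbreviation "S x \<equiv> cn Succ \<bullet> x"

lemma axiom: "A \<in> EPRA \<Longrightarrow> internal A \<Longrightarrow> wff A \<Longrightarrow> typed \<rho> \<Longrightarrow> sat \<rho> A"
  by (rule sound[OF ax]) (use EPRA in auto)

lemma cn_in: "wfc c \<Longrightarrow> ctyp c = \<sigma> \<Longrightarrow> cn c \<in> D \<sigma>"
  using cn_closed by blast

lemma Z_in [simp]: "Z \<in> D N"
  by (rule cn_in) simp_all

lemma S_in [simp]: "x \<in> D N \<Longrightarrow> S x \<in> D N"
  by (rule ap_closed[of _ N], rule cn_in) simp_all

text \<open>Zero, constant functions, and the sequence of length zero taken from a constant
  enumeration. Nonemptiness provides the default valuation \<open>base\<close>.\<close>

lemma D_nonempty: "D \<sigma> \<noteq> {}"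
proof (induction \<sigma>)
  case N
  then show ?case using Z_in by blast
next
  case (Fn \<sigma> \<tau>)
  then obtain a where a: "a \<in> D \<tau>" by blast
  have "cn (CombK \<tau> \<sigma>) \<in> D (\<tau> \<rightarrow> \<sigma> \<rightarrow> \<tau>)" by (rule cn_in) simp_all
  from ap_closed[OF this a] show ?case by blast
next
  case (Sq \<sigma>)
  then obtain a where a: "a \<in> D \<sigma>" by blast
  have "cn (CombK \<sigma> N) \<in> D (\<sigma> \<rightarrow> N \<rightarrow> \<sigma>)" by (rule cn_in) simp_all
  moreover have "cn (Mk \<sigma>) \<in> D ((N \<rightarrow> \<sigma>) \<rightarrow> N \<rightarrow> Sq \<sigma>)" by (rule cn_in) simp_all
  ultimately have "cn (Mk \<sigma>) \<bullet> (cn (CombK \<sigma> N) \<bullet> a) \<bullet> Z \<in> D (Sq \<sigma>)"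
    using a ap_closed Z_in by blast
  then show ?case by blast
qed

definition base :: "var \<Rightarrow> 'a" where "base x = (SOME a. a \<in> D (snd x))"

lemma typed_base [simp]: "typed base"
  unfolding typed_def base_def using D_nonempty by (metis some_in_eq)

lemma sat_eq_iff:
  assumes "typed \<rho>" "wft s" "wft t" "tyof s = \<sigma>" "tyof t = \<sigma>"
  shows "sat \<rho> (eq \<sigma> s t) \<longleftrightarrow> val \<rho> s = val \<rho> t"
proof -
  have refl: "ext_eq \<tau> a a" for a \<tau>
    by (induction \<tau> arbitrary: a) auto
  show ?thesis
    using extensional[of "val \<rho> s" \<sigma> "val \<rho> t"] val_in assms refl by (auto simp: sat_eq)
qed

lemma fn_ext:
  assumes "f \<in> D (\<sigma> \<rightarrow> \<tau>)" "g \<in> D (\<sigma> \<rightarrow> \<tau>)" "\<And>a. a \<in> D \<sigma> \<Longrightarrow> f \<bullet> a = g \<bullet> a"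
  shows "f = g"
proof (rule extensional)
  have refl: "ext_eq \<tau> a a" for a
    by (induction \<tau> arbitrary: a) auto
  show "ext_eq (\<sigma> \<rightarrow> \<tau>) f g" using assms(3) refl by simp
qed (use assms in auto)

lemma combK: "a \<in> D \<sigma> \<Longrightarrow> b \<in> D \<tau> \<Longrightarrow> cn (CombK \<sigma> \<tau>) \<bullet> a \<bullet> b = a"
proof -
  assume ab: "a \<in> D \<sigma>" "b \<in> D \<tau>"
  let ?\<rho> = "base((0, \<sigma>) := a, (1, \<tau>) := b)"
  let ?s = "Cn (CombK \<sigma> \<tau>) \<cdot> Var (0, \<sigma>) \<cdot> Var (1, \<tau>)"
  have "sat ?\<rho> (eq \<sigma> ?s (Var (0, \<sigma>)))"
    by (rule axiom) (use ab in \<open>auto intro: EPRA.combK wff_eq simp del: fun_upd_apply\<close>)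
  then show ?thesis using ab by (subst (asm) sat_eq_iff) auto
qed

lemma combS:
  "a \<in> D (\<rho> \<rightarrow> \<sigma> \<rightarrow> \<tau>) \<Longrightarrow> b \<in> D (\<rho> \<rightarrow> \<sigma>) \<Longrightarrow> c \<in> D \<rho> \<Longrightarrow>
    cn (CombS \<rho> \<sigma> \<tau>) \<bullet> a \<bullet> b \<bullet> c = a \<bullet> c \<bullet> (b \<bullet> c)"
proof -
  assume abc: "a \<in> D (\<rho> \<rightarrow> \<sigma> \<rightarrow> \<tau>)" "b \<in> D (\<rho> \<rightarrow> \<sigma>)" "c \<in> D \<rho>"
  let ?a = "(0, \<rho> \<rightarrow> \<sigma> \<rightarrow> \<tau>)" and ?b = "(1, \<rho> \<rightarrow> \<sigma>)" and ?c = "(2, \<rho>)"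
  let ?\<rho> = "base(?a := a, ?b := b, ?c := c)"
  let ?s = "Cn (CombS \<rho> \<sigma> \<tau>) \<cdot> Var ?a \<cdot> Var ?b \<cdot> Var ?c" and ?t = "Var ?a \<cdot> Var ?c \<cdot> (Var ?b \<cdot> Var ?c)"
  have "sat ?\<rho> (eq \<tau> ?s ?t)"
    by (rule axiom) (use abc in \<open>auto intro: EPRA.combS wff_eq simp del: fun_upd_apply\<close>)
  then show ?thesis using abc by (subst (asm) sat_eq_iff) auto
qed

lemma rec_Z: "a \<in> D N \<Longrightarrow> f \<in> D (N \<rightarrow> N \<rightarrow> N) \<Longrightarrow> cn Rec \<bullet> Z \<bullet> a \<bullet> f = a"
  using axiom[OF EPRA.rec_zero[of "v 0" "Var (0, N \<rightarrow> N \<rightarrow> N)"],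
      of "base((0, N) := a, (0, N \<rightarrow> N \<rightarrow> N) := f)"] by simp

lemma rec_S: "n \<in> D N \<Longrightarrow> a \<in> D N \<Longrightarrow> f \<in> D (N \<rightarrow> N \<rightarrow> N) \<Longrightarrow>
  cn Rec \<bullet> S n \<bullet> a \<bullet> f = f \<bullet> (cn Rec \<bullet> n \<bullet> a \<bullet> f) \<bullet> n"
  using axiom[OF EPRA.rec_suc[of "v 1" "v 0" "Var (0, N \<rightarrow> N \<rightarrow> N)"],
      of "base((0, N) := a, (1, N) := n, (0, N \<rightarrow> N \<rightarrow> N) := f)"] by simp

lemma S_neq_Z [simp]: "x \<in> D N \<Longrightarrow> S x \<noteq> Z"
  using axiom[OF EPRA.suc_nonzero[of "v 0"], of "base((0, N) := x)"] by simp

lemma S_inj [simp]: "x \<in> D N \<Longrightarrow> y \<in> D N \<Longrightarrow> S x = S y \<longleftrightarrow> x = y"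
  using axiom[OF EPRA.suc_inj[of "v 0" "v 1"], of "base((0, N) := x, (1, N) := y)"] by auto

text \<open>Induction inside the model is available for quantifier-free formulas only. Each use
  below therefore spells out a formula, with its parameters assigned to variables other than
  \<open>(0, N)\<close>.\<close>

lemma ind:
  assumes A: "qf A" "wff A" and \<rho>: "typed \<rho>" and n: "n \<in> D N"
    and zero: "sat (\<rho>((0, N) := Z)) A"
    and suc: "\<And>m. m \<in> D N \<Longrightarrow> sat (\<rho>((0, N) := m)) A \<Longrightarrow> sat (\<rho>((0, N) := S m)) A"
  shows "sat (\<rho>((0, N) := n)) A"
proof -
  have i: "internal (sbf (0, N) s A)" for s
    using A(1) by (induction A) auto
  have "sat \<rho> (sbf (0, N) zero A \<^bold>\<longrightarrow> Forall (0, N) (A \<^bold>\<longrightarrow> sbf (0, N) (suc (v 0)) A) \<^bold>\<longrightarrow> Forall (0, N) A)"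
    by (rule axiom) (use A \<rho> i in \<open>auto intro!: EPRA.qf_ind wff_sbf intro: qf_internal\<close>)
  moreover have "sat \<rho> (sbf (0, N) zero A)" using zero A by (simp add: sat_sbf)
  moreover have "sat (\<rho>((0, N) := m)) (sbf (0, N) (suc (v 0)) A)"
    if "m \<in> D N" "sat (\<rho>((0, N) := m)) A" for m
    using suc[OF that] A by (simp add: sat_sbf)
  ultimately show ?thesis using n by simp
qed

text \<open>Beta conversion, by the cases of the translation: the identity as \<open>S K K\<close>,
  constant functions where \<open>x\<close> is absent, and \<open>S\<close> otherwise.\<close>

lemma lam_ap: "typed \<rho> \<Longrightarrow> wft t \<Longrightarrow> a \<in> D (snd x) \<Longrightarrow> val \<rho> (lam x t) \<bullet> a = val (\<rho>(x := a)) t"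
proof (induction t)
  case (Var y)
  show ?case
  proof (cases "y = x")
    case True
    let ?\<sigma> = "snd x"
    have "cn (CombK ?\<sigma> (?\<sigma> \<rightarrow> ?\<sigma>)) \<in> D (?\<sigma> \<rightarrow> (?\<sigma> \<rightarrow> ?\<sigma>) \<rightarrow> ?\<sigma>)" "cn (CombK ?\<sigma> ?\<sigma>) \<in> D (?\<sigma> \<rightarrow> ?\<sigma> \<rightarrow> ?\<sigma>)"
      by (rule cn_in; simp)+
    then show ?thesis using Var True by (simp add: lam.simps combS combK ap_closed)
  next
    case False
    then show ?thesis using Var typedD[of \<rho> y] by (simp add: lam.simps combK)
  qed
next
  case (Cn c)
  then show ?case by (simp add: lam.simps combK cn_closed)
next
  case (App s t)
  show ?case
  proof (cases "x \<in> fvt (s \<cdot> t)")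
    case True
    have "val \<rho> (lam x s) \<in> D (snd x \<rightarrow> tyof t \<rightarrow> tyof (s \<cdot> t))" "val \<rho> (lam x t) \<in> D (snd x \<rightarrow> tyof t)"
      by (rule val_in; use App.prems in simp)+
    then show ?thesis using App True by (simp add: lam.simps combS)
  next
    case False
    have "val \<rho> (s \<cdot> t) \<in> D (tyof (s \<cdot> t))" by (rule val_in) (use App.prems in auto)
    then show ?thesis using False App.prems by (simp add: lam.simps combK del: fun_upd_apply)
  qed
qed


section \<open>Arithmetic of the model's numbers\<close>

definition "cl t = val base t"

lemma val_cl: "fvt t = {} \<Longrightarrow> val \<rho> t = cl t"
  unfolding cl_def by (rule val_cong) simp

lemma val_arith [simp]:
  "val \<rho> addT = cl addT" "val \<rho> predT = cl predT" "val \<rho> subT = cl subT" "val \<rho> condT = cl condT"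
  "val \<rho> triT = cl triT" "val \<rho> pairT = cl pairT" "val \<rho> rootT = cl rootT" "val \<rho> sndT = cl sndT"
  "val \<rho> fstT = cl fstT" "val \<rho> codeT = cl codeT" "val \<rho> cutT = cl cutT" "val \<rho> lhT = cl lhT"
  "val \<rho> extT = cl extT"
  by (simp_all add: val_cl)

lemma cl_in: "wft t \<Longrightarrow> tyof t = \<sigma> \<Longrightarrow> cl t \<in> D \<sigma>"
  unfolding cl_def by (rule val_in) simp_all

lemma N_in [simp]:
  "f \<in> D (N \<rightarrow> N) \<Longrightarrow> x \<in> D N \<Longrightarrow> f \<bullet> x \<in> D N"
  "f2 \<in> D (N \<rightarrow> N \<rightarrow> N) \<Longrightarrow> x \<in> D N \<Longrightarrow> y \<in> D N \<Longrightarrow> f2 \<bullet> x \<bullet> y \<in> D N"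
  by (blast intro: ap_closed)+

abbreviation plus (infixl \<open>\<oplus>\<close> 65) where "x \<oplus> y \<equiv> cl addT \<bullet> x \<bullet> y"
abbreviation minus (infixl \<open>\<ominus>\<close> 65) where "x \<ominus> y \<equiv> cl subT \<bullet> x \<bullet> y"
abbreviation "pred x \<equiv> cl predT \<bullet> x"
abbreviation "cond c x y \<equiv> cl condT \<bullet> c \<bullet> x \<bullet> y"

lemma arith_in [simp]:
  "x \<in> D N \<Longrightarrow> y \<in> D N \<Longrightarrow> x \<oplus> y \<in> D N"
  "x \<in> D N \<Longrightarrow> y \<in> D N \<Longrightarrow> x \<ominus> y \<in> D N"
  "x \<in> D N \<Longrightarrow> pred x \<in> D N"
  "x \<in> D N \<Longrightarrow> y \<in> D N \<Longrightarrow> z \<in> D N \<Longrightarrow> cond x y z \<in> D N"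
  using cl_in[of addT "N \<rightarrow> N \<rightarrow> N"] cl_in[of subT "N \<rightarrow> N \<rightarrow> N"] cl_in[of predT "N \<rightarrow> N"]
    cl_in[of condT "N \<rightarrow> N \<rightarrow> N \<rightarrow> N"] by (auto intro: ap_closed)

lemma cl_lam: "wft t \<Longrightarrow> a \<in> D (snd x) \<Longrightarrow> cl (lam x t) \<bullet> a = val (base(x := a)) t"
  unfolding cl_def by (rule lam_ap) simp_all

lemma rec_in: "n \<in> D N \<Longrightarrow> a \<in> D N \<Longrightarrow> f \<in> D (N \<rightarrow> N \<rightarrow> N) \<Longrightarrow> cn Rec \<bullet> n \<bullet> a \<bullet> f \<in> D N"
  using cn_in[of Rec, OF _ refl] ap_closed by simp blast

lemmas evals = rec_in cl_lam lam_ap rec_Z rec_S val_in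

lemma plus_0 [simp]: "x \<in> D N \<Longrightarrow> x \<oplus> Z = x"
  by (simp add: addT_def evals)

lemma plus_S [simp]: "x \<in> D N \<Longrightarrow> y \<in> D N \<Longrightarrow> x \<oplus> S y = S (x \<oplus> y)"
  by (simp add: addT_def evals)

lemma pred_0 [simp]: "pred Z = Z"
  by (simp add: predT_def evals)

lemma pred_S [simp]: "x \<in> D N \<Longrightarrow> pred (S x) = x"
  by (simp add: predT_def evals)

lemma minus_0 [simp]: "x \<in> D N \<Longrightarrow> x \<ominus> Z = x"
  by (simp add: subT_def evals)

lemma minus_S [simp]: "x \<in> D N \<Longrightarrow> y \<in> D N \<Longrightarrow> x \<ominus> S y = pred (x \<ominus> y)"
  by (simp add: subT_def evals)

lemma cond_0 [simp]: "x \<in> D N \<Longrightarrow> y \<in> D N \<Longrightarrow> cond Z x y = x"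
  by (simp add: condT_def evals)

lemma cond_S [simp]: "c \<in> D N \<Longrightarrow> x \<in> D N \<Longrightarrow> y \<in> D N \<Longrightarrow> cond (S c) x y = y"
  by (simp add: condT_def evals)

lemma Z_plus [simp]: "x \<in> D N \<Longrightarrow> Z \<oplus> x = x"
  using ind[of "Eq (addT \<cdot> zero \<cdot> v 0) (v 0)" base x] by simp

lemma S_plus [simp]: "x \<in> D N \<Longrightarrow> y \<in> D N \<Longrightarrow> S x \<oplus> y = S (x \<oplus> y)"
  using ind[of "Eq (addT \<cdot> suc (v 1) \<cdot> v 0) (suc (addT \<cdot> v 1 \<cdot> v 0))" "base((1, N) := x)" y] by simp

lemma plus_commute: "x \<in> D N \<Longrightarrow> y \<in> D N \<Longrightarrow> x \<oplus> y = y \<oplus> x"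
  using ind[of "Eq (addT \<cdot> v 1 \<cdot> v 0) (addT \<cdot> v 0 \<cdot> v 1)" "base((1, N) := x)" y] by simp

lemma plus_assoc: "x \<in> D N \<Longrightarrow> y \<in> D N \<Longrightarrow> z \<in> D N \<Longrightarrow> x \<oplus> y \<oplus> z = x \<oplus> (y \<oplus> z)"
  using ind[of "Eq (addT \<cdot> (addT \<cdot> v 1 \<cdot> v 2) \<cdot> v 0) (addT \<cdot> v 1 \<cdot> (addT \<cdot> v 2 \<cdot> v 0))"
    "base((1, N) := x, (2, N) := y)" z] by simp

lemma N_cases: assumes "x \<in> D N" obtains "x = Z" | y where "y \<in> D N" "x = S y"
proof -
  have "x = Z \<or> x = S (pred x)"
    using ind[of "\<^bold>\<not> Eq (v 0) zero \<^bold>\<longrightarrow> Eq (v 0) (suc (predT \<cdot> v 0))" base x] assms by auto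
  then show ?thesis using that assms arith_in by blast
qed

lemma Z_minus [simp]: "x \<in> D N \<Longrightarrow> Z \<ominus> x = Z"
  using ind[of "Eq (subT \<cdot> zero \<cdot> v 0) zero" base x] by simp

lemma S_minus_S: "x \<in> D N \<Longrightarrow> y \<in> D N \<Longrightarrow> S x \<ominus> S y = x \<ominus> y"
  using ind[of "Eq (subT \<cdot> suc (v 1) \<cdot> suc (v 0)) (subT \<cdot> v 1 \<cdot> v 0)" "base((1, N) := x)" y] by simp

lemma pred_S_minus [simp]: "x \<in> D N \<Longrightarrow> y \<in> D N \<Longrightarrow> pred (S x \<ominus> y) = x \<ominus> y"
  using S_minus_S[of x y] by simp

lemma minus_self [simp]: "x \<in> D N \<Longrightarrow> x \<ominus> x = Z"
  using ind[of "Eq (subT \<cdot> v 0 \<cdot> v 0) zero" base x] by simp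

lemma plus_cancel: "x \<in> D N \<Longrightarrow> y \<in> D N \<Longrightarrow> z \<in> D N \<Longrightarrow> x \<oplus> z = y \<oplus> z \<longleftrightarrow> x = y"
  using ind[of "Eq (addT \<cdot> v 1 \<cdot> v 0) (addT \<cdot> v 2 \<cdot> v 0) \<^bold>\<longrightarrow> Eq (v 1) (v 2)"
    "base((1, N) := x, (2, N) := y)" z] by auto

lemma plus_minus: "x \<in> D N \<Longrightarrow> z \<in> D N \<Longrightarrow> x \<oplus> z \<ominus> x = z"
  using ind[of "Eq (subT \<cdot> (addT \<cdot> v 0 \<cdot> v 1) \<cdot> v 0) (v 1)" "base((1, N) := z)" x]
  by (simp add: S_minus_S del: minus_S)

lemma minus_plus: "x \<in> D N \<Longrightarrow> z \<in> D N \<Longrightarrow> x \<ominus> (x \<oplus> z) = Z"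
  using ind[of "Eq (subT \<cdot> v 0 \<cdot> (addT \<cdot> v 0 \<cdot> v 1)) zero" "base((1, N) := z)" x]
  by (simp add: S_minus_S del: minus_S)

text \<open>Of two numbers, one is the sum of the other and a truncated difference. This is the
  source of the linear order below.\<close>

definition minus_spec :: "'a \<Rightarrow> 'a \<Rightarrow> bool" where
  "minus_spec x y \<longleftrightarrow> (x \<ominus> y = Z \<longrightarrow> x \<oplus> (y \<ominus> x) = y) \<and> (x \<ominus> y \<noteq> Z \<longrightarrow> y \<oplus> (x \<ominus> y) = x \<and> y \<ominus> x = Z)"

text \<open>Double induction: a counterexample \<open>(x, y)\<close> stays one when both entries are decreased
  \<open>x\<close> times, which makes the first entry zero.\<close>

lemma minus_spec: assumes "x \<in> D N" "y \<in> D N" shows "minus_spec x y"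
proof (rule ccontr)
  assume neg: "\<not> minus_spec x y"
  have RZ: "minus_spec Z b" if "b \<in> D N" for b using that by (simp add: minus_spec_def)
  have RSZ: "minus_spec (S a) Z" if "a \<in> D N" for a using that by (simp add: minus_spec_def)
  have RSS: "minus_spec (S a) (S b)" if "a \<in> D N" "b \<in> D N" "minus_spec a b" for a b
    using that by (simp add: minus_spec_def S_minus_S del: minus_S)
  have step: "minus_spec (pred a) (pred b) \<Longrightarrow> minus_spec a b" if "a \<in> D N" "b \<in> D N" for a b
    using N_cases[OF that(1)] N_cases[OF that(2)] RZ RSZ RSS that by (metis pred_S)
  let ?X = "subT \<cdot> v 1 \<cdot> v 0" and ?Y = "subT \<cdot> v 2 \<cdot> v 0"
  let ?A = "\<^bold>\<not> ((Eq (subT \<cdot> ?X \<cdot> ?Y) zero \<^bold>\<longrightarrow> Eq (addT \<cdot> ?X \<cdot> (subT \<cdot> ?Y \<cdot> ?X)) ?Y) \<^bold>\<and>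
    (\<^bold>\<not> Eq (subT \<cdot> ?X \<cdot> ?Y) zero \<^bold>\<longrightarrow>
      Eq (addT \<cdot> ?Y \<cdot> (subT \<cdot> ?X \<cdot> ?Y)) ?X \<^bold>\<and> Eq (subT \<cdot> ?Y \<cdot> ?X) zero))"
  let ?\<rho> = "base((1, N) := x, (2, N) := y)"
  have A: "sat (?\<rho>((0, N) := k)) ?A \<longleftrightarrow> \<not> minus_spec (x \<ominus> k) (y \<ominus> k)" for k
    by (simp add: minus_spec_def)
  have "sat (?\<rho>((0, N) := x)) ?A"
  proof (rule ind)
    show "sat (?\<rho>((0, N) := Z)) ?A" unfolding A using neg assms by simp
    show "sat (?\<rho>((0, N) := S m)) ?A" if "m \<in> D N" "sat (?\<rho>((0, N) := m)) ?A" for m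
      using that(2) step[of "x \<ominus> m" "y \<ominus> m"] that(1) assms unfolding A by auto
  qed (use assms in simp_all)
  then show False unfolding A using assms RZ by simp
qed


section \<open>The order of the numbers\<close>

definition lq (infix \<open>\<preceq>\<close> 50) where "x \<preceq> y \<longleftrightarrow> x \<ominus> y = Z"

lemma lq_iff: assumes "x \<in> D N" "y \<in> D N" shows "x \<preceq> y \<longleftrightarrow> (\<exists>z\<in>D N. y = x \<oplus> z)"
proof
  assume "x \<preceq> y"
  then have "y = x \<oplus> (y \<ominus> x)" using minus_spec[OF assms] by (simp add: minus_spec_def lq_def)
  then show "\<exists>z\<in>D N. y = x \<oplus> z" using assms arith_in by blast
qed (use assms minus_plus lq_def in auto)

lemma lqE: assumes "x \<preceq> y" "x \<in> D N" "y \<in> D N" obtains z where "z \<in> D N" "y = x \<oplus> z"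
  using lq_iff assms by blast

lemma lq_plus [simp]: "x \<in> D N \<Longrightarrow> y \<in> D N \<Longrightarrow> x \<preceq> x \<oplus> y" "x \<in> D N \<Longrightarrow> y \<in> D N \<Longrightarrow> y \<preceq> x \<oplus> y"
  using lq_iff arith_in plus_commute by metis+

lemma lq_refl [simp]: "x \<in> D N \<Longrightarrow> x \<preceq> x"
  by (simp add: lq_def)

lemma Z_lq [simp]: "x \<in> D N \<Longrightarrow> Z \<preceq> x"
  by (simp add: lq_def)

lemma S_lq_S [simp]: "x \<in> D N \<Longrightarrow> y \<in> D N \<Longrightarrow> S x \<preceq> S y \<longleftrightarrow> x \<preceq> y"
  by (simp add: lq_def S_minus_S del: minus_S)

lemma S_lq_Z [simp]: "x \<in> D N \<Longrightarrow> \<not> S x \<preceq> Z"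
  by (simp add: lq_def)

lemma lq_trans: "x \<preceq> y \<Longrightarrow> y \<preceq> z \<Longrightarrow> x \<in> D N \<Longrightarrow> y \<in> D N \<Longrightarrow> z \<in> D N \<Longrightarrow> x \<preceq> z"
  by (metis lqE lq_plus(1) plus_assoc arith_in(1))

lemma plus_eq_self: assumes "x \<in> D N" "z \<in> D N" "x = x \<oplus> z" shows "z = Z"
  using plus_cancel[of z Z x] assms plus_commute[of x z] by simp

lemma lq_antisym: assumes "x \<preceq> y" "y \<preceq> x" "x \<in> D N" "y \<in> D N" shows "x = y"
proof -
  obtain z w where zw: "z \<in> D N" "y = x \<oplus> z" "w \<in> D N" "x = y \<oplus> w" using assms lqE by metis
  then have "z \<oplus> w = Z" using plus_eq_self[of x "z \<oplus> w"] assms plus_assoc[of x z w] by simp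
  then have "z = Z" using N_cases[OF zw(1)] zw by (metis S_neq_Z S_plus arith_in(1))
  then show ?thesis using zw assms by simp
qed

lemma not_S_lq [simp]: assumes "x \<in> D N" shows "\<not> S x \<preceq> x"
proof
  assume "S x \<preceq> x"
  then obtain z where z: "z \<in> D N" "x = S x \<oplus> z" using assms lqE by (metis S_in)
  then have "x = x \<oplus> S z" using assms by simp
  then show False using plus_eq_self[of x "S z"] assms z by simp
qed

lemma not_lq: assumes "x \<in> D N" "y \<in> D N" shows "\<not> x \<preceq> y \<longleftrightarrow> S y \<preceq> x"
proof
  assume n: "\<not> x \<preceq> y"
  then obtain w where w: "w \<in> D N" "x \<ominus> y = S w" using N_cases[of "x \<ominus> y"] assms by (auto simp: lq_def)
  then have "x = y \<oplus> S w" using minus_spec[OF assms] by (simp add: minus_spec_def)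
  then have "x = S y \<oplus> w" using assms w by simp
  then show "S y \<preceq> x" using assms w lq_plus(1)[of "S y" w] by simp
next
  assume "S y \<preceq> x"
  then show "\<not> x \<preceq> y" using lq_trans[of "S y" x y] assms by auto
qed

lemma lq_S_iff: assumes "x \<in> D N" "y \<in> D N" shows "x \<preceq> S y \<longleftrightarrow> x \<preceq> y \<or> x = S y"
proof
  assume "x \<preceq> S y"
  then obtain z where z: "z \<in> D N" "S y = x \<oplus> z" using lqE assms by (metis S_in)
  show "x \<preceq> y \<or> x = S y"
  proof (rule N_cases[OF z(1)])
    assume "z = Z"
    then show ?thesis using z assms by simp
  next
    fix w assume w: "w \<in> D N" "z = S w"
    then have "y = x \<oplus> w" using z assms by simp
    then show ?thesis using w assms by simp
  qed
next
  have "y \<preceq> S y" using lq_iff[of y "S y"] assms by (auto intro!: bexI[of _ "S Z"])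
  then show "x \<preceq> y \<or> x = S y \<Longrightarrow> x \<preceq> S y" using lq_trans[of x y "S y"] assms by auto
qed

lemma lq_S [simp]: "x \<in> D N \<Longrightarrow> x \<preceq> S x"
  by (simp add: lq_S_iff)

lemma lq_total: "x \<in> D N \<Longrightarrow> y \<in> D N \<Longrightarrow> x \<preceq> y \<or> y \<preceq> x"
  using not_lq[of x y] lq_trans[of y "S y" x] by auto

lemma S_lqD: "S x \<preceq> y \<Longrightarrow> x \<in> D N \<Longrightarrow> y \<in> D N \<Longrightarrow> x \<preceq> y"
  using lq_trans[of x "S x" y] by simp

lemma plus_mono: assumes "a \<preceq> b" "c \<preceq> d" "a \<in> D N" "b \<in> D N" "c \<in> D N" "d \<in> D N"
  shows "a \<oplus> c \<preceq> b \<oplus> d"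
proof -
  obtain z w where zw: "z \<in> D N" "b = a \<oplus> z" "w \<in> D N" "d = c \<oplus> w" using assms lqE by metis
  have "b \<oplus> d = a \<oplus> (z \<oplus> c \<oplus> w)" using zw assms by (simp add: plus_assoc)
  also have "\<dots> = a \<oplus> c \<oplus> (z \<oplus> w)"
    using zw assms plus_commute[of z c] by (simp add: plus_assoc)
  finally show ?thesis using zw assms by simp
qed

lemma minus_in_between: "x \<in> D N \<Longrightarrow> y \<in> D N \<Longrightarrow> z \<in> D N \<Longrightarrow> y = x \<oplus> z \<Longrightarrow> y \<ominus> x = z \<and> y \<ominus> z = x"
  using plus_minus[of x z] plus_minus[of z x] plus_commute[of x z] by simp

text \<open>Makes the simplifier turn the satisfaction of \<open>le\<close> into
  \<open>\<preceq>\<close>.\<close>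

lemma minus_zero_iff [simp]: "x \<ominus> y = Z \<longleftrightarrow> x \<preceq> y"
  by (simp add: lq_def)

lemma less_iff [simp]: "less x y \<longleftrightarrow> S x \<preceq> y"
  using less_val[of x y base] by simp

lemma cond_iff: "c \<in> D N \<Longrightarrow> x \<in> D N \<Longrightarrow> y \<in> D N \<Longrightarrow> cond c x y = (if c = Z then x else y)"
  by (metis N_cases cond_0 cond_S)

declare minus_S [simp del]


section \<open>Pairing and sequence codes\<close>

abbreviation "tri x \<equiv> cl triT \<bullet> x"
abbreviation "pair x y \<equiv> cl pairT \<bullet> x \<bullet> y"
abbreviation "root x \<equiv> cl rootT \<bullet> x"
abbreviation "sec x \<equiv> cl sndT \<bullet> x"
abbreviation "fir x \<equiv> cl fstT \<bullet> x"
abbreviation "code f n \<equiv> cl codeT \<bullet> f \<bullet> n"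
abbreviation "cutf s k \<equiv> cl cutT \<bullet> s \<bullet> k"
abbreviation "lh s \<equiv> cl lhT \<bullet> s"
abbreviation "ex s \<equiv> cl extT \<bullet> s"

lemma code_ops_in [simp]:
  "x \<in> D N \<Longrightarrow> tri x \<in> D N" "x \<in> D N \<Longrightarrow> y \<in> D N \<Longrightarrow> pair x y \<in> D N"
  "x \<in> D N \<Longrightarrow> root x \<in> D N" "x \<in> D N \<Longrightarrow> sec x \<in> D N" "x \<in> D N \<Longrightarrow> fir x \<in> D N"
  "f \<in> D ty1 \<Longrightarrow> y \<in> D N \<Longrightarrow> code f y \<in> D N" "x \<in> D N \<Longrightarrow> y \<in> D N \<Longrightarrow> cutf x y \<in> D N"
  "x \<in> D N \<Longrightarrow> lh x \<in> D N" "x \<in> D N \<Longrightarrow> ex x \<in> D ty1"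
  using cl_in[of triT "N \<rightarrow> N"] cl_in[of pairT "N \<rightarrow> N \<rightarrow> N"] cl_in[of rootT "N \<rightarrow> N"]
    cl_in[of sndT "N \<rightarrow> N"] cl_in[of fstT "N \<rightarrow> N"] cl_in[of codeT "ty1 \<rightarrow> N \<rightarrow> N"]
    cl_in[of cutT "N \<rightarrow> N \<rightarrow> N"] cl_in[of lhT "N \<rightarrow> N"] cl_in[of extT "N \<rightarrow> N \<rightarrow> N"]
  by (auto intro: ap_closed)

lemma tri_0 [simp]: "tri Z = Z"
  by (simp add: triT_def evals)

lemma tri_S: "x \<in> D N \<Longrightarrow> tri (S x) = tri x \<oplus> S x"
  by (simp add: triT_def evals)

lemma pair_eq: "x \<in> D N \<Longrightarrow> y \<in> D N \<Longrightarrow> pair x y = tri (x \<oplus> y) \<oplus> y"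
  by (simp add: pairT_def evals)

lemma root_0 [simp]: "root Z = Z"
  by (simp add: rootT_def evals)

lemma root_S: "x \<in> D N \<Longrightarrow> root (S x) = (if tri (S (root x)) \<preceq> S x then S (root x) else root x)"
  by (simp add: rootT_def evals cond_iff)

lemma sec_eq: "x \<in> D N \<Longrightarrow> sec x = x \<ominus> tri (root x)"
  by (simp add: sndT_def evals)

lemma fir_eq: "x \<in> D N \<Longrightarrow> fir x = root x \<ominus> sec x"
  by (simp add: fstT_def evals)

lemma fir_0 [simp]: "fir Z = Z"
  by (simp add: fir_eq)

text \<open>Induction on the difference of the two arguments.\<close>

lemma tri_mono: assumes "x \<preceq> y" "x \<in> D N" "y \<in> D N" shows "tri x \<preceq> tri y"
proof -
  obtain z where z: "z \<in> D N" "y = x \<oplus> z" using lqE assms by blast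
  let ?A = "le (triT \<cdot> v 1) (triT \<cdot> (addT \<cdot> v 1 \<cdot> v 0))"
  have "sat (base((1, N) := x, (0, N) := z)) ?A"
  proof (rule ind)
    fix m assume m: "m \<in> D N" "sat (base((1, N) := x, (0, N) := m)) ?A"
    have "tri (x \<oplus> m) \<preceq> tri (S (x \<oplus> m))" using m assms by (simp add: tri_S del: plus_S)
    then show "sat (base((1, N) := x, (0, N) := S m)) ?A"
      using m assms lq_trans[of "tri x" "tri (x \<oplus> m)"] by simp
  qed (use assms z in simp_all)
  then show ?thesis using z by simp
qed

lemma lq_tri: "x \<in> D N \<Longrightarrow> x \<preceq> tri x"
  using ind[of "le (v 0) (triT \<cdot> v 0)" base x] by (simp add: tri_S del: plus_S)

text \<open>Induction along the recursion for \<open>root\<close>, which rises by at most one per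
  step. When it rises from \<open>r\<close> at \<open>S m\<close>, the new upper bound
  \<open>tri (S (S r))\<close> exceeds \<open>tri (S r)\<close>, which is already at least
  \<open>S m\<close>.\<close>

lemma root_prop: "p \<in> D N \<Longrightarrow> tri (root p) \<preceq> p \<and> S p \<preceq> tri (S (root p))"
proof -
  assume p: "p \<in> D N"
  let ?A = "le (triT \<cdot> (rootT \<cdot> v 0)) (v 0) \<^bold>\<and> le (suc (v 0)) (triT \<cdot> suc (rootT \<cdot> v 0))"
  have "sat (base((0, N) := p)) ?A"
  proof (rule ind)
    fix m assume m: "m \<in> D N" "sat (base((0, N) := m)) ?A"
    let ?r = "root m"
    have IH: "tri ?r \<preceq> m" "S m \<preceq> tri (S ?r)" using m by simp_all
    have "tri (root (S m)) \<preceq> S m \<and> S (S m) \<preceq> tri (S (root (S m)))"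
    proof (cases "tri (S ?r) \<preceq> S m")
      case True
      have "tri (S (S ?r)) = S (tri (S ?r) \<oplus> S ?r)" using m tri_S[of "S ?r"] by simp
      moreover have "S m \<preceq> tri (S ?r) \<oplus> S ?r" using IH(2) lq_trans[of "S m" "tri (S ?r)"] m by (simp del: plus_S)
      ultimately show ?thesis using True m by (simp add: root_S del: plus_S)
    next
      case False
      then have "S (S m) \<preceq> tri (S ?r)" using m not_lq by simp
      moreover have "tri ?r \<preceq> S m" using IH(1) m lq_trans[of "tri ?r" m "S m"] by simp
      ultimately show ?thesis using False m by (simp add: root_S)
    qed
    then show "sat (base((0, N) := S m)) ?A" by simp
  qed (use p in \<open>simp_all add: tri_S\<close>)
  then show ?thesis using p by simp
qed

text \<open>The intervals between successive triangular numbers are disjoint, as \<open>tri\<close>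
  is monotone.\<close>

lemma root_unique:
  assumes "w \<in> D N" "p \<in> D N" "tri w \<preceq> p" "S p \<preceq> tri (S w)"
  shows "root p = w"
proof -
  have *: "a \<preceq> b" if ab: "a \<in> D N" "b \<in> D N" "tri a \<preceq> p" "S p \<preceq> tri (S b)" for a b
  proof (rule ccontr)
    assume "\<not> a \<preceq> b"
    then have "tri (S b) \<preceq> tri a" using not_lq tri_mono ab by simp
    then have "S p \<preceq> p" using ab assms lq_trans[of "S p" "tri (S b)" "tri a"] lq_trans[of "S p" "tri a" p] by simp
    then show False using assms by simp
  qed
  show ?thesis using *[of "root p" w] *[of w "root p"] root_prop[of p] assms by (simp add: lq_antisym)
qed

text \<open>\<open>tri (x \<oplus> y) \<oplus> y\<close> stays below the next triangular number
  because \<open>y\<close> is at most \<open>x \<oplus> y\<close>.\<close>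

lemma root_pair [simp]: assumes "x \<in> D N" "y \<in> D N" shows "root (pair x y) = x \<oplus> y"
proof (rule root_unique)
  have "tri (x \<oplus> y) \<oplus> y \<preceq> tri (x \<oplus> y) \<oplus> (x \<oplus> y)" using assms by (intro plus_mono) simp_all
  then show "S (pair x y) \<preceq> tri (S (x \<oplus> y))" using assms by (simp add: pair_eq tri_S)
qed (use assms in \<open>simp_all add: pair_eq\<close>)

lemma sec_pair [simp]: "x \<in> D N \<Longrightarrow> y \<in> D N \<Longrightarrow> sec (pair x y) = y"
  by (simp add: sec_eq) (simp add: pair_eq plus_minus)

lemma fir_pair [simp]: "x \<in> D N \<Longrightarrow> y \<in> D N \<Longrightarrow> fir (pair x y) = x"
  using minus_in_between[of x "x \<oplus> y" y] by (simp add: fir_eq)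

lemma pair_mono: "a \<preceq> b \<Longrightarrow> c \<preceq> d \<Longrightarrow> a \<in> D N \<Longrightarrow> b \<in> D N \<Longrightarrow> c \<in> D N \<Longrightarrow> d \<in> D N \<Longrightarrow>
  pair a c \<preceq> pair b d"
  by (simp add: pair_eq plus_mono tri_mono)

lemma lq_pair: "x \<in> D N \<Longrightarrow> y \<in> D N \<Longrightarrow> x \<preceq> pair x y"
  using lq_trans[of x "x \<oplus> y" "tri (x \<oplus> y)"] lq_trans[of x "tri (x \<oplus> y)" "tri (x \<oplus> y) \<oplus> y"] lq_tri
  by (simp add: pair_eq)

section \<open>Codes of finite sequences\<close>

lemma code_0 [simp]: "f \<in> D ty1 \<Longrightarrow> code f Z = Z"
  by (simp add: codeT_def evals)

lemma code_S [simp]: "f \<in> D ty1 \<Longrightarrow> n \<in> D N \<Longrightarrow> code f (S n) = S (pair (code f n) (f \<bullet> n))"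
  by (simp add: codeT_def evals)

lemma cut_0 [simp]: "s \<in> D N \<Longrightarrow> cutf s Z = s"
  by (simp add: cutT_def evals)

lemma cut_S: "s \<in> D N \<Longrightarrow> k \<in> D N \<Longrightarrow> cutf s (S k) = fir (pred (cutf s k))"
  by (simp add: cutT_def evals)

lemma ext_ap: "s \<in> D N \<Longrightarrow> i \<in> D N \<Longrightarrow>
  ex s \<bullet> i = (if S i \<preceq> lh s then sec (pred (cutf s (lh s \<ominus> S i))) else Z)"
  by (simp add: extT_def evals cond_iff)


lemma code_cong:
  assumes "f \<in> D ty1" "g \<in> D ty1" "n \<in> D N" "\<And>i. i \<in> D N \<Longrightarrow> S i \<preceq> n \<Longrightarrow> f \<bullet> i = g \<bullet> i"
  shows "code f n = code g n"
  using ind[of "le (v 0) (v 1) \<^bold>\<longrightarrow> Eq (codeT \<cdot> Var (0, ty1) \<cdot> v 0) (codeT \<cdot> Var (1, ty1) \<cdot> v 0)"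
    "base((0, ty1) := f, (1, ty1) := g, (1, N) := n)" n] assms S_lqD by simp

text \<open>The projections of a pair recover the last entry and the code of the others; the
  induction is on the length.\<close>

lemma code_inj:
  assumes "f \<in> D ty1" "g \<in> D ty1" "n \<in> D N" "i \<in> D N" "code f n = code g n" "S i \<preceq> n"
  shows "f \<bullet> i = g \<bullet> i"
proof -
  let ?A = "Eq (codeT \<cdot> Var (0, ty1) \<cdot> v 0) (codeT \<cdot> Var (1, ty1) \<cdot> v 0) \<^bold>\<longrightarrow> lt (v 1) (v 0)
    \<^bold>\<longrightarrow> Eq (Var (0, ty1) \<cdot> v 1) (Var (1, ty1) \<cdot> v 1)"
  let ?\<rho> = "base((0, ty1) := f, (1, ty1) := g, (1, N) := i)"
  have "sat (?\<rho>((0, N) := n)) ?A"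
  proof (rule ind)
    fix m assume m: "m \<in> D N" "sat (?\<rho>((0, N) := m)) ?A"
    then have IH: "code f m = code g m \<Longrightarrow> S i \<preceq> m \<Longrightarrow> f \<bullet> i = g \<bullet> i" by simp
    have "f \<bullet> i = g \<bullet> i" if "code f (S m) = code g (S m)" "S i \<preceq> S m"
    proof -
      have "pair (code f m) (f \<bullet> m) = pair (code g m) (g \<bullet> m)" using that(1) assms m by simp
      then have "code f m = code g m" "f \<bullet> m = g \<bullet> m"
        using assms m fir_pair sec_pair N_in code_ops_in(6) by metis+
      moreover have "S i \<preceq> m \<or> i = m" using that(2) m assms by (simp add: lq_S_iff del: S_lq_S)
      ultimately show ?thesis using IH by blast
    qed
    then show "sat (?\<rho>((0, N) := S m)) ?A" by simp
  qed (use assms in simp_all)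
  then show ?thesis using assms by simp
qed

lemma cut_code:
  assumes "f \<in> D ty1" "n \<in> D N" "k \<in> D N" "k \<preceq> n"
  shows "cutf (code f n) k = code f (n \<ominus> k)"
proof -
  let ?A = "le (v 0) (v 1) \<^bold>\<longrightarrow>
    Eq (cutT \<cdot> (codeT \<cdot> Var (0, ty1) \<cdot> v 1) \<cdot> v 0) (codeT \<cdot> Var (0, ty1) \<cdot> (subT \<cdot> v 1 \<cdot> v 0))"
  let ?\<rho> = "base((0, ty1) := f, (1, N) := n)"
  have "sat (?\<rho>((0, N) := k)) ?A"
  proof (rule ind)
    fix m assume m: "m \<in> D N" "sat (?\<rho>((0, N) := m)) ?A"
    have "cutf (code f n) (S m) = code f (n \<ominus> S m)" if le: "S m \<preceq> n"
    proof -
      \<comment> \<open>Writing the length as a sum shows that \<open>n \<ominus> m\<close> is a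
        successor, so the code of that length unfolds to a pair, whose first component remains after
        one more cut.\<close>
      obtain z where z: "z \<in> D N" "n = S m \<oplus> z" using lqE[OF le] m assms by auto
      have "n = m \<oplus> S z" using z m(1) by simp
      then have 1: "n \<ominus> S m = z" and 2: "n \<ominus> m = S z"
        using plus_minus[of "S m" z] plus_minus[of m "S z"] z m(1) by (metis S_in)+
      have "cutf (code f n) m = code f (n \<ominus> m)" using m(2) S_lqD[OF le m(1) assms(2)] by simp
      then show ?thesis using 1 2 m(1) assms(1,2) z(1) by (simp add: cut_S)
    qed
    then show "sat (?\<rho>((0, N) := S m)) ?A" by simp
  qed (use assms in simp_all)
  then show ?thesis using assms by simp
qed

text \<open>Cutting the empty code gives the empty code again, since the predecessor and the first
  projection of \<open>Z\<close> are both \<open>Z\<close>.\<close>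

lemma cut_code_ge:
  assumes "f \<in> D ty1" "n \<in> D N" "z \<in> D N"
  shows "cutf (code f n) (n \<oplus> z) = Z"
  using ind[of "Eq (cutT \<cdot> (codeT \<cdot> Var (0, ty1) \<cdot> v 1) \<cdot> (addT \<cdot> v 1 \<cdot> v 0)) zero"
      "base((0, ty1) := f, (1, N) := n)" z] assms by (simp add: cut_S cut_code)

text \<open>Each further entry increases the code. Hence the loop in \<open>lhT\<close>, which runs
  \<open>code f n\<close> times, makes at least \<open>n\<close> steps.\<close>

lemma lq_code: "f \<in> D ty1 \<Longrightarrow> n \<in> D N \<Longrightarrow> n \<preceq> code f n"
proof -
  assume a: "f \<in> D ty1" "n \<in> D N"
  have "n \<preceq> pair (code f n) (f \<bullet> n)" if "n \<in> D N" "n \<preceq> code f n" for n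
    using lq_trans[OF that(2) lq_pair] that a by simp
  then show ?thesis
    using ind[of "le (v 0) (codeT \<cdot> Var (0, ty1) \<cdot> v 0)" "base((0, ty1) := f)" n] a by simp
qed

text \<open>The counter \<open>L\<close> of the loop in \<open>lhT\<close> rises during the first
  \<open>n\<close> steps, while the cut sequence is nonempty, and is constant afterwards; the loop
  is long enough by \<open>lq_code\<close>.\<close>

lemma lh_code [simp]: assumes f: "f \<in> D ty1" and n: "n \<in> D N" shows "lh (code f n) = n"
proof -
  let ?s = "code f n"
  \<comment> \<open>The step function of the loop becomes an element of the model, so that the
    induction formulas can refer to it through a single variable.\<close>
  define F where "F = val (base((0, N) := ?s))
    (lamN 1 (lamN 2 (condT \<cdot> (cutT \<cdot> v 0 \<cdot> v 2) \<cdot> v 1 \<cdot> suc (v 1))))"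
  define L where "L m = cn Rec \<bullet> m \<bullet> Z \<bullet> F" for m
  have F: "F \<in> D (N \<rightarrow> N \<rightarrow> N)" unfolding F_def by (rule val_in) (use f n in simp_all)
  have FL: "F \<bullet> a \<bullet> k = (if cutf ?s k = Z then a else S a)" if "a \<in> D N" "k \<in> D N" for a k
    using that f n by (simp add: F_def evals cond_iff)
  have L0: "L Z = Z" using F by (simp add: L_def rec_Z)
  have LD: "L m \<in> D N" if "m \<in> D N" for m using F that by (simp add: L_def rec_in)
  have LS: "L (S m) = (if cutf ?s m = Z then L m else S (L m))" if "m \<in> D N" for m
    using F that FL LD by (simp add: L_def rec_S)
  have lh: "lh ?s = L ?s" using f n by (simp add: lhT_def evals L_def F_def)
  have L1: "m \<preceq> n \<longrightarrow> L m = m" if "m \<in> D N" for m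
  proof -
    let ?A = "le (v 0) (v 1) \<^bold>\<longrightarrow> Eq (Cn Rec \<cdot> v 0 \<cdot> zero \<cdot> Var (0, N \<rightarrow> N \<rightarrow> N)) (v 0)"
    let ?\<rho> = "base((1, N) := n, (0, N \<rightarrow> N \<rightarrow> N) := F)"
    have A: "sat (?\<rho>((0, N) := k)) ?A \<longleftrightarrow> (k \<preceq> n \<longrightarrow> L k = k)" for k by (simp add: L_def)
    have "sat (?\<rho>((0, N) := m)) ?A"
    proof (rule ind)
      fix k assume k: "k \<in> D N" "sat (?\<rho>((0, N) := k)) ?A"
      have "L (S k) = S k" if le: "S k \<preceq> n"
      proof -
        obtain z where z: "z \<in> D N" "n = S k \<oplus> z" using lqE[OF le] k n by auto
        have "n = k \<oplus> S z" using z k(1) by simp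
        then have "n \<ominus> k = S z" using plus_minus[of k "S z"] z(1) k(1) by (metis S_in)
        then have "cutf ?s k \<noteq> Z"
          using cut_code[OF f n k(1) S_lqD[OF le k(1) n]] f z(1) by simp
        then show ?thesis using LS[OF k(1)] S_lqD[OF le k(1) n] k(2) unfolding A by simp
      qed
      then show "sat (?\<rho>((0, N) := S k)) ?A" unfolding A by blast
    qed (use that F L0 n in \<open>simp_all add: L_def\<close>)
    then show ?thesis unfolding A .
  qed
  have L2: "L (n \<oplus> z) = n" if "z \<in> D N" for z
  proof -
    let ?A = "Eq (Cn Rec \<cdot> (addT \<cdot> v 1 \<cdot> v 0) \<cdot> zero \<cdot> Var (0, N \<rightarrow> N \<rightarrow> N)) (v 1)"
    let ?\<rho> = "base((1, N) := n, (0, N \<rightarrow> N \<rightarrow> N) := F)"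
    have A: "sat (?\<rho>((0, N) := k)) ?A \<longleftrightarrow> L (n \<oplus> k) = n" for k by (simp add: L_def)
    have "sat (?\<rho>((0, N) := z)) ?A"
    proof (rule ind)
      fix k assume k: "k \<in> D N" "sat (?\<rho>((0, N) := k)) ?A"
      then have "L (n \<oplus> S k) = n" using LS[of "n \<oplus> k"] cut_code_ge[OF f n k(1)] n unfolding A by simp
      then show "sat (?\<rho>((0, N) := S k)) ?A" unfolding A .
    next
      show "sat (?\<rho>((0, N) := Z)) ?A" unfolding A using L1[OF n] n by simp
    qed (use that F n in simp_all)
    then show ?thesis unfolding A .
  qed
  obtain z where "z \<in> D N" "?s = n \<oplus> z" using lqE[OF lq_code[OF f n]] f n by auto
  then show ?thesis using L2 lh by simp
qed

text \<open>Cutting \<open>n \<ominus> S i\<close> entries leaves the code of length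
  \<open>S i\<close>, whose last entry is \<open>f \<bullet> i\<close>.\<close>

lemma ext_code: assumes "f \<in> D ty1" "n \<in> D N" "i \<in> D N"
  shows "ex (code f n) \<bullet> i = (if S i \<preceq> n then f \<bullet> i else Z)"
proof (cases "S i \<preceq> n")
  case True
  obtain z where z: "z \<in> D N" "n = S i \<oplus> z" using lqE[OF True] assms by auto
  have m: "n \<ominus> S i = z" "n \<ominus> z = S i"
    using minus_in_between[OF _ assms(2) z(1,2)] assms(3) by (metis S_in)+
  have "z \<preceq> n" using lq_plus(2)[of "S i" z] z assms(3) by (metis S_in)
  then show ?thesis using True assms z(1) by (simp add: ext_ap cut_code m)
qed (use assms in \<open>simp add: ext_ap\<close>)


section \<open>Cantor space\<close>

definition "C f \<longleftrightarrow> f \<in> D ty1 \<and> (\<forall>i\<in>D N. f \<bullet> i \<preceq> S Z)"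

lemma C_in: "C f \<Longrightarrow> f \<in> D ty1"
  by (simp add: C_def)

lemma lq_one: "x \<in> D N \<Longrightarrow> x \<preceq> S Z \<longleftrightarrow> x = Z \<or> x = S Z"
proof -
  have "x \<preceq> Z \<longleftrightarrow> x = Z" if "x \<in> D N" using lq_antisym[of x Z] that by auto
  then show "x \<in> D N \<Longrightarrow> ?thesis" by (simp add: lq_S_iff)
qed

section \<open>Retraction onto Cantor space and bounded maximisation\<close>

text \<open>\<open>trimT\<close> is a retraction onto Cantor space that keeps zero entries;
  \<open>trimcT\<close> does the same to a code without changing its length; \<open>argmaxT\<close>
  finds a place where a function attains its maximum on \<open>0, ..., n\<close>.\<close>

definition trimT :: trm where
  "trimT = lam (0, ty1) (lamN 1 (condT \<cdot> (Var (0, ty1) \<cdot> v 1) \<cdot> zero \<cdot> suc zero))"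
definition trimcT :: trm where "trimcT = lamN 0 (codeT \<cdot> (trimT \<cdot> (extT \<cdot> v 0)) \<cdot> (lhT \<cdot> v 0))"
definition oneT :: trm where "oneT = lamN 0 (suc zero)"
definition argmaxT :: trm where
  "argmaxT = lam (0, ty1) (lamN 1 (recN (v 1) zero 2 3
     (condT \<cdot> (subT \<cdot> (Var (0, ty1) \<cdot> suc (v 3)) \<cdot> (Var (0, ty1) \<cdot> v 2)) \<cdot> v 2 \<cdot> suc (v 3))))"

lemma trimT_wf [simp]: "wft trimT" "tyof trimT = ty1 \<rightarrow> ty1" "fvt trimT = {}"
  by (simp_all add: trimT_def insert_Diff_if)

lemma trimcT_wf [simp]: "wft trimcT" "tyof trimcT = ty1" "fvt trimcT = {}"
  by (simp_all add: trimcT_def insert_Diff_if)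

lemma oneT_wf [simp]: "wft oneT" "tyof oneT = ty1" "fvt oneT = {}"
  by (simp_all add: oneT_def insert_Diff_if)

lemma argmaxT_wf [simp]: "wft argmaxT" "tyof argmaxT = ty1 \<rightarrow> ty1" "fvt argmaxT = {}"
  by (simp_all add: argmaxT_def insert_Diff_if)

abbreviation "trim f \<equiv> cl trimT \<bullet> f"
abbreviation "trimc s \<equiv> cl trimcT \<bullet> s"
abbreviation "argmax g n \<equiv> cl argmaxT \<bullet> g \<bullet> n"

lemma val_cantor_ops [simp]:
  "val \<rho> trimT = cl trimT" "val \<rho> trimcT = cl trimcT" "val \<rho> oneT = cl oneT" "val \<rho> argmaxT = cl argmaxT"
  by (simp_all add: val_cl)

lemma cantor_ops_in [simp]:
  "f \<in> D ty1 \<Longrightarrow> trim f \<in> D ty1" "x \<in> D N \<Longrightarrow> trimc x \<in> D N" "cl oneT \<in> D ty1"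
  "f \<in> D ty1 \<Longrightarrow> x \<in> D N \<Longrightarrow> argmax f x \<in> D N"
  using cl_in[of trimT "ty1 \<rightarrow> ty1"] cl_in[of trimcT ty1] cl_in[of oneT ty1] cl_in[of argmaxT "ty1 \<rightarrow> ty1"]
  by (auto intro: ap_closed)

lemma trim_ap [simp]: "f \<in> D ty1 \<Longrightarrow> i \<in> D N \<Longrightarrow> trim f \<bullet> i = (if f \<bullet> i = Z then Z else S Z)"
  by (simp add: trimT_def evals cond_iff)

lemma C_trim [simp]: "f \<in> D ty1 \<Longrightarrow> C (trim f)"
  by (simp add: C_def)

lemma trim_C: "C f \<Longrightarrow> trim f = f"
  by (rule fn_ext[of _ N N]) (auto simp: C_def lq_one)

text \<open>Beyond the length both sides vanish, as trimming keeps zeros.\<close>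

lemma ext_trimc [simp]: "s \<in> D N \<Longrightarrow> ex (trimc s) = trim (ex s)"
proof (rule fn_ext[of _ N N])
  fix i assume "s \<in> D N" "i \<in> D N"
  moreover from this have "trimc s = code (trim (ex s)) (lh s)" by (simp add: trimcT_def evals)
  ultimately show "ex (trimc s) \<bullet> i = trim (ex s) \<bullet> i" by (simp add: ext_code) (simp add: ext_ap)
qed simp_all

lemma one_ap [simp]: "i \<in> D N \<Longrightarrow> cl oneT \<bullet> i = S Z"
  by (simp add: oneT_def evals)

text \<open>Pairing is monotone in both entries, so \<open>1, ..., 1\<close> has the largest code
  among the binary sequences of its length. This confines the search for a maximum to a bounded
  range of codes.\<close>

lemma code_le_one: assumes "C f" "n \<in> D N" shows "code f n \<preceq> code (cl oneT) n"
proof -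
  have f: "f \<in> D ty1" using assms by (simp add: C_def)
  have "pair (code f m) (f \<bullet> m) \<preceq> pair (code (cl oneT) m) (S Z)"
    if "m \<in> D N" "code f m \<preceq> code (cl oneT) m" for m
    by (rule pair_mono) (use that assms f in \<open>auto simp: C_def\<close>)
  then show ?thesis
    using ind[of "le (codeT \<cdot> Var (0, ty1) \<cdot> v 0) (codeT \<cdot> oneT \<cdot> v 0)" "base((0, ty1) := f)" n] assms f
    by simp
qed

lemma argmax_0 [simp]: "g \<in> D ty1 \<Longrightarrow> argmax g Z = Z"
  by (simp add: argmaxT_def evals)

lemma argmax_S: "g \<in> D ty1 \<Longrightarrow> n \<in> D N \<Longrightarrow>
  argmax g (S n) = (if g \<bullet> S n \<preceq> g \<bullet> argmax g n then argmax g n else S n)"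
  by (simp add: argmaxT_def evals cond_iff)

lemma argmax_max: assumes "g \<in> D ty1" "n \<in> D N" "i \<in> D N" "i \<preceq> n" shows "g \<bullet> i \<preceq> g \<bullet> argmax g n"
proof -
  let ?A = "le (v 1) (v 0) \<^bold>\<longrightarrow> le (Var (0, ty1) \<cdot> v 1) (Var (0, ty1) \<cdot> (argmaxT \<cdot> Var (0, ty1) \<cdot> v 0))"
  let ?\<rho> = "base((0, ty1) := g, (1, N) := i)"
  have "sat (?\<rho>((0, N) := n)) ?A"
  proof (rule ind)
    show "sat (?\<rho>((0, N) := Z)) ?A" using lq_antisym[of i Z] assms by auto
    fix m assume m: "m \<in> D N" "sat (?\<rho>((0, N) := m)) ?A"
    have IH: "i \<preceq> m \<Longrightarrow> g \<bullet> i \<preceq> g \<bullet> argmax g m" using m by simp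
    have "g \<bullet> i \<preceq> g \<bullet> argmax g (S m)" if le: "i \<preceq> S m"
    proof (cases "i \<preceq> m")
      case True
      moreover have "g \<bullet> argmax g m \<preceq> g \<bullet> argmax g (S m)"
        using lq_total[of "g \<bullet> S m" "g \<bullet> argmax g m"] assms m by (auto simp: argmax_S)
      ultimately show ?thesis using IH lq_trans assms m by (meson N_in(1) S_in cantor_ops_in(4))
    next
      case False
      then have "i = S m" using le assms m by (simp add: lq_S_iff)
      then show ?thesis using assms m by (simp add: argmax_S)
    qed
    then show "sat (?\<rho>((0, N) := S m)) ?A" by simp
  qed (use assms in simp_all)
  then show ?thesis using assms by simp
qed

lemma sat_cantor: "sat \<rho> (cantor t) \<longleftrightarrow> (\<forall>i\<in>D N. val \<rho> t \<bullet> i \<preceq> S Z)"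
proof -
  have "(fresh t, N) \<notin> fvt t" using fvt_fresh[of _ t] by fastforce
  then show ?thesis by (simp add: cantor_def Let_def)
qed

text \<open>\<open>binary\<close> inspects only the entries below the length; all others of the
  extension are zero.\<close>

lemma sat_binary:
  assumes "val \<rho> s \<in> D N"
  shows "sat \<rho> (binary s) \<longleftrightarrow> C (ex (val \<rho> s))"
proof -
  have "(fresh s, N) \<notin> fvt s" using fvt_fresh[of _ s] by fastforce
  then have "sat \<rho> (binary s) \<longleftrightarrow> (\<forall>i\<in>D N. S i \<preceq> lh (val \<rho> s) \<longrightarrow> ex (val \<rho> s) \<bullet> i \<preceq> S Z)"
    by (simp add: binary_def Let_def)
  also have "\<dots> \<longleftrightarrow> C (ex (val \<rho> s))"
    using assms by (auto simp: C_def ext_ap)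
  finally show ?thesis .
qed

end

section \<open>The principles in models\<close>

text \<open>Separated from its quantifier because it also names the constant
  \<open>Def vG SUP_matrix\<close>, through which transfer will be applied.\<close>

definition SUP_matrix :: fm where
  "SUP_matrix = Forall vphi
     (AllC vf (le (Var vphi \<cdot> Var vf) (Var vG \<cdot> Var vphi))
      \<^bold>\<and> ExC vg (Eq (Var vG \<cdot> Var vphi) (Var vphi \<cdot> Var vg)))"

lemma SUP_fm_matrix: "SUP_fm = Exists vG SUP_matrix"
  by (simp add: SUP_fm_def SUP_matrix_def)

lemma wff_cantor [simp]: "wft t \<Longrightarrow> tyof t = ty1 \<Longrightarrow> wff (cantor t)"
  by (simp add: cantor_def Let_def)

lemma internal_cantor [simp]: "internal (cantor t)"
  by (simp add: cantor_def Let_def)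

lemma fv_cantor [simp]: "fv (cantor t) = fvt t"
proof -
  have "(fresh t, N) \<notin> fvt t" using fvt_fresh[of _ t] by fastforce
  then show ?thesis by (auto simp: cantor_def Let_def)
qed

lemma wff_binary [simp]: "wft t \<Longrightarrow> tyof t = N \<Longrightarrow> wff (binary t)"
proof -
  have "(fresh t, N) \<notin> fvt t" using fvt_fresh[of _ t] by fastforce
  then show "wft t \<Longrightarrow> tyof t = N \<Longrightarrow> wff (binary t)" by (simp add: binary_def Let_def)
qed

lemma internal_binary [simp]: "internal (binary t)"
  by (simp add: binary_def Let_def)

lemma rel_st_binary [simp]: "rel_st (binary t) = binary t"
  by (simp add: binary_def Let_def)

lemma wff_rel_st: "wff A \<Longrightarrow> wff (rel_st A)"
  by (induction A) auto

lemma wff_matrix [simp]: "wff SUP_matrix" "internal SUP_matrix" "fv SUP_matrix = {vG}"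
  by (auto simp: SUP_matrix_def)

lemma wff_principles [simp]:
  "wff MUC_fm" "wff SUP_fm" "wff N_fm" "wff SUP_dagger_fm" "wff N_dagger_fm"
  by (simp_all add: MUC_fm_def SUP_fm_def N_fm_def SUP_dagger_fm_def N_dagger_fm_def)

context epra_model begin

lemma D2_in [simp]: "\<phi> \<in> D ty2 \<Longrightarrow> f \<in> D ty1 \<Longrightarrow> \<phi> \<bullet> f \<in> D N"
  by (rule ap_closed)

lemma D3_in [simp]: "G \<in> D ty3 \<Longrightarrow> \<phi> \<in> D ty2 \<Longrightarrow> G \<bullet> \<phi> \<in> D N"
  by (rule ap_closed)

lemma sat_cantor_C: "val \<rho> t \<in> D ty1 \<Longrightarrow> sat \<rho> (cantor t) \<longleftrightarrow> C (val \<rho> t)"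
  by (simp add: sat_cantor C_def)

lemma C_quant:
  "(\<forall>f\<in>D ty1. (\<forall>i\<in>D N. f \<bullet> i \<preceq> S Z) \<longrightarrow> P f) \<longleftrightarrow> (\<forall>f. C f \<longrightarrow> P f)"
  "(\<exists>f\<in>D ty1. (\<forall>i\<in>D N. f \<bullet> i \<preceq> S Z) \<and> P f) \<longleftrightarrow> (\<exists>f. C f \<and> P f)"
  unfolding C_def by blast+

definition modulus :: "'a \<Rightarrow> bool" where
  "modulus \<Omega> \<longleftrightarrow> \<Omega> \<in> D ty3 \<and> (\<forall>\<phi>\<in>D ty2. \<forall>f g. C f \<longrightarrow> C g \<longrightarrow>
     code f (\<Omega> \<bullet> \<phi>) = code g (\<Omega> \<bullet> \<phi>) \<longrightarrow> \<phi> \<bullet> f = \<phi> \<bullet> g)"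

lemma sat_MUC: "sat \<rho> MUC_fm \<longleftrightarrow> (\<exists>\<Omega>. modulus \<Omega>)"
  unfolding modulus_def by (simp add: MUC_fm_def sat_cantor C_quant Bex_def) blast

definition upper :: "'a \<Rightarrow> 'a \<Rightarrow> bool" where
  "upper \<phi> k \<longleftrightarrow> (\<forall>f. C f \<longrightarrow> \<phi> \<bullet> f \<preceq> k)"

definition sup_fun :: "'a \<Rightarrow> bool" where
  "sup_fun G \<longleftrightarrow> G \<in> D ty3 \<and> (\<forall>\<phi>\<in>D ty2. upper \<phi> (G \<bullet> \<phi>) \<and> (\<exists>g. C g \<and> G \<bullet> \<phi> = \<phi> \<bullet> g))"

lemma sat_SUP_matrix: "\<rho> vG \<in> D ty3 \<Longrightarrow> sat \<rho> SUP_matrix \<longleftrightarrow> sup_fun (\<rho> vG)"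
  unfolding sup_fun_def upper_def by (simp add: SUP_matrix_def sat_cantor C_quant)

lemma sat_SUP: "sat \<rho> SUP_fm \<longleftrightarrow> (\<exists>G. sup_fun G)"
  unfolding SUP_fm_matrix using sat_SUP_matrix by (auto simp: sup_fun_def)

lemma sat_SUP_dagger: "sat \<rho> SUP_dagger_fm \<longleftrightarrow> (\<exists>G\<in>D ty3. \<forall>\<phi>\<in>D ty2. upper \<phi> (G \<bullet> \<phi>) \<and>
    (\<exists>\<sigma>\<in>D N. C (ex \<sigma>) \<and> G \<bullet> \<phi> = \<phi> \<bullet> ex \<sigma>))"
  unfolding upper_def by (simp add: SUP_dagger_fm_def sat_cantor C_quant sat_binary cong: bex_cong)

text \<open>Each functional attains its value, which is therefore bounded by the value of the other.
  Uniqueness is the condition under which the constant of \<open>SUP_matrix\<close> has its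
  axiom.\<close>

lemma sup_fun_unique:
  assumes "sup_fun G" "sup_fun H" shows "G = H"
proof (rule fn_ext[of _ ty2 N])
  fix \<phi> assume \<phi>: "\<phi> \<in> D ty2"
  obtain g where g: "C g" "G \<bullet> \<phi> = \<phi> \<bullet> g" using assms(1) \<phi> by (auto simp: sup_fun_def)
  obtain h where h: "C h" "H \<bullet> \<phi> = \<phi> \<bullet> h" using assms(2) \<phi> by (auto simp: sup_fun_def)
  have "\<phi> \<bullet> g \<preceq> H \<bullet> \<phi>" "\<phi> \<bullet> h \<preceq> G \<bullet> \<phi>"
    using assms \<phi> g(1) h(1) unfolding sup_fun_def upper_def by blast+
  then show "G \<bullet> \<phi> = H \<bullet> \<phi>" using \<phi> g h lq_antisym[of "\<phi> \<bullet> g" "\<phi> \<bullet> h"] C_in by simp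
qed (use assms in \<open>simp_all add: sup_fun_def\<close>)

end

lemma SUP_matrix_free_for: "free_for (Var (1, ty3)) vG SUP_matrix"
  by (simp add: SUP_matrix_def cantor_def)

text \<open>The axiom for the constant asks for a derivation in \<open>RCA0\<omega>\<close>. It
  comes from completeness for this smaller theory, which is applicable since the formula is
  internal.\<close>

lemma SUP_matrix_unique:
  "RCA0\<omega> \<turnstile> Forall vG (Forall (1, ty3)
     (SUP_matrix \<^bold>\<and> sbf vG (Var (1, ty3)) SUP_matrix \<^bold>\<longrightarrow> eq ty3 (Var vG) (Var (1, ty3))))"
proof (rule completeness)
  note ff = SUP_matrix_free_for
  have w: "wff (sbf vG (Var (1, ty3)) SUP_matrix)"
    by (rule wff_sbf) (use ff in simp_all)
  then show "wff (Forall vG (Forall (1, ty3)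
     (SUP_matrix \<^bold>\<and> sbf vG (Var (1, ty3)) SUP_matrix \<^bold>\<longrightarrow> eq ty3 (Var vG) (Var (1, ty3)))))"
    by (simp add: wff_eq del: eq.simps)
  have i: "internal (sbf x s A) = internal A" for x s A
    by (induction A) auto
  show "internal (Forall vG (Forall (1, ty3)
     (SUP_matrix \<^bold>\<and> sbf vG (Var (1, ty3)) SUP_matrix \<^bold>\<longrightarrow> eq ty3 (Var vG) (Var (1, ty3))))) \<or> StAx \<subseteq> RCA0\<omega>"
    by (simp add: i del: eq.simps)
  show "EPRA \<subseteq> RCA0\<omega>" by (simp add: RCA0\<omega>_def)
  fix D :: "ty \<Rightarrow> trm set set" and ap cn sd \<rho>
  assume "model RCA0\<omega> D ap cn sd" and \<rho>: "interp.typed D \<rho>"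
  then interpret epra_model RCA0\<omega> D ap cn sd
    by (simp add: epra_model_def epra_model_axioms_def RCA0\<omega>_def)
  show "sat \<rho> (Forall vG (Forall (1, ty3)
     (SUP_matrix \<^bold>\<and> sbf vG (Var (1, ty3)) SUP_matrix \<^bold>\<longrightarrow> eq ty3 (Var vG) (Var (1, ty3)))))"
    using \<rho> sup_fun_unique by (simp add: sat_sbf[OF ff[unfolded One_nat_def]] sat_eq_iff sat_SUP_matrix del: eq.simps)
qed

section \<open>Standard elements, transfer and choice in models\<close>

locale rca_model = epra_model +
  assumes RCA: "RCA0\<Omega> \<subseteq> T"
begin

lemma StAx: "StAx \<subseteq> T"
  using RCA by (auto simp: RCA0\<Omega>_def)

lemma axT: "A \<in> T \<Longrightarrow> wff A \<Longrightarrow> typed \<rho> \<Longrightarrow> sat \<rho> A"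
  by (rule sound[OF ax]) (use StAx in auto)

lemma sd_closed: "wft t \<Longrightarrow> fvt t = {} \<Longrightarrow> sd (val \<rho> t)"
proof -
  assume t: "wft t" "fvt t = {}"
  have "sat base (St t)" by (rule axT) (use t StAx StAx.st_closed in auto)
  then show ?thesis using val_cl[OF t(2)] by simp
qed

lemma sd_cl [simp]: "wft t \<Longrightarrow> fvt t = {} \<Longrightarrow> sd (cl t)"
  unfolding cl_def by (rule sd_closed)

lemma sd_ap: assumes "f \<in> D (\<sigma> \<rightarrow> \<tau>)" "a \<in> D \<sigma>" "sd f" "sd a" shows "sd (f \<bullet> a)"
proof -
  have "sat (base((0, \<sigma> \<rightarrow> \<tau>) := f, (1, \<sigma>) := a))
    (St (Var (0, \<sigma> \<rightarrow> \<tau>)) \<^bold>\<and> St (Var (1, \<sigma>)) \<^bold>\<longrightarrow> St (Var (0, \<sigma> \<rightarrow> \<tau>) \<cdot> Var (1, \<sigma>)))"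
    by (rule axT) (use assms StAx StAx.st_app in auto)
  then show ?thesis using assms by simp
qed

text \<open>The means of recognising a constructed object as standard: it is the value of a term
  with standard parameters.\<close>

lemma sd_val: "typed \<rho> \<Longrightarrow> wft t \<Longrightarrow> (\<And>x. x \<in> fvt t \<Longrightarrow> sd (\<rho> x)) \<Longrightarrow> sd (val \<rho> t)"
proof (induction t)
  case (Cn c)
  then show ?case using sd_closed[of "Cn c" \<rho>] by simp
next
  case (App s t)
  have st: "val \<rho> s \<in> D (tyof t \<rightarrow> tyof (s \<cdot> t))" "val \<rho> t \<in> D (tyof t)"
    by (rule val_in; use App.prems in simp)+
  show ?case using sd_ap[OF st] App by simp
qed simp

lemma sd_lq: assumes "x \<preceq> y" "x \<in> D N" "y \<in> D N" "sd y" shows "sd x"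
proof -
  have "sat (base((0, N) := x, (1, N) := y)) (St (v 1) \<^bold>\<and> le (v 0) (v 1) \<^bold>\<longrightarrow> St (v 0))"
    by (rule axT) (use assms StAx StAx.st_le in auto)
  then show ?thesis using assms by simp
qed

text \<open>The formula may speak about \<open>x\<close> and closed terms only. Further objects have
  to be coded into \<open>x\<close>, and a functional has to be named by a constant.\<close>

lemma transfer:
  assumes A: "wff A" "internal A" "fv A \<subseteq> {x}"
    and st: "\<And>a. a \<in> D (snd x) \<Longrightarrow> sd a \<Longrightarrow> sat (base(x := a)) A" and a: "a \<in> D (snd x)"
  shows "sat (base(x := a)) A"
proof -
  have "(AllSt x A \<^bold>\<longrightarrow> Forall x A) \<in> PFTP" by (rule PFTP.intros) (use A in auto)
  then have "sat base (AllSt x A \<^bold>\<longrightarrow> Forall x A)"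
    by (intro axT) (use A RCA in \<open>auto simp: RCA0\<Omega>_def\<close>)
  then show ?thesis using st a by simp
qed

lemma transfer_ex:
  assumes A: "wff A" "internal A" "fv A \<subseteq> {x}" and a: "a \<in> D (snd x)" "sat (base(x := a)) A"
  shows "\<exists>a\<in>D (snd x). sd a \<and> sat (base(x := a)) A"
  using transfer[of "\<^bold>\<not> A" x a] A a by auto

lemma sat_mem:
  assumes "typed \<rho>" "wft z" "wft s" "tyof z = \<sigma>" "tyof s = Sq \<sigma>"
  shows "sat \<rho> (mem \<sigma> z s) \<longleftrightarrow>
    (\<exists>i\<in>D N. S i \<preceq> cn (Len \<sigma>) \<bullet> val \<rho> s \<and> val \<rho> z = cn (At \<sigma>) \<bullet> val \<rho> s \<bullet> i)"
proof -
  have "(fresh (z \<cdot> s), N) \<notin> fvt s" "(fresh (z \<cdot> s), N) \<notin> fvt z"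
    using fvt_fresh[of _ s] fvt_fresh[of _ z] by fastforce+
  then show ?thesis using assms by (auto simp: mem_def Let_def sat_eq_iff)
qed

lemma wff_mem: "wft z \<Longrightarrow> wft s \<Longrightarrow> tyof z = \<sigma> \<Longrightarrow> tyof s = Sq \<sigma> \<Longrightarrow> wff (mem \<sigma> z s)"
proof -
  have "(fresh (z \<cdot> s), N) \<notin> fvt s" using fvt_fresh[of _ s] by fastforce
  then show "wft z \<Longrightarrow> wft s \<Longrightarrow> tyof z = \<sigma> \<Longrightarrow> tyof s = Sq \<sigma> \<Longrightarrow> wff (mem \<sigma> z s)"
    by (auto simp: mem_def Let_def wff_eq)
qed

text \<open>\<open>F\<close> gives only a finite sequence of candidates for each standard
  \<open>a\<close>, some unspecified entry of which is suitable. The users of the lemma select an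
  entry by maximisation.\<close>

lemma choice:
  assumes A: "wff A" "internal A" "(0, \<sigma> \<rightarrow> Sq \<tau>) \<notin> fv A" and xy: "(i, \<sigma>) \<noteq> (j, \<tau>)"
    and ex: "\<And>a. a \<in> D \<sigma> \<Longrightarrow> sd a \<Longrightarrow> \<exists>b\<in>D \<tau>. sd b \<and> sat (base((i, \<sigma>) := a, (j, \<tau>) := b)) A"
  shows "\<exists>F\<in>D (\<sigma> \<rightarrow> Sq \<tau>). sd F \<and> (\<forall>a\<in>D \<sigma>. sd a \<longrightarrow> (\<exists>i'\<in>D N. S i' \<preceq> cn (Len \<tau>) \<bullet> (F \<bullet> a) \<and>
    sat (base((i, \<sigma>) := a, (j, \<tau>) := cn (At \<tau>) \<bullet> (F \<bullet> a) \<bullet> i')) A))"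
proof -
  let ?x = "(i, \<sigma>)" and ?y = "(j, \<tau>)" and ?F = "(0, \<sigma> \<rightarrow> Sq \<tau>)"
  let ?M = "mem \<tau> (Var ?y) (Var ?F \<cdot> Var ?x)"
  have "(AllSt ?x (ExSt ?y A) \<^bold>\<longrightarrow> ExSt ?F (AllSt ?x (Exists ?y (?M \<^bold>\<and> A)))) \<in> HACint"
    using HACint.intros[of A ?x ?y ?F] A xy by simp
  then have "sat base (AllSt ?x (ExSt ?y A) \<^bold>\<longrightarrow> ExSt ?F (AllSt ?x (Exists ?y (?M \<^bold>\<and> A))))"
    by (intro axT) (use A RCA wff_mem in \<open>auto simp: RCA0\<Omega>_def\<close>)
  then have "sat base (ExSt ?F (AllSt ?x (Exists ?y (?M \<^bold>\<and> A))))"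
    using ex by simp
  then obtain F where F: "F \<in> D (\<sigma> \<rightarrow> Sq \<tau>)" "sd F"
    "sat (base(?F := F)) (AllSt ?x (Exists ?y (?M \<^bold>\<and> A)))" by auto
  have "\<exists>i'\<in>D N. S i' \<preceq> cn (Len \<tau>) \<bullet> (F \<bullet> a) \<and>
    sat (base(?x := a, ?y := cn (At \<tau>) \<bullet> (F \<bullet> a) \<bullet> i')) A" if a: "a \<in> D \<sigma>" "sd a" for a
  proof -
    let ?\<rho> = "\<lambda>b. base(?F := F, ?x := a, ?y := b)"
    obtain b where b: "b \<in> D \<tau>" "sat (?\<rho> b) ?M" "sat (?\<rho> b) A"
      using F(3) a by auto
    have lk: "?\<rho> b ?F = F" "?\<rho> b ?x = a" "?\<rho> b ?y = b" using xy by auto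
    have "typed (?\<rho> b)" using F a b by simp
    then obtain i' where i': "i' \<in> D N" "S i' \<preceq> cn (Len \<tau>) \<bullet> (F \<bullet> a)" "b = cn (At \<tau>) \<bullet> (F \<bullet> a) \<bullet> i'"
      using b(2) by (subst (asm) sat_mem) (auto simp: lk simp del: fun_upd_apply)
    have "sat (?\<rho> b) A = sat (base(?x := a, ?y := b)) A"
      by (rule sat_cong) (use A in auto)
    then show ?thesis using i' b by blast
  qed
  then show ?thesis using F by blast
qed

end

section \<open>Coding a functional and two functions as one functional\<close>

text \<open>\<open>consT\<close> puts a number in front of a function; its recursion ignores the
  previous value and merely distinguishes zero from successors.\<close>

definition consT :: trm where
  "consT = lamN 0 (lam (0, ty1) (lamN 1 (recN (v 1) (v 0) 2 3 (Var (0, ty1) \<cdot> v 3))))"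
definition shiftT :: trm where "shiftT = lam (0, ty1) (lamN 0 (Var (0, ty1) \<cdot> suc (v 0)))"
definition constT :: trm where "constT = lamN 0 (lamN 1 (v 0))"

text \<open>\<open>encT\<close> codes objects of types \<open>2\<close>, \<open>1\<close>, \<open>1\<close> as one object of type \<open>2\<close>, which selects a
  component by the first entry of its argument; this makes parameter-free transfer and
  \<open>QF-AC\<^bsup>2,0\<^esup>\<close> applicable to several variables.\<close>

definition encT :: trm where
  "encT = lam (0, ty2) (lam (0, ty1) (lam (1, ty1) (lam (2, ty1)
    (condT \<cdot> (Var (2, ty1) \<cdot> zero) \<cdot> (Var (0, ty2) \<cdot> (shiftT \<cdot> Var (2, ty1)))
      \<cdot> (condT \<cdot> (predT \<cdot> (Var (2, ty1) \<cdot> zero)) \<cdot> (Var (0, ty1) \<cdot> (Var (2, ty1) \<cdot> suc zero))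
          \<cdot> (Var (1, ty1) \<cdot> (Var (2, ty1) \<cdot> suc zero)))))))"
definition dec0T :: trm where
  "dec0T = lam (0, ty2) (lam (0, ty1) (Var (0, ty2) \<cdot> (consT \<cdot> zero \<cdot> Var (0, ty1))))"
definition dec1T :: trm where
  "dec1T = lam (0, ty2) (lamN 0 (Var (0, ty2) \<cdot> (consT \<cdot> suc zero \<cdot> (constT \<cdot> v 0))))"
definition dec2T :: trm where
  "dec2T = lam (0, ty2) (lamN 0 (Var (0, ty2) \<cdot> (consT \<cdot> suc (suc zero) \<cdot> (constT \<cdot> v 0))))"

lemma consT_wf [simp]: "wft consT" "tyof consT = N \<rightarrow> ty1 \<rightarrow> ty1" "fvt consT = {}"
  by (simp_all add: consT_def insert_Diff_if)

lemma shiftT_wf [simp]: "wft shiftT" "tyof shiftT = ty1 \<rightarrow> ty1" "fvt shiftT = {}"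
  by (simp_all add: shiftT_def insert_Diff_if)

lemma constT_wf [simp]: "wft constT" "tyof constT = N \<rightarrow> ty1" "fvt constT = {}"
  by (simp_all add: constT_def insert_Diff_if)

lemma encT_wf [simp]: "wft encT" "tyof encT = ty2 \<rightarrow> ty1 \<rightarrow> ty1 \<rightarrow> ty2" "fvt encT = {}"
  by (simp_all add: encT_def insert_Diff_if)

lemma dec0T_wf [simp]: "wft dec0T" "tyof dec0T = ty2 \<rightarrow> ty2" "fvt dec0T = {}"
  by (simp_all add: dec0T_def insert_Diff_if)

lemma dec1T_wf [simp]: "wft dec1T" "tyof dec1T = ty2 \<rightarrow> ty1" "fvt dec1T = {}"
  by (simp_all add: dec1T_def insert_Diff_if)

lemma dec2T_wf [simp]: "wft dec2T" "tyof dec2T = ty2 \<rightarrow> ty1" "fvt dec2T = {}"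
  by (simp_all add: dec2T_def insert_Diff_if)

context epra_model begin

abbreviation "enc \<phi> f g \<equiv> cl encT \<bullet> \<phi> \<bullet> f \<bullet> g"
abbreviation "dec0 x \<equiv> cl dec0T \<bullet> x"
abbreviation "dec1 x \<equiv> cl dec1T \<bullet> x"
abbreviation "dec2 x \<equiv> cl dec2T \<bullet> x"

lemma val_coding [simp]:
  "val \<rho> consT = cl consT" "val \<rho> shiftT = cl shiftT" "val \<rho> constT = cl constT" "val \<rho> encT = cl encT"
  "val \<rho> dec0T = cl dec0T" "val \<rho> dec1T = cl dec1T" "val \<rho> dec2T = cl dec2T"
  by (simp_all add: val_cl)

lemma coding_in [simp]:
  "a \<in> D N \<Longrightarrow> f \<in> D ty1 \<Longrightarrow> cl consT \<bullet> a \<bullet> f \<in> D ty1" "f \<in> D ty1 \<Longrightarrow> cl shiftT \<bullet> f \<in> D ty1"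
  "a \<in> D N \<Longrightarrow> cl constT \<bullet> a \<in> D ty1"
  "\<phi> \<in> D ty2 \<Longrightarrow> f \<in> D ty1 \<Longrightarrow> g \<in> D ty1 \<Longrightarrow> enc \<phi> f g \<in> D ty2"
  "\<phi> \<in> D ty2 \<Longrightarrow> dec0 \<phi> \<in> D ty2" "\<phi> \<in> D ty2 \<Longrightarrow> dec1 \<phi> \<in> D ty1" "\<phi> \<in> D ty2 \<Longrightarrow> dec2 \<phi> \<in> D ty1"
  using cl_in[of consT "N \<rightarrow> ty1 \<rightarrow> ty1"] cl_in[of shiftT "ty1 \<rightarrow> ty1"] cl_in[of constT "N \<rightarrow> ty1"]
    cl_in[of encT "ty2 \<rightarrow> ty1 \<rightarrow> ty1 \<rightarrow> ty2"] cl_in[of dec0T "ty2 \<rightarrow> ty2"] cl_in[of dec1T "ty2 \<rightarrow> ty1"]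
    cl_in[of dec2T "ty2 \<rightarrow> ty1"]
  by (simp, meson ap_closed)+

lemma cons_0 [simp]: "a \<in> D N \<Longrightarrow> f \<in> D ty1 \<Longrightarrow> cl consT \<bullet> a \<bullet> f \<bullet> Z = a"
  by (simp add: consT_def evals)

lemma cons_S [simp]: "a \<in> D N \<Longrightarrow> f \<in> D ty1 \<Longrightarrow> i \<in> D N \<Longrightarrow> cl consT \<bullet> a \<bullet> f \<bullet> S i = f \<bullet> i"
  by (simp add: consT_def evals)

lemma const_ap [simp]: "a \<in> D N \<Longrightarrow> i \<in> D N \<Longrightarrow> cl constT \<bullet> a \<bullet> i = a"
  by (simp add: constT_def evals)

lemma shift_cons [simp]: "a \<in> D N \<Longrightarrow> f \<in> D ty1 \<Longrightarrow> cl shiftT \<bullet> (cl consT \<bullet> a \<bullet> f) = f"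
  by (rule fn_ext[of _ N N]) (simp_all add: shiftT_def evals)

lemma enc_ap: "\<phi> \<in> D ty2 \<Longrightarrow> f \<in> D ty1 \<Longrightarrow> g \<in> D ty1 \<Longrightarrow> h \<in> D ty1 \<Longrightarrow>
  enc \<phi> f g \<bullet> h = (if h \<bullet> Z = Z then \<phi> \<bullet> (cl shiftT \<bullet> h)
    else if pred (h \<bullet> Z) = Z then f \<bullet> (h \<bullet> S Z) else g \<bullet> (h \<bullet> S Z))"
  by (simp add: encT_def evals cond_iff)

lemma dec0_enc [simp]: "\<phi> \<in> D ty2 \<Longrightarrow> f \<in> D ty1 \<Longrightarrow> g \<in> D ty1 \<Longrightarrow> dec0 (enc \<phi> f g) = \<phi>"
  by (rule fn_ext[of _ ty1 N]) (simp_all add: dec0T_def evals, simp add: enc_ap)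

lemma dec1_enc [simp]: "\<phi> \<in> D ty2 \<Longrightarrow> f \<in> D ty1 \<Longrightarrow> g \<in> D ty1 \<Longrightarrow> dec1 (enc \<phi> f g) = f"
  by (rule fn_ext[of _ N N]) (simp_all add: dec1T_def evals, simp add: enc_ap)

lemma dec2_enc [simp]: "\<phi> \<in> D ty2 \<Longrightarrow> f \<in> D ty1 \<Longrightarrow> g \<in> D ty1 \<Longrightarrow> dec2 (enc \<phi> f g) = g"
  by (rule fn_ext[of _ N N]) (simp_all add: dec2T_def evals, simp add: enc_ap)

text \<open>From a modulus: maximise over all codes up to that of \<open>1,...,1\<close>, which bounds the codes of
  binary sequences of the same length.\<close>

definition maxcodeT :: trm where
  "maxcodeT = lam (0, ty3) (lam (0, ty2) (trimcT \<cdot> (argmaxT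
     \<cdot> (lamN 0 (Var (0, ty2) \<cdot> (extT \<cdot> (trimcT \<cdot> v 0))))
     \<cdot> (codeT \<cdot> oneT \<cdot> (Var (0, ty3) \<cdot> Var (0, ty2))))))"

lemma maxcodeT_wf [simp]: "wft maxcodeT" "tyof maxcodeT = ty3 \<rightarrow> ty2 \<rightarrow> N" "fvt maxcodeT = {}"
  by (simp_all add: maxcodeT_def insert_Diff_if)

lemma val_maxcode [simp]: "val \<rho> maxcodeT = cl maxcodeT"
  by (simp add: val_cl)

lemma maxcode_in [simp]: "\<Omega> \<in> D ty3 \<Longrightarrow> \<phi> \<in> D ty2 \<Longrightarrow> cl maxcodeT \<bullet> \<Omega> \<bullet> \<phi> \<in> D N"
  using cl_in[of maxcodeT "ty3 \<rightarrow> ty2 \<rightarrow> N"] by (simp, meson ap_closed)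

text \<open>A binary \<open>f\<close> agrees up to the modulus with the zero-extension of its own
  initial segment, and the code of that segment is in the range of the search. Thus
  \<open>\<phi> \<bullet> f\<close> is among the values compared.\<close>

lemma maxcode:
  assumes \<Omega>: "modulus \<Omega>" and \<phi>: "\<phi> \<in> D ty2"
  defines "\<sigma> \<equiv> cl maxcodeT \<bullet> \<Omega> \<bullet> \<phi>"
  shows "C (ex \<sigma>)" "upper \<phi> (\<phi> \<bullet> ex \<sigma>)"
proof -
  have \<Omega>D: "\<Omega> \<in> D ty3" using \<Omega> by (simp add: modulus_def)
  let ?n = "\<Omega> \<bullet> \<phi>"
  \<comment> \<open>The range of the search also contains codes of sequences that are not binary;
    trimming them first makes every number a candidate.\<close>
  define g where "g = val (base((0, ty3) := \<Omega>, (0, ty2) := \<phi>)) (lamN 0 (Var (0, ty2) \<cdot> (extT \<cdot> (trimcT \<cdot> v 0))))"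
  have g: "g \<in> D ty1" unfolding g_def by (rule val_in) (use \<Omega>D \<phi> in simp_all)
  have g_ap: "g \<bullet> c = \<phi> \<bullet> (trim (ex c))" if "c \<in> D N" for c
    using that \<Omega>D \<phi> by (simp add: g_def evals)
  let ?m = "argmax g (code (cl oneT) ?n)"
  have m: "?m \<in> D N" using g \<Omega>D \<phi> by simp
  have "\<sigma> = trimc ?m" using \<Omega>D \<phi> by (simp add: \<sigma>_def maxcodeT_def evals g_def)
  then have ex: "ex \<sigma> = trim (ex ?m)" using m by simp
  then show "C (ex \<sigma>)" using m by simp
  show "upper \<phi> (\<phi> \<bullet> ex \<sigma>)"
    unfolding upper_def
  proof (intro allI impI)
    fix f assume f: "C f"
    then have fD: "f \<in> D ty1" by (rule C_in)
    let ?c = "code f ?n"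
    have n: "?n \<in> D N" using \<Omega>D \<phi> by simp
    have c: "?c \<in> D N" using fD n by simp
    have Cc: "C (ex ?c)" using f fD n by (simp add: C_def ext_code)
    \<comment> \<open>The extension of the segment has the same initial segment as \<open>f\<close>,
      as the modulus demands.\<close>
    have "code (ex ?c) ?n = ?c" by (rule code_cong) (use fD n c in \<open>simp_all add: ext_code\<close>)
    then have "\<phi> \<bullet> f = \<phi> \<bullet> ex ?c" using \<Omega> \<phi> f Cc unfolding modulus_def by metis
    also have "\<dots> = g \<bullet> ?c" using g_ap[OF c] trim_C[OF Cc] by simp
    also have "\<dots> \<preceq> g \<bullet> ?m" using argmax_max[OF g _ c code_le_one[OF f n]] n by simp
    also have "g \<bullet> ?m = \<phi> \<bullet> ex \<sigma>" using g_ap[OF m] ex by simp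
    finally show "\<phi> \<bullet> f \<preceq> \<phi> \<bullet> ex \<sigma>" .
  qed
qed

text \<open>The finite sequence is computed from the modulus by a closed term, so \<open>G\<close>
  is explicitly definable from \<open>\<Omega>\<close>.\<close>

lemma MUC_imp_SUP_dagger: assumes "sat \<rho> MUC_fm" shows "sat \<rho>' SUP_dagger_fm"
proof -
  obtain \<Omega> where \<Omega>: "modulus \<Omega>" using assms sat_MUC by blast
  then have \<Omega>D: "\<Omega> \<in> D ty3" by (simp add: modulus_def)
  define G where "G = val (base((0, ty3) := \<Omega>))
    (lam (0, ty2) (Var (0, ty2) \<cdot> (extT \<cdot> (maxcodeT \<cdot> Var (0, ty3) \<cdot> Var (0, ty2)))))"
  have "G \<in> D ty3" unfolding G_def by (rule val_in) (use \<Omega>D in simp_all)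
  moreover have "G \<bullet> \<phi> = \<phi> \<bullet> ex (cl maxcodeT \<bullet> \<Omega> \<bullet> \<phi>)" if "\<phi> \<in> D ty2" for \<phi>
    using that \<Omega>D by (simp add: G_def evals)
  ultimately show ?thesis unfolding sat_SUP_dagger using maxcode[OF \<Omega>] maxcode_in[OF \<Omega>D] by metis
qed

lemma SUP_dagger_imp_SUP: "sat \<rho> SUP_dagger_fm \<Longrightarrow> sat \<rho>' SUP_fm"
  unfolding sat_SUP_dagger sat_SUP sup_fun_def by blast

end

section \<open>The principles relative to standard objects\<close>

context rca_model begin

text \<open>What relativisation makes of Cantor space: nothing is said about the entries at
  nonstandard places.\<close>

definition Cs :: "'a \<Rightarrow> bool" where
  "Cs f \<longleftrightarrow> f \<in> D ty1 \<and> sd f \<and> (\<forall>i\<in>D N. sd i \<longrightarrow> f \<bullet> i \<preceq> S Z)"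

lemma Cs_quant:
  "(\<forall>f\<in>D ty1. sd f \<longrightarrow> (\<forall>i\<in>D N. sd i \<longrightarrow> f \<bullet> i \<preceq> S Z) \<longrightarrow> P f) \<longleftrightarrow> (\<forall>f. Cs f \<longrightarrow> P f)"
  "(\<exists>f\<in>D ty1. sd f \<and> (\<forall>i\<in>D N. sd i \<longrightarrow> f \<bullet> i \<preceq> S Z) \<and> P f) \<longleftrightarrow> (\<exists>f. Cs f \<and> P f)"
  unfolding Cs_def by blast+

lemma sat_rel_st_cantor: "sat \<rho> (rel_st (cantor t)) \<longleftrightarrow> (\<forall>i\<in>D N. sd i \<longrightarrow> val \<rho> t \<bullet> i \<preceq> S Z)"
proof -
  have "(fresh t, N) \<notin> fvt t" using fvt_fresh[of _ t] by fastforce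
  then show ?thesis by (simp add: cantor_def Let_def)
qed

definition upper_st :: "'a \<Rightarrow> 'a \<Rightarrow> bool" where
  "upper_st \<phi> k \<longleftrightarrow> (\<forall>f. Cs f \<longrightarrow> \<phi> \<bullet> f \<preceq> k)"

definition sup_st :: "'a \<Rightarrow> bool" where
  "sup_st G \<longleftrightarrow> G \<in> D ty3 \<and> sd G \<and>
    (\<forall>\<phi>\<in>D ty2. sd \<phi> \<longrightarrow> upper_st \<phi> (G \<bullet> \<phi>) \<and> (\<exists>g. Cs g \<and> G \<bullet> \<phi> = \<phi> \<bullet> g))"

lemma sat_rel_st_matrix:
  "\<rho> vG \<in> D ty3 \<Longrightarrow> sd (\<rho> vG) \<Longrightarrow> sat \<rho> (rel_st SUP_matrix) \<longleftrightarrow> sup_st (\<rho> vG)"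
  unfolding sup_st_def upper_st_def by (simp add: SUP_matrix_def sat_rel_st_cantor Cs_quant)

lemma sat_SUP_st: "sat \<rho> (rel_st SUP_fm) \<longleftrightarrow> (\<exists>G. sup_st G)"
  unfolding SUP_fm_matrix using sat_rel_st_matrix by (auto simp: sup_st_def)

text \<open>Relativisation leaves \<open>binary\<close> as it is, its only quantifier being bounded.
  The finite sequence is thus binary outright, while the upper bound refers to
  \<open>Cs\<close>.\<close>

lemma sat_SUP_dagger_st: "sat \<rho> (rel_st SUP_dagger_fm) \<longleftrightarrow> (\<exists>G\<in>D ty3. sd G \<and>
    (\<forall>\<phi>\<in>D ty2. sd \<phi> \<longrightarrow> upper_st \<phi> (G \<bullet> \<phi>) \<and> (\<exists>\<sigma>\<in>D N. sd \<sigma> \<and> C (ex \<sigma>) \<and> G \<bullet> \<phi> = \<phi> \<bullet> ex \<sigma>)))"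
  unfolding upper_st_def
  by (simp add: SUP_dagger_fm_def sat_rel_st_cantor Cs_quant sat_binary cong: bex_cong)

lemma sat_N: "sat \<rho> N_fm \<longleftrightarrow> (\<forall>\<phi>\<in>D ty2. sd \<phi> \<longrightarrow>
    (\<exists>k\<in>D N. sd k \<and> upper \<phi> k \<and> (\<exists>g\<in>D ty1. sd g \<and> C g \<and> k = \<phi> \<bullet> g)))"
  unfolding upper_def by (simp add: N_fm_def sat_cantor C_quant) (simp add: C_def)

lemma sat_N_dagger: "sat \<rho> N_dagger_fm \<longleftrightarrow> (\<forall>\<phi>\<in>D ty2. sd \<phi> \<longrightarrow>
    (\<exists>k\<in>D N. sd k \<and> upper \<phi> k \<and> (\<exists>\<sigma>\<in>D N. sd \<sigma> \<and> C (ex \<sigma>) \<and> k = \<phi> \<bullet> ex \<sigma>)))"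
  unfolding upper_def by (simp add: N_dagger_fm_def sat_cantor C_quant sat_binary cong: bex_cong)

lemma sd_ex: "\<sigma> \<in> D N \<Longrightarrow> sd \<sigma> \<Longrightarrow> sd (ex \<sigma>)"
  by (rule sd_ap[of _ N ty1]) (simp_all add: cl_in)

lemma sd_trim: "f \<in> D ty1 \<Longrightarrow> sd f \<Longrightarrow> sd (trim f)"
  by (rule sd_ap[of _ ty1 ty1]) (simp_all add: cl_in)

lemma sd_ap2: "\<phi> \<in> D ty2 \<Longrightarrow> f \<in> D ty1 \<Longrightarrow> sd \<phi> \<Longrightarrow> sd f \<Longrightarrow> sd (\<phi> \<bullet> f)"
  by (rule sd_ap)

text \<open>For standard objects this is stronger than the axiom of extensionality, since agreement
  is assumed at standard places only.\<close>

definition ext_st :: bool where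
  "ext_st \<longleftrightarrow> (\<forall>\<phi>\<in>D ty2. \<forall>f\<in>D ty1. \<forall>g\<in>D ty1. sd \<phi> \<longrightarrow> sd f \<longrightarrow> sd g \<longrightarrow>
     (\<forall>i\<in>D N. sd i \<longrightarrow> f \<bullet> i = g \<bullet> i) \<longrightarrow> \<phi> \<bullet> f = \<phi> \<bullet> g)"

lemma Cs_trim: assumes "Cs f" shows "C (trim f)" "sd (trim f)" "i \<in> D N \<Longrightarrow> sd i \<Longrightarrow> trim f \<bullet> i = f \<bullet> i"
  using assms sd_trim by (auto simp: Cs_def lq_one)

lemma C_imp_Cs: "C f \<Longrightarrow> sd f \<Longrightarrow> Cs f"
  by (auto simp: C_def Cs_def)

text \<open>Replace \<open>f\<close> by \<open>trim f\<close>, which is binary everywhere and equal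
  to \<open>f\<close> at standard places.\<close>

lemma upper_imp_st:
  assumes "ext_st" "\<phi> \<in> D ty2" "sd \<phi>" "upper \<phi> k"
  shows "upper_st \<phi> k"
  unfolding upper_st_def
proof (intro allI impI)
  fix f assume f: "Cs f"
  then have "\<phi> \<bullet> f = \<phi> \<bullet> trim f"
    using assms(1-3) Cs_trim[OF f] unfolding ext_st_def Cs_def by (metis cantor_ops_in(1))
  then show "\<phi> \<bullet> f \<preceq> k" using assms(4) Cs_trim(1)[OF f] by (simp add: upper_def)
qed

lemma ext_st_of_N_dagger:
  assumes "sat \<rho> N_dagger_fm" shows ext_st
  unfolding ext_st_def
proof (intro ballI impI)
  fix \<phi> f g
  assume D: "\<phi> \<in> D ty2" "f \<in> D ty1" "g \<in> D ty1" and sd: "sd \<phi>" "sd f" "sd g"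
    and fg: "\<forall>i\<in>D N. sd i \<longrightarrow> f \<bullet> i = g \<bullet> i"
  let ?\<rho> = "base((0, ty2) := \<phi>, (0, ty1) := f, (1, ty1) := g)"
  let ?h = "Var (2, ty1)"
  \<comment> \<open>\<open>?mix\<close> follows \<open>f\<close> where \<open>h\<close> is nonzero
    and \<open>g\<close> elsewhere. In \<open>?t\<close>, the sum of both truncated differences
    vanishes exactly if the two values of \<open>\<phi>\<close> are equal.\<close>
  let ?mix = "lamN 0 (condT \<cdot> (?h \<cdot> v 0) \<cdot> (Var (1, ty1) \<cdot> v 0) \<cdot> (Var (0, ty1) \<cdot> v 0))"
  let ?a = "Var (0, ty2) \<cdot> ?mix" and ?b = "Var (0, ty2) \<cdot> Var (1, ty1)"
  let ?t = "lam (2, ty1) (condT \<cdot> (addT \<cdot> (subT \<cdot> ?a \<cdot> ?b) \<cdot> (subT \<cdot> ?b \<cdot> ?a)) \<cdot> zero \<cdot> suc zero)"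
  define mix where "mix h = val (?\<rho>((2, ty1) := h)) ?mix" for h
  have mixD: "mix h \<in> D ty1" if "h \<in> D ty1" for h
    unfolding mix_def by (rule val_in) (use D that in simp_all)
  have mix_ap: "mix h \<bullet> i = (if h \<bullet> i = Z then g \<bullet> i else f \<bullet> i)" if "h \<in> D ty1" "i \<in> D N" for h i
    using D that by (simp add: mix_def evals cond_iff)
  define \<psi> where "\<psi> = val ?\<rho> ?t"
  have \<psi>D: "\<psi> \<in> D ty2" unfolding \<psi>_def by (rule val_in) (use D in simp_all)
  have \<psi>s: "sd \<psi>" unfolding \<psi>_def by (rule sd_val) (use D sd in auto)
  have zero: "x \<oplus> y = Z \<longleftrightarrow> x = Z \<and> y = Z" if "x \<in> D N" "y \<in> D N" for x y
    using that N_cases[of y] by (metis S_neq_Z arith_in(1) plus_0 plus_S)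
  have \<psi>_ap: "\<psi> \<bullet> h = (if \<phi> \<bullet> mix h = \<phi> \<bullet> g then Z else S Z)" if h: "h \<in> D ty1" for h
  proof -
    have "\<psi> \<bullet> h = cond ((\<phi> \<bullet> mix h \<ominus> \<phi> \<bullet> g) \<oplus> (\<phi> \<bullet> g \<ominus> \<phi> \<bullet> mix h)) Z (S Z)"
      using D h mixD[OF h] by (simp add: \<psi>_def lam_ap mix_def)
    then show ?thesis
      using D h mixD[OF h] lq_antisym[of "\<phi> \<bullet> mix h" "\<phi> \<bullet> g"] by (auto simp: cond_iff zero)
  qed
  obtain \<sigma> where \<sigma>: "\<sigma> \<in> D N" "sd \<sigma>" "C (ex \<sigma>)" "upper \<psi> (\<psi> \<bullet> ex \<sigma>)"
    using assms \<psi>D \<psi>s unfolding sat_N_dagger by blast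
  \<comment> \<open>A place where \<open>ex \<sigma>\<close> is nonzero lies below the standard
    length of \<open>\<sigma>\<close>; it is therefore standard, and \<open>f\<close> and
    \<open>g\<close> agree there.\<close>
  have "mix (ex \<sigma>) = g"
  proof (rule fn_ext[of _ N N])
    fix i assume i: "i \<in> D N"
    have "sd (lh \<sigma>)" by (rule sd_ap[of _ N N]) (use \<sigma> in \<open>simp_all add: cl_in\<close>)
    then have "sd i" if "S i \<preceq> lh \<sigma>" using sd_lq[OF S_lqD[OF that]] \<sigma> i by simp
    then show "mix (ex \<sigma>) \<bullet> i = g \<bullet> i" using fg i \<sigma> mix_ap[of "ex \<sigma>" i] by (auto simp: ext_ap)
  qed (use mixD \<sigma> D in simp_all)
  then have max: "\<psi> \<bullet> ex \<sigma> = Z" using \<psi>_ap \<sigma> by simp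
  \<comment> \<open>The constant function 1 selects \<open>f\<close> throughout. It belongs to
    Cantor space, so \<open>\<psi>\<close> is bounded there by its maximum zero.\<close>
  have "mix (cl oneT) = f"
    by (rule fn_ext[of _ N N]) (use mixD D in \<open>simp_all add: mix_ap\<close>)
  moreover have "C (cl oneT)" by (simp add: C_def)
  ultimately show "\<phi> \<bullet> f = \<phi> \<bullet> g"
    using \<sigma>(4) \<psi>_ap[of "cl oneT"] unfolding max upper_def by (auto split: if_splits)
qed

section \<open>The principles with finite binary witnesses\<close>

text \<open>Choice lists finitely many candidates for each standard \<open>\<phi>\<close>, one of
  which yields an upper bound; \<open>G\<close> takes the largest value of \<open>\<phi>\<close> on
  the trimmed list, which is then an upper bound too. Standard extensionality carries the bound over
  to functions that are binary at standard places.\<close>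

lemma N_dagger_imp_SUP_dagger_st:
  assumes N: "sat \<rho> N_dagger_fm" shows "sat \<rho>' (rel_st SUP_dagger_fm)"
proof -
  let ?A = "binary (v 1) \<^bold>\<and> AllC vf (le (Var vphi \<cdot> Var vf) (Var vphi \<cdot> (extT \<cdot> v 1)))"
  have A: "sat (base((0, ty2) := \<phi>, (1, N) := \<sigma>)) ?A \<longleftrightarrow> C (ex \<sigma>) \<and> upper \<phi> (\<phi> \<bullet> ex \<sigma>)"
    if "\<sigma> \<in> D N" for \<phi> \<sigma>
    using that by (simp add: sat_binary sat_cantor C_quant upper_def)
  have "\<exists>F\<in>D (ty2 \<rightarrow> Sq N). sd F \<and> (\<forall>\<phi>\<in>D ty2. sd \<phi> \<longrightarrow> (\<exists>i\<in>D N. S i \<preceq> cn (Len N) \<bullet> (F \<bullet> \<phi>) \<and>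
    sat (base((0, ty2) := \<phi>, (1, N) := cn (At N) \<bullet> (F \<bullet> \<phi>) \<bullet> i)) ?A))"
  proof (rule choice)
    fix \<phi> assume "\<phi> \<in> D ty2" "sd \<phi>"
    then obtain \<sigma> where "\<sigma> \<in> D N" "sd \<sigma>" "C (ex \<sigma>)" "upper \<phi> (\<phi> \<bullet> ex \<sigma>)"
      using N unfolding sat_N_dagger by blast
    then show "\<exists>\<sigma>\<in>D N. sd \<sigma> \<and> sat (base((0, ty2) := \<phi>, (1, N) := \<sigma>)) ?A" using A by blast
  qed (auto simp: binary_def)
  then obtain F where F: "F \<in> D (ty2 \<rightarrow> Sq N)" "sd F" and
    Fi: "\<And>\<phi>. \<phi> \<in> D ty2 \<Longrightarrow> sd \<phi> \<Longrightarrow> \<exists>i\<in>D N. S i \<preceq> cn (Len N) \<bullet> (F \<bullet> \<phi>) \<and>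
      sat (base((0, ty2) := \<phi>, (1, N) := cn (At N) \<bullet> (F \<bullet> \<phi>) \<bullet> i)) ?A" by blast
  let ?F = "Var (0, ty2 \<rightarrow> Sq N) \<cdot> Var (0, ty2)"
  \<comment> \<open>Because of the trimming, entries that are not binary, and the index just past
    the end that the maximisation includes, still contribute values on Cantor space.\<close>
  let ?g = "lamN 0 (Var (0, ty2) \<cdot> (extT \<cdot> (trimcT \<cdot> (Cn (At N) \<cdot> ?F \<cdot> v 0))))"
  let ?s = "trimcT \<cdot> (Cn (At N) \<cdot> ?F \<cdot> (argmaxT \<cdot> ?g \<cdot> (Cn (Len N) \<cdot> ?F)))"
  let ?\<rho> = "base((0, ty2 \<rightarrow> Sq N) := F)"
  define \<sigma> where "\<sigma> \<phi> = val (?\<rho>((0, ty2) := \<phi>)) ?s" for \<phi>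
  define G where "G = val ?\<rho> (lam (0, ty2) (Var (0, ty2) \<cdot> (extT \<cdot> ?s)))"
  have GD: "G \<in> D ty3" unfolding G_def by (rule val_in) (use F in simp_all)
  have Gs: "sd G" unfolding G_def by (rule sd_val) (use F in auto)
  have G_ap: "G \<bullet> \<phi> = \<phi> \<bullet> ex (\<sigma> \<phi>)" if "\<phi> \<in> D ty2" for \<phi>
    using that F by (simp add: G_def \<sigma>_def lam_ap)
  have "upper_st \<phi> (G \<bullet> \<phi>) \<and> (\<exists>\<sigma>\<in>D N. sd \<sigma> \<and> C (ex \<sigma>) \<and> G \<bullet> \<phi> = \<phi> \<bullet> ex \<sigma>)"
    if \<phi>: "\<phi> \<in> D ty2" "sd \<phi>" for \<phi>
  proof -
    let ?\<rho>' = "?\<rho>((0, ty2) := \<phi>)"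
    have ty: "typed ?\<rho>'" using F \<phi> by simp
    define g where "g = val ?\<rho>' ?g"
    define l where "l = cn (Len N) \<bullet> (F \<bullet> \<phi>)"
    define s where "s i = cn (At N) \<bullet> (F \<bullet> \<phi>) \<bullet> i" for i
    have gD: "g \<in> D ty1" unfolding g_def by (rule val_in[OF ty]) simp_all
    have lD: "l \<in> D N" unfolding l_def using val_in[OF ty, of "Cn (Len N) \<cdot> ?F" N] by simp
    have sD: "s i \<in> D N" if "i \<in> D N" for i
      unfolding s_def using val_in[of "?\<rho>'((0, N) := i)" "Cn (At N) \<cdot> ?F \<cdot> v 0" N] ty that by simp
    have g_ap: "g \<bullet> i = \<phi> \<bullet> trim (ex (s i))" if "i \<in> D N" for i
      using that ty \<phi> F sD[OF that] by (simp add: g_def lam_ap s_def)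
    have m: "argmax g l \<in> D N" using gD lD by simp
    have \<sigma>m: "\<sigma> \<phi> = trimc (s (argmax g l))" by (simp add: \<sigma>_def g_def l_def s_def)
    then have \<sigma>D: "\<sigma> \<phi> \<in> D N" using sD m by simp
    have \<sigma>s: "sd (\<sigma> \<phi>)" unfolding \<sigma>_def by (rule sd_val[OF ty]) (use F \<phi> in auto)
    have \<sigma>C: "C (ex (\<sigma> \<phi>))" using \<sigma>m sD m by simp
    obtain i where i: "i \<in> D N" "S i \<preceq> l" "C (ex (s i))" "upper \<phi> (\<phi> \<bullet> ex (s i))"
      using Fi[OF \<phi>] A sD unfolding l_def s_def by blast
    have "\<phi> \<bullet> ex (s i) = g \<bullet> i" using g_ap i trim_C by simp
    also have "\<dots> \<preceq> g \<bullet> argmax g l" using argmax_max gD lD i S_lqD by blast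
    also have "\<dots> = G \<bullet> \<phi>" using g_ap[OF m] G_ap[OF \<phi>(1)] \<sigma>m sD m by simp
    finally have le: "\<phi> \<bullet> ex (s i) \<preceq> G \<bullet> \<phi>" .
    have "upper \<phi> (G \<bullet> \<phi>)"
      using i(4) le lq_trans C_in \<phi>(1) GD sD[OF i(1)] unfolding upper_def
      by (meson D2_in D3_in code_ops_in(9))
    then show ?thesis
      using upper_imp_st[OF ext_st_of_N_dagger[OF N] \<phi>] G_ap[OF \<phi>(1)] \<sigma>D \<sigma>s \<sigma>C by blast
  qed
  then show ?thesis unfolding sat_SUP_dagger_st using GD Gs by blast
qed

abbreviation "\<Gamma> \<equiv> cn (Def vG SUP_matrix)"

lemma Gamma_in [simp]: "\<Gamma> \<in> D ty3"
  by (rule cn_in) simp_all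

text \<open>On standard arguments the constant has the values of \<open>G\<close>. In contrast to
  \<open>G\<close>, it may occur in formulas to which transfer applies.\<close>

lemma Gamma:
  assumes "sup_st G" "\<phi> \<in> D ty2" "sd \<phi>" shows "\<Gamma> \<bullet> \<phi> = G \<bullet> \<phi>"
proof -
  have "const_ax vG SUP_matrix \<in> DefAx"
  proof (rule DefAx.other)
    show "RCA0\<omega> \<turnstile> Forall vG (Forall (1, ty3)
        (SUP_matrix \<^bold>\<and> sbf vG (Var (1, ty3)) SUP_matrix \<^bold>\<longrightarrow> eq (snd vG) (Var vG) (Var (1, ty3))))"
      unfolding snd_conv by (rule SUP_matrix_unique)
  qed (simp_all add: SUP_matrix_free_for del: One_nat_def)
  moreover have "wff (const_ax vG SUP_matrix)"
    by (auto simp: const_ax_def wff_eq simp del: eq.simps intro!: wff_rel_st)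
  ultimately have "sat base (const_ax vG SUP_matrix)"
    using axT RCA by (auto simp: RCA0\<Omega>_def)
  moreover have G: "G \<in> D ty3" "sd G" using assms by (simp_all add: sup_st_def)
  moreover have "sat (base(vG := G)) (rel_st SUP_matrix)"
    using assms G by (simp add: sat_rel_st_matrix)
  ultimately show ?thesis using assms by (simp add: const_ax_def Let_def)
qed

text \<open>Transfer of the inequality in both variables at once, \<open>\<phi>\<close> and
  \<open>f\<close> being decoded from a single object. The conclusion thus covers nonstandard
  \<open>\<phi>\<close> and \<open>f\<close>.\<close>

lemma Gamma_upper:
  assumes "\<And>\<phi> f. \<phi> \<in> D ty2 \<Longrightarrow> sd \<phi> \<Longrightarrow> C f \<Longrightarrow> sd f \<Longrightarrow> \<phi> \<bullet> f \<preceq> \<Gamma> \<bullet> \<phi>" and \<phi>: "\<phi> \<in> D ty2"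
  shows "upper \<phi> (\<Gamma> \<bullet> \<phi>)"
  unfolding upper_def
proof (intro allI impI)
  fix f assume f: "C f"
  let ?x = "Var (0, ty2)"
  let ?A = "cantor (dec1T \<cdot> ?x) \<^bold>\<longrightarrow>
    le (dec0T \<cdot> ?x \<cdot> (dec1T \<cdot> ?x)) (Cn (Def vG SUP_matrix) \<cdot> (dec0T \<cdot> ?x))"
  have A: "sat (base((0, ty2) := x)) ?A \<longleftrightarrow> (C (dec1 x) \<longrightarrow> dec0 x \<bullet> dec1 x \<preceq> \<Gamma> \<bullet> dec0 x)"
    if "x \<in> D ty2" for x using that by (simp add: sat_cantor_C)
  \<comment> \<open>The formula reads two components; the repeated \<open>f\<close> fills the
    third.\<close>
  let ?e = "enc \<phi> f f"
  have "sat (base((0, ty2) := ?e)) ?A"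
  proof (rule transfer)
    fix x assume "x \<in> D (snd vphi)" "sd x"
    then have x: "x \<in> D ty2" "sd x" by simp_all
    have "sd (dec0 x)" by (rule sd_ap[of _ ty2 ty2]) (use x in \<open>simp_all add: cl_in\<close>)
    moreover have "sd (dec1 x)" by (rule sd_ap[of _ ty2 ty1]) (use x in \<open>simp_all add: cl_in\<close>)
    ultimately show "sat (base((0, ty2) := x)) ?A" unfolding A[OF x(1)] using assms(1) x by simp
  qed (use \<phi> C_in[OF f] in auto)
  then show "\<phi> \<bullet> f \<preceq> \<Gamma> \<bullet> \<phi>" using A[of ?e] \<phi> f C_in[OF f] by simp
qed

lemma sup_st_Gamma_upper:
  assumes G: "sup_st G" and "\<phi> \<in> D ty2" shows "upper \<phi> (\<Gamma> \<bullet> \<phi>)"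
proof (rule Gamma_upper)
  show "\<phi> \<bullet> f \<preceq> \<Gamma> \<bullet> \<phi>" if "\<phi> \<in> D ty2" "sd \<phi>" "C f" "sd f" for \<phi> f
    using that G Gamma[OF G] C_imp_Cs by (auto simp: sup_st_def upper_st_def)
qed (use assms in simp)

text \<open>By assumption \<open>G\<close> bounds a standard \<open>\<phi>\<close> only on standard
  functions. Passing to \<open>\<Gamma>\<close> extends the bound to all of Cantor space, while the
  values at standard \<open>\<phi>\<close> remain the same.\<close>

lemma SUP_dagger_st_imp_N_dagger:
  assumes "sat \<rho> (rel_st SUP_dagger_fm)" shows "sat \<rho>' N_dagger_fm"
proof -
  obtain G where G: "G \<in> D ty3" "sd G" "\<And>\<phi>. \<phi> \<in> D ty2 \<Longrightarrow> sd \<phi> \<Longrightarrow>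
    upper_st \<phi> (G \<bullet> \<phi>) \<and> (\<exists>\<sigma>\<in>D N. sd \<sigma> \<and> C (ex \<sigma>) \<and> G \<bullet> \<phi> = \<phi> \<bullet> ex \<sigma>)"
    using assms unfolding sat_SUP_dagger_st by blast
  have s: "sup_st G" unfolding sup_st_def using G C_imp_Cs sd_ex by metis
  have "sd (G \<bullet> \<phi>)" if "\<phi> \<in> D ty2" "sd \<phi>" for \<phi> by (rule sd_ap) (use G that in auto)
  then show ?thesis
    unfolding sat_N_dagger using G sup_st_Gamma_upper[OF s] Gamma[OF s] D3_in by metis
qed

lemma N_dagger_imp_N: "sat \<rho> N_dagger_fm \<Longrightarrow> sat \<rho>' N_fm"
  unfolding sat_N_dagger sat_N using sd_ex code_ops_in(9) by metis

text \<open>The matrix of \<open>MUC_fm\<close> has no parameters, so by transfer some modulus is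
  standard; the maximising sequence computed from it is then standard for standard
  \<open>\<phi>\<close>.\<close>

lemma MUC_imp_N_dagger: assumes "sat \<rho> MUC_fm" shows "sat \<rho>' N_dagger_fm"
proof -
  obtain \<Omega>' where \<Omega>': "modulus \<Omega>'" using assms sat_MUC by blast
  let ?A = "Forall vphi (AllC vf (AllC vg
     (Eq (codeT \<cdot> Var vf \<cdot> (Var vOmega \<cdot> Var vphi)) (codeT \<cdot> Var vg \<cdot> (Var vOmega \<cdot> Var vphi))
      \<^bold>\<longrightarrow> Eq (Var vphi \<cdot> Var vf) (Var vphi \<cdot> Var vg))))"
  have A: "sat (base(vOmega := \<Omega>)) ?A \<longleftrightarrow> modulus \<Omega>" if "\<Omega> \<in> D ty3" for \<Omega>
    unfolding modulus_def using that by (simp add: sat_cantor C_quant)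
  have "\<exists>\<Omega>\<in>D (snd vOmega). sd \<Omega> \<and> sat (base(vOmega := \<Omega>)) ?A"
  proof (rule transfer_ex)
    show "\<Omega>' \<in> D (snd vOmega)" using \<Omega>' by (simp add: modulus_def)
    then show "sat (base(vOmega := \<Omega>')) ?A" unfolding snd_conv using A \<Omega>' by blast
  qed auto
  then obtain \<Omega> where \<Omega>: "\<Omega> \<in> D ty3" "sd \<Omega>" "modulus \<Omega>" using A by auto
  have "sd (cl maxcodeT \<bullet> \<Omega> \<bullet> \<phi>)" if \<phi>: "\<phi> \<in> D ty2" "sd \<phi>" for \<phi>
  proof -
    let ?\<rho> = "base((0, ty3) := \<Omega>, (0, ty2) := \<phi>)"
    have "sd (val ?\<rho> (maxcodeT \<cdot> Var (0, ty3) \<cdot> Var (0, ty2)))"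
      by (rule sd_val) (use \<Omega> \<phi> in auto)
    then show ?thesis by simp
  qed
  then show ?thesis
    unfolding sat_N_dagger using maxcode[OF \<Omega>(3)] maxcode_in[OF \<Omega>(1)] sd_ap2 sd_ex
    by (metis D2_in code_ops_in(9))
qed

end

section \<open>Consequences of quantifier-free choice at type 2\<close>

locale rca_qfac_model = rca_model +
  assumes QFAC: "QFAC ty2 \<subseteq> T"
begin

text \<open>Read contrapositively: if \<open>dec0 x\<close> has different values,
  \<open>\<Psi>\<close> finds a place where its arguments differ. The functional and both arguments
  are packed into the one argument of type 2 that \<open>QFAC ty2\<close> permits.\<close>

definition separates :: "'a \<Rightarrow> bool" where
  "separates \<Psi> \<longleftrightarrow> \<Psi> \<in> D ty3 \<and> (\<forall>x\<in>D ty2. dec1 x \<bullet> (\<Psi> \<bullet> x) = dec2 x \<bullet> (\<Psi> \<bullet> x) \<longrightarrow>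
     dec0 x \<bullet> dec1 x = dec0 x \<bullet> dec2 x)"

text \<open>By extensionality some place \<open>n\<close> satisfies the quantifier-free
  \<open>?A\<close>, so choice applies. The property of the resulting functional has no parameters,
  and transfer supplies a standard one.\<close>

lemma separates_st: "\<exists>\<Psi>. sd \<Psi> \<and> separates \<Psi>"
proof -
  let ?X = "Var (0, ty2)"
  let ?A = "\<lambda>n. Eq (dec1T \<cdot> ?X \<cdot> n) (dec2T \<cdot> ?X \<cdot> n) \<^bold>\<longrightarrow>
    Eq (dec0T \<cdot> ?X \<cdot> (dec1T \<cdot> ?X)) (dec0T \<cdot> ?X \<cdot> (dec2T \<cdot> ?X))"
  let ?F = "Var (0, ty3)"
  let ?ax = "Forall (0, ty2) (Exists (1, N) (?A (v 1))) \<^bold>\<longrightarrow>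
    Exists (0, ty3) (Forall (0, ty2) (sbf (1, N) (?F \<cdot> ?X) (?A (v 1))))"
  have sb: "sbf (1, N) (?F \<cdot> ?X) (?A (v 1)) = ?A (?F \<cdot> ?X)" by simp
  have "?ax \<in> QFAC ty2" by (rule QFAC.intros) simp_all
  then have "sat base ?ax" by (intro axT) (use QFAC in auto)
  moreover have "\<exists>n\<in>D N. dec1 x \<bullet> n = dec2 x \<bullet> n \<longrightarrow> dec0 x \<bullet> dec1 x = dec0 x \<bullet> dec2 x"
    if x: "x \<in> D ty2" for x
  proof (cases "dec1 x = dec2 x")
    case False
    then obtain n where "n \<in> D N" "dec1 x \<bullet> n \<noteq> dec2 x \<bullet> n"
      using fn_ext[of "dec1 x" N N "dec2 x"] x by auto
    then show ?thesis by blast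
  next
    case True
    then show ?thesis by (intro bexI[of _ Z]) simp_all
  qed
  ultimately have "\<exists>\<Psi>. separates \<Psi>" unfolding sb separates_def by (auto simp: Bex_def)
  then obtain \<Psi> where \<Psi>: "separates \<Psi>" ..
  let ?B = "Forall (0, ty2) (?A (?F \<cdot> ?X))"
  have B: "sat (base((0, ty3) := \<Psi>)) ?B \<longleftrightarrow> separates \<Psi>" if "\<Psi> \<in> D ty3" for \<Psi>
    unfolding separates_def using that by simp
  have "\<exists>\<Psi>\<in>D (snd vG). sd \<Psi> \<and> sat (base((0, ty3) := \<Psi>)) ?B"
  proof (rule transfer_ex)
    show "\<Psi> \<in> D (snd vG)" using \<Psi> by (simp add: separates_def)
    then show "sat (base((0, ty3) := \<Psi>)) ?B" unfolding snd_conv using B \<Psi> by blast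
  qed auto
  then show ?thesis using B by auto
qed

lemma separatesD:
  assumes "separates \<Psi>" "\<phi> \<in> D ty2" "f \<in> D ty1" "g \<in> D ty1"
    "f \<bullet> (\<Psi> \<bullet> enc \<phi> f g) = g \<bullet> (\<Psi> \<bullet> enc \<phi> f g)"
  shows "\<phi> \<bullet> f = \<phi> \<bullet> g"
  using assms unfolding separates_def by (metis dec0_enc dec1_enc dec2_enc coding_in(4))

text \<open>A standard \<open>\<Psi>\<close> yields a standard place for standard arguments;
  agreement at that place already forces equal values.\<close>

lemma ext_st: ext_st
  unfolding ext_st_def
proof (intro ballI impI)
  fix \<phi> f g
  assume D: "\<phi> \<in> D ty2" "f \<in> D ty1" "g \<in> D ty1" and sd: "sd \<phi>" "sd f" "sd g"
    and fg: "\<forall>i\<in>D N. sd i \<longrightarrow> f \<bullet> i = g \<bullet> i"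
  obtain \<Psi> where \<Psi>: "sd \<Psi>" "separates \<Psi>" using separates_st by blast
  then have \<Psi>D: "\<Psi> \<in> D ty3" by (simp add: separates_def)
  let ?\<rho> = "base((0, ty3) := \<Psi>, (0, ty2) := \<phi>, (0, ty1) := f, (1, ty1) := g)"
  let ?t = "Var (0, ty3) \<cdot> (encT \<cdot> Var (0, ty2) \<cdot> Var (0, ty1) \<cdot> Var (1, ty1))"
  have "sd (val ?\<rho> ?t)" by (rule sd_val) (use D sd \<Psi> \<Psi>D in auto)
  then have "sd (\<Psi> \<bullet> enc \<phi> f g)" by simp
  then show "\<phi> \<bullet> f = \<phi> \<bullet> g" using separatesD[OF \<Psi>(2) D] fg D \<Psi>D by simp
qed

text \<open>The place \<open>\<Psi>(\<phi>, f, g)\<close> is bounded by two nested suprema, the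
  inner one over \<open>g\<close> with \<open>f\<close> fixed and the outer one over
  \<open>f\<close>. If \<open>f\<close> and \<open>g\<close> agree up to this bound, they agree at
  the place that could tell their values apart.\<close>

lemma SUP_imp_MUC: assumes "sat \<rho> SUP_fm" shows "sat \<rho>' MUC_fm"
proof -
  obtain G where G: "sup_fun G" using assms sat_SUP by blast
  obtain \<Psi> where \<Psi>: "separates \<Psi>" using separates_st by blast
  have D: "G \<in> D ty3" "\<Psi> \<in> D ty3" using G \<Psi> by (simp_all add: sup_fun_def separates_def)
  have up: "\<psi> \<bullet> f \<preceq> G \<bullet> \<psi>" if "\<psi> \<in> D ty2" "C f" for \<psi> f
    using G that by (simp add: sup_fun_def upper_def)
  let ?in = "lam (1, ty1) (Var (1, ty3) \<cdot> (encT \<cdot> Var (0, ty2) \<cdot> Var (0, ty1) \<cdot> Var (1, ty1)))"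
  let ?out = "lam (0, ty1) (Var (0, ty3) \<cdot> ?in)"
  let ?\<rho> = "base((0, ty3) := G, (1, ty3) := \<Psi>)"
  \<comment> \<open>The successor is there because \<open>code f n\<close> records only the places
    strictly below \<open>n\<close>.\<close>
  define \<Omega> where "\<Omega> = val ?\<rho> (lam (0, ty2) (suc (Var (0, ty3) \<cdot> ?out)))"
  have \<Omega>D: "\<Omega> \<in> D ty3" unfolding \<Omega>_def by (rule val_in) (use D in simp_all)
  have "\<phi> \<bullet> f = \<phi> \<bullet> g"
    if \<phi>: "\<phi> \<in> D ty2" and fg: "C f" "C g" and c: "code f (\<Omega> \<bullet> \<phi>) = code g (\<Omega> \<bullet> \<phi>)" for \<phi> f g
  proof -
    note fgD = C_in[OF fg(1)] C_in[OF fg(2)]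
    let ?n = "\<Psi> \<bullet> enc \<phi> f g"
    define \<psi> where "\<psi> = val (?\<rho>((0, ty2) := \<phi>)) ?out"
    define \<chi> where "\<chi> = val (?\<rho>((0, ty2) := \<phi>, (0, ty1) := f)) ?in"
    have \<psi>D: "\<psi> \<in> D ty2" unfolding \<psi>_def by (rule val_in) (use D \<phi> in simp_all)
    have \<chi>D: "\<chi> \<in> D ty2" unfolding \<chi>_def by (rule val_in) (use D \<phi> fgD in simp_all)
    have "?n = \<chi> \<bullet> g" using D \<phi> fgD by (simp add: \<chi>_def lam_ap)
    also have "\<chi> \<bullet> g \<preceq> G \<bullet> \<chi>" by (rule up[OF \<chi>D fg(2)])
    finally have 1: "?n \<preceq> G \<bullet> \<chi>" .
    have "G \<bullet> \<chi> = \<psi> \<bullet> f" using D \<phi> fgD by (simp add: \<psi>_def \<chi>_def lam_ap)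
    also have "\<psi> \<bullet> f \<preceq> G \<bullet> \<psi>" by (rule up[OF \<psi>D fg(1)])
    finally have 2: "G \<bullet> \<chi> \<preceq> G \<bullet> \<psi>" .
    have nD: "?n \<in> D N" using D \<phi> fgD by simp
    have "\<Omega> \<bullet> \<phi> = S (G \<bullet> \<psi>)" using D \<phi> by (simp add: \<Omega>_def \<psi>_def lam_ap)
    then have "S ?n \<preceq> \<Omega> \<bullet> \<phi>" using lq_trans[OF 1 2] nD D \<chi>D \<psi>D by simp
    then have "f \<bullet> ?n = g \<bullet> ?n" using code_inj[OF fgD _ nD c] \<Omega>D \<phi> by simp
    then show ?thesis by (rule separatesD[OF \<Psi> \<phi> fgD])
  qed
  then show ?thesis unfolding sat_MUC modulus_def using \<Omega>D by blast
qed

text \<open>As for finite sequences, but with functions as candidates: trimmed, they lie in Cantor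
  space, and the selected one is standard as the value of a term in \<open>F\<close> and
  \<open>\<phi>\<close>. Standard extensionality now comes from choice.\<close>

lemma N_imp_SUP_st:
  assumes N: "sat \<rho> N_fm" shows "sat \<rho>' (rel_st SUP_fm)"
proof -
  let ?A = "cantor (Var vg) \<^bold>\<and> AllC vf (le (Var vphi \<cdot> Var vf) (Var vphi \<cdot> Var vg))"
  have A: "sat (base((0, ty2) := \<phi>, (1, ty1) := g)) ?A \<longleftrightarrow> C g \<and> upper \<phi> (\<phi> \<bullet> g)"
    if "g \<in> D ty1" for \<phi> g
    using that by (simp add: sat_cantor C_quant upper_def) (simp add: C_def)
  have "\<exists>F\<in>D (ty2 \<rightarrow> Sq ty1). sd F \<and> (\<forall>\<phi>\<in>D ty2. sd \<phi> \<longrightarrow> (\<exists>i\<in>D N. S i \<preceq> cn (Len ty1) \<bullet> (F \<bullet> \<phi>) \<and>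
    sat (base((0, ty2) := \<phi>, (1, ty1) := cn (At ty1) \<bullet> (F \<bullet> \<phi>) \<bullet> i)) ?A))"
  proof (rule choice)
    fix \<phi> assume "\<phi> \<in> D ty2" "sd \<phi>"
    then obtain g where "g \<in> D ty1" "sd g" "C g" "upper \<phi> (\<phi> \<bullet> g)"
      using N unfolding sat_N by blast
    then show "\<exists>g\<in>D ty1. sd g \<and> sat (base((0, ty2) := \<phi>, (1, ty1) := g)) ?A" using A by blast
  qed auto
  then obtain F where F: "F \<in> D (ty2 \<rightarrow> Sq ty1)" "sd F" and
    Fi: "\<And>\<phi>. \<phi> \<in> D ty2 \<Longrightarrow> sd \<phi> \<Longrightarrow> \<exists>i\<in>D N. S i \<preceq> cn (Len ty1) \<bullet> (F \<bullet> \<phi>) \<and>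
      sat (base((0, ty2) := \<phi>, (1, ty1) := cn (At ty1) \<bullet> (F \<bullet> \<phi>) \<bullet> i)) ?A" by blast
  let ?F = "Var (0, ty2 \<rightarrow> Sq ty1) \<cdot> Var (0, ty2)"
  let ?g = "lamN 0 (Var (0, ty2) \<cdot> (trimT \<cdot> (Cn (At ty1) \<cdot> ?F \<cdot> v 0)))"
  let ?s = "trimT \<cdot> (Cn (At ty1) \<cdot> ?F \<cdot> (argmaxT \<cdot> ?g \<cdot> (Cn (Len ty1) \<cdot> ?F)))"
  let ?\<rho> = "base((0, ty2 \<rightarrow> Sq ty1) := F)"
  define w where "w \<phi> = val (?\<rho>((0, ty2) := \<phi>)) ?s" for \<phi>
  define G where "G = val ?\<rho> (lam (0, ty2) (Var (0, ty2) \<cdot> ?s))"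
  have GD: "G \<in> D ty3" unfolding G_def by (rule val_in) (use F in simp_all)
  have Gs: "sd G" unfolding G_def by (rule sd_val) (use F in auto)
  have G_ap: "G \<bullet> \<phi> = \<phi> \<bullet> w \<phi>" if "\<phi> \<in> D ty2" for \<phi>
    using that F by (simp add: G_def w_def lam_ap)
  have "upper_st \<phi> (G \<bullet> \<phi>) \<and> (\<exists>g. Cs g \<and> G \<bullet> \<phi> = \<phi> \<bullet> g)"
    if \<phi>: "\<phi> \<in> D ty2" "sd \<phi>" for \<phi>
  proof -
    let ?\<rho>' = "?\<rho>((0, ty2) := \<phi>)"
    have ty: "typed ?\<rho>'" using F \<phi> by simp
    define g where "g = val ?\<rho>' ?g"
    define l where "l = cn (Len ty1) \<bullet> (F \<bullet> \<phi>)"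
    define s where "s i = cn (At ty1) \<bullet> (F \<bullet> \<phi>) \<bullet> i" for i
    have gD: "g \<in> D ty1" unfolding g_def by (rule val_in[OF ty]) simp_all
    have lD: "l \<in> D N" unfolding l_def using val_in[OF ty, of "Cn (Len ty1) \<cdot> ?F" N] by simp
    have sD: "s i \<in> D ty1" if "i \<in> D N" for i
      unfolding s_def using val_in[of "?\<rho>'((0, N) := i)" "Cn (At ty1) \<cdot> ?F \<cdot> v 0" ty1] ty that by simp
    have g_ap: "g \<bullet> i = \<phi> \<bullet> trim (s i)" if "i \<in> D N" for i
      using that ty \<phi> F sD[OF that] by (simp add: g_def lam_ap s_def)
    have m: "argmax g l \<in> D N" using gD lD by simp
    have wm: "w \<phi> = trim (s (argmax g l))" by (simp add: w_def g_def l_def s_def)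
    have ws: "sd (w \<phi>)" unfolding w_def by (rule sd_val[OF ty]) (use F \<phi> in auto)
    have wC: "C (w \<phi>)" using wm sD m by simp
    obtain i where i: "i \<in> D N" "S i \<preceq> l" "C (s i)" "upper \<phi> (\<phi> \<bullet> s i)"
      using Fi[OF \<phi>] A sD unfolding l_def s_def by blast
    have "\<phi> \<bullet> s i = g \<bullet> i" using g_ap i trim_C by simp
    also have "\<dots> \<preceq> g \<bullet> argmax g l" using argmax_max gD lD i S_lqD by blast
    also have "\<dots> = G \<bullet> \<phi>" using g_ap[OF m] G_ap[OF \<phi>(1)] wm sD m by simp
    finally have le: "\<phi> \<bullet> s i \<preceq> G \<bullet> \<phi>" .
    have "upper \<phi> (G \<bullet> \<phi>)"
      using i(4) le lq_trans C_in \<phi>(1) GD sD[OF i(1)] unfolding upper_def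
      by (meson D2_in D3_in)
    then show ?thesis
      using upper_imp_st[OF ext_st \<phi>] G_ap[OF \<phi>(1)] C_imp_Cs[OF wC ws] by blast
  qed
  then show ?thesis unfolding sat_SUP_st sup_st_def using GD Gs by blast
qed

text \<open>The constant \<open>\<Gamma>\<close> is itself a supremum functional: its bound is
  already known for all \<open>\<phi>\<close>, and attainment is transferred as a property of
  \<open>\<phi>\<close> alone.\<close>

lemma SUP_st_imp_SUP: assumes "sat \<rho> (rel_st SUP_fm)" shows "sat \<rho>' SUP_fm"
proof -
  obtain G where G: "sup_st G" using assms sat_SUP_st by blast
  let ?A = "ExC vg (Eq (Cn (Def vG SUP_matrix) \<cdot> Var vphi) (Var vphi \<cdot> Var vg))"
  have A: "sat (base(vphi := \<phi>)) ?A \<longleftrightarrow> (\<exists>g. C g \<and> \<Gamma> \<bullet> \<phi> = \<phi> \<bullet> g)" for \<phi>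
    by (simp add: sat_cantor C_quant)
  have "sat (base(vphi := \<phi>)) ?A" if "\<phi> \<in> D (snd vphi)" for \<phi>
  proof (rule transfer)
    fix \<phi> assume "\<phi> \<in> D (snd vphi)" and s: "sd \<phi>"
    then have \<phi>: "\<phi> \<in> D ty2" by simp
    obtain g where g: "Cs g" "G \<bullet> \<phi> = \<phi> \<bullet> g" using G \<phi> s by (auto simp: sup_st_def)
    \<comment> \<open>The witness is known to be binary only at standard places; its trimmed version
      is binary everywhere and gives the same value by \<open>ext_st\<close>.\<close>
    then have "\<phi> \<bullet> g = \<phi> \<bullet> trim g"
      using ext_st \<phi> s Cs_trim[OF g(1)] unfolding ext_st_def Cs_def by (metis cantor_ops_in(1))
    then show "sat (base(vphi := \<phi>)) ?A"
      unfolding A using Cs_trim(1)[OF g(1)] g(2) Gamma[OF G \<phi> s] by auto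
  qed (use that in auto)
  then have "sup_fun \<Gamma>" unfolding sup_fun_def A using sup_st_Gamma_upper[OF G] by simp
  then show ?thesis unfolding sat_SUP by blast
qed

end

section \<open>Derivability of the equivalences\<close>

text \<open>Reduces a derivation to agreement of truth values in all models; external formulas are
  covered because \<open>T\<close> contains \<open>StAx\<close>.\<close>

lemma rca_iff:
  assumes T: "RCA0\<Omega> \<subseteq> T" and w: "wff A" "wff B"
    and AB: "\<And>(D :: ty \<Rightarrow> trm set set) ap cn sd \<rho>. rca_model T D ap cn sd \<Longrightarrow>
      interp.sat D ap cn (=) sd \<rho> A \<longleftrightarrow> interp.sat D ap cn (=) sd \<rho> B"
  shows "T \<turnstile> A \<^bold>\<longleftrightarrow> B"
proof (rule completeness)
  show E: "EPRA \<subseteq> T" and "internal (A \<^bold>\<longleftrightarrow> B) \<or> StAx \<subseteq> T"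
    using T by (auto simp: RCA0\<Omega>_def RCA0\<omega>_def)
  show "wff (A \<^bold>\<longleftrightarrow> B)" using w by simp
  fix D :: "ty \<Rightarrow> trm set set" and ap cn sd \<rho>
  assume m: "model T D ap cn sd"
  then interpret model T D ap cn sd .
  have "rca_model T D ap cn sd"
    using m T E by (simp add: rca_model_def rca_model_axioms_def epra_model_def epra_model_axioms_def)
  from AB[OF this] show "sat \<rho> (A \<^bold>\<longleftrightarrow> B)" by simp
qed

theorem theorem3p8:
  shows "(RCA0\<Omega> \<turnstile> rel_st SUP_dagger_fm \<^bold>\<longleftrightarrow> N_dagger_fm) \<and>
    (RCA0\<Omega> \<union> QFAC ty2 \<turnstile> MUC_fm \<^bold>\<longleftrightarrow> SUP_fm) \<and>
    (RCA0\<Omega> \<union> QFAC ty2 \<turnstile> SUP_fm \<^bold>\<longleftrightarrow> rel_st SUP_fm) \<and>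
    (RCA0\<Omega> \<union> QFAC ty2 \<turnstile> rel_st SUP_fm \<^bold>\<longleftrightarrow> N_fm) \<and>
    (RCA0\<Omega> \<union> QFAC ty2 \<turnstile> N_fm \<^bold>\<longleftrightarrow> SUP_dagger_fm) \<and>
    (RCA0\<Omega> \<union> QFAC ty2 \<turnstile> SUP_dagger_fm \<^bold>\<longleftrightarrow> N_dagger_fm)"
proof -
  have dagger: "RCA0\<Omega> \<turnstile> rel_st SUP_dagger_fm \<^bold>\<longleftrightarrow> N_dagger_fm"
  proof (rule rca_iff)
    fix D :: "ty \<Rightarrow> trm set set" and ap cn sd \<rho>
    assume "rca_model RCA0\<Omega> D ap cn sd"
    then interpret rca_model RCA0\<Omega> D ap cn sd .
    show "sat \<rho> (rel_st SUP_dagger_fm) \<longleftrightarrow> sat \<rho> N_dagger_fm"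
      using N_dagger_imp_SUP_dagger_st SUP_dagger_st_imp_N_dagger by blast
  qed (simp_all add: wff_rel_st)
  let ?P = "{MUC_fm, SUP_fm, rel_st SUP_fm, N_fm, SUP_dagger_fm, N_dagger_fm}"
  have "RCA0\<Omega> \<union> QFAC ty2 \<turnstile> A \<^bold>\<longleftrightarrow> B" if AB: "A \<in> ?P" "B \<in> ?P" for A B
  proof (rule rca_iff)
    show "wff A" "wff B" using AB by (auto simp: wff_rel_st)
    fix D :: "ty \<Rightarrow> trm set set" and ap cn sd \<rho>
    assume "rca_model (RCA0\<Omega> \<union> QFAC ty2) D ap cn sd"
    then interpret rca_qfac_model "RCA0\<Omega> \<union> QFAC ty2" D ap cn sd
      by (simp add: rca_qfac_model_def rca_qfac_model_axioms_def)
    \<comment> \<open>Two routes lead from \<open>MUC_fm\<close> to \<open>SUP_fm\<close>, from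
      which \<open>MUC_fm\<close> returns: one through \<open>N_dagger_fm\<close>,
      \<open>N_fm\<close> and \<open>rel_st SUP_fm\<close>, the other through
      \<open>SUP_dagger_fm\<close>.\<close>
    have "sat \<rho> A \<longleftrightarrow> sat \<rho> MUC_fm" if "A \<in> ?P" for A
      using that MUC_imp_N_dagger N_dagger_imp_N N_imp_SUP_st SUP_st_imp_SUP SUP_imp_MUC
        MUC_imp_SUP_dagger SUP_dagger_imp_SUP by blast
    then show "sat \<rho> A \<longleftrightarrow> sat \<rho> B" using AB by blast
  qed simp
  with dagger show ?thesis by simp
qed

end
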